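(* Let $q,m\in\{1,2,\dots\}$, let $U^{(1)},\dots,U^{(m)}$ be linearly independent real skew-symmetric $q\times q$ matrices, and let $\mathrm{P}_h^{\{k\}}$ be as defined in the context. Then $\mathrm{P}_h^{\{k\}}(X,T)>0$ for all $k\in\{0,1,2,\dots\}$, $h>0$, $X\in\mathbb{R}^q$ and $T\in\mathbb{R}^m$.
   Context: For $\lambda\in\mathbb{R}^m$, $U(\lambda)=i\sum_{j=1}^m\lambda_jU^{(j)}$, a Hermitian $q\times q$ matrix; functions of $U(\lambda)$ are defined by functional calculus. For $k\in\{0,1,2,\dots\}$, $I_{k+1/2}$ is the modified Bessel function, $\mathrm{Q}_k(z)=z^{-(k+1/2)}I_{k+1/2}(z)$ (an even entire function, positive on $\mathbb{R}$), and $\mathrm{R}_k(z)=z^2\,\frac{\mathrm{Q}_{k+1}(z)}{\mathrm{Q}_k(z)}$. For $h>0$ and $(X,T)\in\mathbb{R}^q\times\mathbb{R}^m$, $$\mathrm{P}_h^{\{k\}}(X,T)=h^{-\frac{(k+1)q}{2}-m}\int_{\mathbb{R}^m}\big(\det\mathrm{Q}_k(U(\lambda))\big)^{-1/2}\exp\Big\{-\frac{\langle\mathrm{R}_k(U(\lambda))X,X\rangle-2i\,T\cdot\lambda}{2h}\Big\}\,d\lambda .$$ *)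

theory Defs
  imports "HOL-Complex_Analysis.Complex_Analysis"
begin

section \<open>The functions \<open>Q\<^sub>k\<close> and \<open>R\<^sub>k\<close>\<close>

definition bessel_I :: "complex \<Rightarrow> complex \<Rightarrow> complex" where
  "bessel_I \<nu> z =
     (z / 2) powr \<nu> * (\<Sum>n. (z / 2) ^ (2 * n) / (fact n * Gamma (\<nu> + of_nat n + 1)))"

text \<open>
  With principal branches, \<open>z powr (- (k + 1/2)) * bessel_I (k + 1/2) z\<close> agrees off \<open>0\<close> with an
  entire function: the branch cuts of the two factors cancel. Its value at \<open>0\<close>, where
  \<open>0 powr _ = 0\<close> would give \<open>0\<close>, has to be restored by continuity
  (see \<open>bessel_Q_eq_series\<close>).
\<close>

definition bessel_Q :: "nat \<Rightarrow> complex \<Rightarrow> complex" where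
  "bessel_Q k =
     remove_sings (\<lambda>z. z powr (- (of_nat k + 1 / 2)) * bessel_I (of_nat k + 1 / 2) z)"

definition bessel_R :: "nat \<Rightarrow> complex \<Rightarrow> complex" where
  "bessel_R k z = z\<^sup>2 * (bessel_Q (Suc k) z / bessel_Q k z)"

definition Q_coeff :: "nat \<Rightarrow> nat \<Rightarrow> real" where
  "Q_coeff k n = 1 / (fact n * Gamma (real k + 1 / 2 + real n + 1))"

lemma Gamma_half_pos: "Gamma (real k + 1 / 2 + real n + 1) > 0"
  by (rule Gamma_real_pos) simp

lemma Gamma_half_mono: "Gamma (real k + 1 / 2 + 1) \<le> Gamma (real k + 1 / 2 + real n + 1)"
proof (induction n)
  case (Suc n)
  let ?x = "real k + 1 / 2 + real n + 1"
  have "?x > 0" by simp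
  then have "?x \<notin> \<int>\<^sub>\<le>\<^sub>0" by (auto elim!: nonpos_Ints_cases)
  then have "Gamma (?x + 1) = ?x * Gamma ?x"
    by (rule Gamma_plus1)
  moreover have "1 * Gamma ?x \<le> ?x * Gamma ?x"
    using Gamma_half_pos[of k n] by (intro mult_right_mono) auto
  ultimately have "Gamma ?x \<le> Gamma (?x + 1)" by linarith
  moreover have "real k + 1 / 2 + real (Suc n) + 1 = ?x + 1" by simp
  ultimately show ?case using Suc by (simp only:)
qed simp

lemma Q_coeff_pos: "Q_coeff k n > 0"
  using Gamma_half_pos[of k n] by (simp add: Q_coeff_def)

lemma Q_coeff_le: "Q_coeff k n \<le> (1 / Gamma (real k + 1 / 2 + 1)) / fact n"
proof -
  have "fact n * Gamma (real k + 1 / 2 + 1) \<le> fact n * Gamma (real k + 1 / 2 + real n + 1)"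
    using Gamma_half_mono[of k n] by (intro mult_left_mono) auto
  moreover have "fact n * Gamma (real k + 1 / 2 + 1) > 0"
    using Gamma_half_pos[of k 0] by simp
  ultimately have "1 / (fact n * Gamma (real k + 1 / 2 + real n + 1)) \<le>
      1 / (fact n * Gamma (real k + 1 / 2 + 1))"
    by (intro divide_left_mono mult_pos_pos) (use Gamma_half_pos[of k n] in auto)
  then show ?thesis by (simp add: Q_coeff_def mult.commute)
qed

lemma of_real_Q_coeff:
  "complex_of_real (Q_coeff k n) =
     1 / (fact n * Gamma (of_nat k + 1 / 2 + of_nat n + 1))"
proof -
  have "complex_of_real (Gamma (real k + 1 / 2 + real n + 1)) =
      Gamma (complex_of_real (real k + 1 / 2 + real n + 1))"
    by (rule Gamma_complex_of_real[symmetric])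
  then show ?thesis
    by (simp add: Q_coeff_def)
qed

lemma summable_Q_coeff: "summable (\<lambda>n. complex_of_real (Q_coeff k n) * w ^ n)"
proof (rule summable_comparison_test')
  show "summable (\<lambda>n. (1 / Gamma (real k + 1 / 2 + 1)) * (inverse (fact n) * norm w ^ n))"
    by (intro summable_mult summable_exp)
  fix n :: nat
  have "norm (complex_of_real (Q_coeff k n) * w ^ n) = Q_coeff k n * norm w ^ n"
    using Q_coeff_pos[of k n] by (simp add: norm_mult norm_power)
  also have "\<dots> \<le> ((1 / Gamma (real k + 1 / 2 + 1)) / fact n) * norm w ^ n"
    by (intro mult_right_mono Q_coeff_le) auto
  finally show "norm (complex_of_real (Q_coeff k n) * w ^ n) \<le>
      (1 / Gamma (real k + 1 / 2 + 1)) * (inverse (fact n) * norm w ^ n)"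
    by (simp add: field_simps)
qed

theorem bessel_Q_eq_series:
  "bessel_Q k z =
     2 powr (- (of_nat k + 1 / 2)) * (\<Sum>n. complex_of_real (Q_coeff k n) * (z\<^sup>2 / 4) ^ n)"
proof -
  let ?\<nu> = "of_nat k + 1 / 2 :: complex"
  let ?S = "\<lambda>w. \<Sum>n. complex_of_real (Q_coeff k n) * w ^ n"
  let ?f = "\<lambda>z. z powr (- ?\<nu>) * bessel_I ?\<nu> z"
  let ?g = "\<lambda>z. 2 powr (- ?\<nu>) * ?S (z\<^sup>2 / 4)"
  have eq: "?f w = ?g w" if "w \<noteq> 0" for w
  proof -
    have "(w / 2) powr ?\<nu> = w powr ?\<nu> * 2 powr (- ?\<nu>)"
    proof -
      have "Ln (w / 2) = Ln w - of_real (ln 2)"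
        using Ln_divide_of_real[of 2 w] that by simp
      moreover have "Ln 2 = of_real (ln 2)"
        using Ln_of_real[of 2] by simp
      ultimately have L: "Ln (w / 2) = Ln w - Ln 2" by simp
      show ?thesis
        using that by (simp add: powr_def L exp_add[symmetric]) (simp add: algebra_simps)
    qed
    moreover have "w powr (- ?\<nu>) * w powr ?\<nu> = 1"
      using that by (simp add: powr_minus del: minus_add_distrib)
    moreover have "(w / 2) ^ (2 * n) / (fact n * Gamma (?\<nu> + of_nat n + 1)) =
        complex_of_real (Q_coeff k n) * (w\<^sup>2 / 4) ^ n" for n
      unfolding of_real_Q_coeff by (simp add: power_mult power_divide)
    ultimately show ?thesis
      unfolding bessel_I_def by (simp add: mult.assoc[symmetric])
  qed
  have "isCont ?S w" for w
  proof (rule isCont_powser)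
    show "summable (\<lambda>n. complex_of_real (Q_coeff k n) * (of_real (norm w) + 1) ^ n)"
      by (rule summable_Q_coeff)
    have "norm (complex_of_real (norm w) + 1) = norm w + 1"
      by (metis abs_of_nonneg add_nonneg_nonneg norm_ge_zero norm_of_real of_real_1 of_real_add
          zero_le_one)
    then show "norm w < norm (complex_of_real (norm w) + 1)" by simp
  qed
  then have "isCont (\<lambda>z. ?S (z\<^sup>2 / 4)) z"
    using isCont_o2[of z "\<lambda>z. z\<^sup>2 / 4" ?S] by simp
  then have "isCont ?g z"
    by (intro continuous_intros)
  then have "?g \<midarrow>z\<rightarrow> ?g z"
    by (simp add: isCont_def)
  moreover have "eventually (\<lambda>w. ?g w = ?f w) (at z)"
    using eventually_neq_at_within[of 0 z UNIV] by eventually_elim (use eq in auto)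
  ultimately have "?f \<midarrow>z\<rightarrow> ?g z"
    by (rule Lim_transform_eventually)
  then show ?thesis
    unfolding bessel_Q_def by (rule remove_sings_eqI)
qed

lemma bessel_Q_pos:
  fixes x :: real
  obtains y :: real where "bessel_Q k (of_real x) = of_real y" "y > 0"
proof
  let ?a = "\<lambda>n. Q_coeff k n * (x\<^sup>2 / 4) ^ n"
  let ?y = "2 powr (- (real k + 1 / 2)) * (\<Sum>n. ?a n)"
  have "summable (\<lambda>n. complex_of_real (?a n))"
    using summable_Q_coeff[of k "of_real (x\<^sup>2 / 4)"] by simp
  then have s: "summable ?a"
    by (simp only: summable_of_real_iff)
  have "0 < Q_coeff k 0" by (rule Q_coeff_pos)
  also have "Q_coeff k 0 = (\<Sum>n<1. ?a n)" by simp
  also have "\<dots> \<le> (\<Sum>n. ?a n)"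
    using Q_coeff_pos[of k] by (intro sum_le_suminf s) (auto intro!: mult_nonneg_nonneg simp: less_imp_le)
  finally show "?y > 0" by simp
  have "complex_of_real (2 powr (- (real k + 1 / 2))) = 2 powr (- (of_nat k + 1 / 2))"
    using powr_of_real[of 2 "- (real k + 1 / 2)"] by simp
  then show "bessel_Q k (of_real x) = of_real ?y"
    using suminf_of_real[OF s, where ?'a = complex] by (simp add: bessel_Q_eq_series)
qed

lemma bessel_Q_even: "bessel_Q k (- z) = bessel_Q k z"
  by (simp add: bessel_Q_eq_series)

section \<open>Functional calculus for normal matrices\<close>

definition adjoint_mat :: "complex^'n^'m \<Rightarrow> complex^'m^'n" where
  "adjoint_mat A = (\<chi> i j. cnj (A $ j $ i))"

definition unitary_mat :: "complex^'n^'n \<Rightarrow> bool" where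
  "unitary_mat V \<longleftrightarrow> V ** adjoint_mat V = mat 1 \<and> adjoint_mat V ** V = mat 1"

definition diag_mat :: "('n \<Rightarrow> complex) \<Rightarrow> complex^'n^'n" where
  "diag_mat d = (\<chi> i j. if i = j then d i else 0)"

text \<open>
  \<open>f(V D V\<^sup>*) = V f(D) V\<^sup>*\<close>, for any unitary diagonalization of \<open>A\<close>; the result does not
  depend on the choice of the diagonalization (see \<open>mat_fun_diag\<close>). Unspecified if \<open>A\<close> is not normal.
\<close>

definition mat_fun :: "(complex \<Rightarrow> complex) \<Rightarrow> complex^'n^'n \<Rightarrow> complex^'n^'n" where
  "mat_fun f A = (THE B. \<exists>V d. unitary_mat V \<and> A = V ** diag_mat d ** adjoint_mat V \<and>
     B = V ** diag_mat (f \<circ> d) ** adjoint_mat V)"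

lemma diag_mat_mult_nth:
  fixes M :: "complex^'n^'n"
  shows "(M ** diag_mat d) $ i $ j = M $ i $ j * d j" "(diag_mat d ** M) $ i $ j = d i * M $ i $ j"
proof -
  have *: "M $ i $ k * (if k = j then d k else 0) = (if k = j then M $ i $ j * d j else 0)"
    "(if i = k then d i else 0) * M $ k $ j = (if i = k then d i * M $ i $ j else 0)" for k
    by auto
  show "(M ** diag_mat d) $ i $ j = M $ i $ j * d j"
    "(diag_mat d ** M) $ i $ j = d i * M $ i $ j"
    by (simp_all add: matrix_matrix_mult_def diag_mat_def *)
qed

theorem mat_fun_diag:
  assumes V: "unitary_mat V" and A: "A = V ** diag_mat d ** adjoint_mat V"
  shows "mat_fun f A = V ** diag_mat (f \<circ> d) ** adjoint_mat V"
  unfolding mat_fun_def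
proof (rule the_equality)
  show "\<exists>V' d'. unitary_mat V' \<and> A = V' ** diag_mat d' ** adjoint_mat V' \<and>
      V ** diag_mat (f \<circ> d) ** adjoint_mat V = V' ** diag_mat (f \<circ> d') ** adjoint_mat V'"
    using assms by blast
next
  fix B assume "\<exists>V' d'. unitary_mat V' \<and> A = V' ** diag_mat d' ** adjoint_mat V' \<and>
      B = V' ** diag_mat (f \<circ> d') ** adjoint_mat V'"
  then obtain W e where W: "unitary_mat W" and A': "A = W ** diag_mat e ** adjoint_mat W"
    and B: "B = W ** diag_mat (f \<circ> e) ** adjoint_mat W" by blast
  define M where "M = adjoint_mat W ** V"
  have V1: "V ** adjoint_mat V = mat 1" "adjoint_mat V ** V = mat 1"
    and W1: "W ** adjoint_mat W = mat 1" "adjoint_mat W ** W = mat 1"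
    using V W by (auto simp: unitary_mat_def)
  have "M ** diag_mat d = adjoint_mat W ** A ** V"
    by (simp add: A M_def matrix_mul_assoc[symmetric] V1)
  also have "\<dots> = diag_mat e ** M"
    by (simp add: A' M_def matrix_mul_assoc W1)
  finally have "M ** diag_mat d = diag_mat e ** M" .
  then have eq: "M $ i $ j * d j = e i * M $ i $ j" for i j
    by (metis diag_mat_mult_nth)
  have "M $ i $ j * f (d j) = f (e i) * M $ i $ j" for i j
    using eq[of i j] by (cases "M $ i $ j = 0") (auto simp: mult.commute)
  then have "M ** diag_mat (f \<circ> d) = diag_mat (f \<circ> e) ** M"
    by (simp add: vec_eq_iff diag_mat_mult_nth)
  then have "W ** (M ** diag_mat (f \<circ> d)) ** adjoint_mat V =
      W ** (diag_mat (f \<circ> e) ** M) ** adjoint_mat V" by simp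
  moreover have "W ** (M ** diag_mat (f \<circ> d)) ** adjoint_mat V =
      V ** diag_mat (f \<circ> d) ** adjoint_mat V"
    by (simp add: M_def matrix_mul_assoc W1)
  moreover have "W ** (diag_mat (f \<circ> e) ** M) ** adjoint_mat V = B"
    by (simp add: B M_def matrix_mul_assoc[symmetric] V1)
  ultimately show "B = V ** diag_mat (f \<circ> d) ** adjoint_mat V" by simp
qed

section \<open>The kernels \<open>P\<^sub>h\<^sup>k\<close>\<close>

definition U_pencil :: "('m::finite \<Rightarrow> real^'q^'q) \<Rightarrow> real^'m \<Rightarrow> complex^'q^'q" where
  "U_pencil U l = (\<chi> a b. \<i> * complex_of_real ((\<Sum>j\<in>UNIV. l $ j *\<^sub>R U j) $ a $ b))"

definition complexify :: "real^'q \<Rightarrow> complex^'q" where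
  "complexify X = (\<chi> a. complex_of_real (X $ a))"

definition hermitian_inner :: "complex^'q \<Rightarrow> complex^'q \<Rightarrow> complex" where
  "hermitian_inner x y = (\<Sum>a\<in>UNIV. x $ a * cnj (y $ a))"

text \<open>
  The power \<open>-1/2\<close> is a principal value; for skew-symmetric \<open>U j\<close> its base is a positive real number.
\<close>

definition P_kernel ::
    "('m::finite \<Rightarrow> real^'q^'q) \<Rightarrow> nat \<Rightarrow> real \<Rightarrow> real^'q \<Rightarrow> real^'m \<Rightarrow> complex" where
  "P_kernel U k h X T =
     complex_of_real (h powr (- (real (k + 1) * real CARD('q) / 2) - real CARD('m))) *
     (LINT l|lborel.
        det (mat_fun (bessel_Q k) (U_pencil U l)) powr (- 1 / 2) *
        exp (- (hermitian_inner (mat_fun (bessel_R k) (U_pencil U l) *v complexify X) (complexify X)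
                 - 2 * \<i> * complex_of_real (T \<bullet> l))
             / complex_of_real (2 * h)))"

end

(*
  Write Q_k(z) = 2^(-k-1/2) S_k(z^2/4), so that S_k' = S_(k+1) and R_k(z) = 2 w S_k'(w) / S_k(w) with
  w = z^2/4. By the product formula for sinh, S_0 is a limit of polynomials with simple negative
  roots; by Rolle the same holds for its derivatives S_k, and the roots only move away from 0. Hence
  S_k(w) = S_k(0) prod_n (1 + u_n w) for some summable u_n >= 0. With A = sum_j l_j U_j, w stands for
  A^T A / 4, and up to a constant the integrand without its phase is a product over n of
    det(1 + u_n w)^(-1/2) exp(-<u_n w (1 + u_n w)^(-1) X, X> / h)
      = E exp(-u_n |A (g_n + sqrt(2/h) X)|^2 / 8),
  g_n a standard Gaussian vector. So, as a function of l, it is a mixture of centred Gaussians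
  exp(-q(l)), q a random quadratic form. The integrand is integrable, so almost every q is positive
  definite, and then the Fourier transform of exp(-q) is positive everywhere.
*)
theory Submission
  imports Defs "HOL-Probability.Probability"
begin

no_notation fps_nth (infixl \<open>$\<close> 75)

section \<open>Zeros of the Bessel functions\<close>

text \<open>A positive integrand may well have a Fourier transform that changes sign, so the
  integrand has to be split into pieces whose transforms are positive at every \<open>T\<close>. The
  obstacle is that the matrices \<open>U j\<close> need not commute: no single basis diagonalizes
  \<open>U_pencil U l\<close> for all \<open>l\<close>, and the dependence on \<open>l\<close> is
  not explicit. Gaussian averaging removes it. For a fixed vector \<open>v\<close>,
  \<open>pencil U l *v v\<close> is linear in \<open>l\<close>, so its squared norm is a quadratic
  form in \<open>l\<close> whatever the commutation relations. An eigenbasis of the pencil serves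
  only to verify the identity at one \<open>l\<close>; the quadratic forms are diagonalized
  separately, in the \<open>l\<close>-space and for a fixed sample. Gaussian integrals produce
  factors \<open>1 + u * w\<close> with \<open>u \<ge> 0\<close>, hence the interest in real
  negative zeros. Skew-symmetry enters through \<open>(i A)^2 = A^T A\<close>: the functions
  \<open>Q_k\<close> and \<open>R_k\<close> are even, so only this real symmetric matrix matters.
  Linear independence makes the norm of \<open>pencil U l\<close> grow like that of
  \<open>l\<close>, which gives the integrability.\<close>

definition bessel_S :: "nat \<Rightarrow> complex \<Rightarrow> complex" where
  "bessel_S k w = (\<Sum>n. complex_of_real (Q_coeff k n) * w ^ n)"

definition bessel_s :: "nat \<Rightarrow> real \<Rightarrow> real" where
  "bessel_s k x = (\<Sum>n. Q_coeff k n * x ^ n)"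

lemma summable_Q_coeff_real: "summable (\<lambda>n. Q_coeff k n * (x::real) ^ n)"
proof -
  have "summable (\<lambda>n. complex_of_real (Q_coeff k n * x ^ n))"
    using summable_Q_coeff[of k "of_real x"] by simp
  then show ?thesis by (simp only: summable_of_real_iff)
qed

lemma bessel_S_of_real: "bessel_S k (of_real x) = of_real (bessel_s k x)"
  using suminf_of_real[OF summable_Q_coeff_real, where ?'a = complex]
  by (simp add: bessel_S_def bessel_s_def)

lemma bessel_s_0: "bessel_s k 0 = Q_coeff k 0"
  by (simp add: bessel_s_def)

text \<open>The Gamma value depends only on \<open>k + n\<close>, so raising \<open>n\<close> by one
  amounts to raising \<open>k\<close> by one, and the factor \<open>n + 1\<close> from
  differentiation cancels against the factorial.\<close>

lemma diffs_Q_coeff: "diffs (\<lambda>n. complex_of_real (Q_coeff k n)) = (\<lambda>n. of_real (Q_coeff (Suc k) n))"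
proof
  fix n
  have "real k + 1 / 2 + real (Suc n) + 1 = real (Suc k) + 1 / 2 + real n + 1" by simp
  then have "real (Suc n) * Q_coeff k (Suc n) = Q_coeff (Suc k) n"
    unfolding Q_coeff_def by (simp only: fact_Suc) (simp add: field_simps del: of_nat_Suc)
  then show "diffs (\<lambda>n. complex_of_real (Q_coeff k n)) n = of_real (Q_coeff (Suc k) n)"
    unfolding diffs_def by (metis of_real_mult of_real_of_nat_eq)
qed

lemma bessel_S_has_field_derivative: "(bessel_S k has_field_derivative bessel_S (Suc k) w) (at w)"
proof -
  have "((\<lambda>w. \<Sum>n. complex_of_real (Q_coeff k n) * w ^ n) has_field_derivative
      (\<Sum>n. diffs (\<lambda>n. complex_of_real (Q_coeff k n)) n * w ^ n)) (at w)"
    by (rule termdiffs_strong_converges_everywhere) (rule summable_Q_coeff)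
  then show ?thesis unfolding diffs_Q_coeff bessel_S_def[abs_def] .
qed

lemma higher_deriv_bessel_S: "(deriv ^^ k) (bessel_S 0) = bessel_S k"
  by (induction k) (auto intro!: ext DERIV_imp_deriv bessel_S_has_field_derivative)

lemma bessel_s_pos: "x \<ge> 0 \<Longrightarrow> bessel_s k x > 0"
proof -
  assume x: "x \<ge> 0"
  have "0 < Q_coeff k 0" by (rule Q_coeff_pos)
  also have "Q_coeff k 0 = (\<Sum>n<1. Q_coeff k n * x ^ n)" by simp
  also have "\<dots> \<le> (\<Sum>n. Q_coeff k n * x ^ n)"
    using Q_coeff_pos[of k] x
    by (intro sum_le_suminf summable_Q_coeff_real) (auto intro!: mult_nonneg_nonneg simp: less_imp_le)
  finally show ?thesis by (simp add: bessel_s_def)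
qed

text \<open>The duplication formula for Gamma merges \<open>fact n\<close> and the Gamma value into
  one odd factorial, so that \<open>bessel_S 0\<close> becomes a rescaled sinh series.\<close>

lemma Q_coeff_0: "Q_coeff 0 n = 2 ^ (2 * n + 1) / (sqrt pi * fact (2 * n + 1))"
proof -
  have "fact n * Gamma (real n + 3 / 2) = sqrt pi * fact (2 * n + 1) / 2 ^ (2 * n + 1)"
  proof (induction n)
    case 0
    have "Gamma (1 / 2 + 1 :: real) = 1 / 2 * Gamma (1 / 2)"
      by (rule Gamma_plus1) (auto elim!: nonpos_Ints_cases)
    then show ?case by (simp add: Gamma_one_half_real)
  next
    case (Suc n)
    have "Gamma (real n + 3 / 2 + 1) = (real n + 3 / 2) * Gamma (real n + 3 / 2)"
      by (rule Gamma_plus1) (auto elim!: nonpos_Ints_cases)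
    moreover have "real (Suc n) + 3 / 2 = real n + 3 / 2 + 1" by simp
    ultimately have "fact (Suc n) * Gamma (real (Suc n) + 3 / 2) =
        real (Suc n) * (real n + 3 / 2) * (fact n * Gamma (real n + 3 / 2))"
      by (simp only: fact_Suc) (simp add: mult_ac)
    also have "\<dots> = real (Suc n) * (real n + 3 / 2) * (sqrt pi * fact (2 * n + 1) / 2 ^ (2 * n + 1))"
      by (simp only: Suc)
    also have "\<dots> = sqrt pi * fact (2 * Suc n + 1) / 2 ^ (2 * Suc n + 1)"
      by (simp add: field_simps)
    finally show ?case .
  qed
  moreover have "real 0 + 1 / 2 + real n + 1 = real n + 3 / 2" by simp
  ultimately show ?thesis
    unfolding Q_coeff_def by (simp only:) simp
qed

text \<open>Up to a constant \<open>bessel_S 0 w\<close> is \<open>sinh (2 * sqrt w) / (2 * sqrt w)\<close>, with zeros \<open>- 1 / sinh_inv_root i\<close>.\<close>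

definition sinh_inv_root :: "nat \<Rightarrow> real" where
  "sinh_inv_root i = 4 / (pi\<^sup>2 * real (Suc i) ^ 2)"

text \<open>With \<open>w = - z^2 / 4\<close> real \<open>z\<close> give negative \<open>w\<close>,
  where the zeros lie, and sinh turns into the sine, to which Euler's product applies.\<close>

lemma bessel_S_0_sin:
  assumes "z \<noteq> 0"
  shows "bessel_S 0 (- (z\<^sup>2) / 4) = of_real (2 / sqrt pi) * (sin z / z)"
proof -
  have "(\<lambda>n. sin_coeff n *\<^sub>R z ^ n) sums sin z" by (rule sin_converges)
  \<comment> \<open>The even coefficients of the sine series vanish, so the sum may run over odd
    indices only.\<close>
  then have "(\<lambda>n. sin_coeff (2 * n + 1) *\<^sub>R z ^ (2 * n + 1)) sums sin z"
    by (subst sums_mono_reindex[of "\<lambda>n. 2 * n + 1"]) (auto simp: strict_mono_def sin_coeff_def elim!: oddE)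
  then have "(\<lambda>n. of_real (2 / sqrt pi) / z * (sin_coeff (2 * n + 1) *\<^sub>R z ^ (2 * n + 1))) sums
      (of_real (2 / sqrt pi) / z * sin z)"
    by (rule sums_mult)
  moreover have "of_real (2 / sqrt pi) / z * (sin_coeff (2 * n + 1) *\<^sub>R z ^ (2 * n + 1)) =
      of_real (Q_coeff 0 n) * (- (z\<^sup>2) / 4) ^ n" for n
  proof -
    have p: "2 ^ (2 * n + 1) = (2 * 4 ^ n :: real)" by (simp add: power_mult)
    have sc: "sin_coeff (2 * n + 1) = (- 1) ^ n / fact (2 * n + 1)"
      by (simp add: sin_coeff_def)
    have zp: "z ^ (2 * n + 1) = z * (z\<^sup>2) ^ n" by (simp add: power_mult)
    have mp: "(- (z\<^sup>2) / 4) ^ n = (-1) ^ n * (z\<^sup>2) ^ n / 4 ^ n"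
      by (metis mult_minus1 power_divide power_mult_distrib)
    show ?thesis
      using assms unfolding Q_coeff_0 p sc zp mp
      by (simp add: scaleR_conv_of_real field_simps del: fact_Suc)
  qed
  ultimately show ?thesis by (simp add: bessel_S_def sums_iff)
qed

lemma bessel_S_0_product:
  "(\<lambda>n. of_real (2 / sqrt pi) * (\<Prod>i<n. 1 + of_real (sinh_inv_root i) * w)) \<longlonglongrightarrow> bessel_S 0 w"
proof (cases "w = 0")
  case True
  have "bessel_S 0 0 = of_real (bessel_s 0 0)" using bessel_S_of_real[of 0 0] by simp
  then have "bessel_S 0 w = of_real (2 / sqrt pi)"
    by (simp add: True bessel_s_0 Q_coeff_0)
  then show ?thesis by (simp add: True)
next
  case False
  \<comment> \<open>Either square root would do, since \<open>sin z / z\<close> is even. Dividing by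
    \<open>pi\<close> matches Euler's factors \<open>1 - x^2 / k^2\<close>; there \<open>k\<close>
    starts at \<open>1\<close>, hence the \<open>Suc i\<close> in
    \<open>sinh_inv_root\<close>.\<close>
  define z where "z = csqrt (- 4 * w)"
  define x where "x = z / of_real pi"
  have z2: "z\<^sup>2 = - 4 * w" unfolding z_def by (rule power2_csqrt)
  have z: "z \<noteq> 0" using False z2 by auto
  have px: "of_real pi * x = z" by (simp add: x_def)
  have *: "(\<Prod>k=1..n. 1 - x\<^sup>2 / of_nat k ^ 2) = (\<Prod>i<n. 1 + of_real (sinh_inv_root i) * w)" for n
  proof -
    have "(\<Prod>k=1..n. 1 - x\<^sup>2 / of_nat k ^ 2) = (\<Prod>i<n. 1 - x\<^sup>2 / of_nat (Suc i) ^ 2)"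
      by (rule prod.reindex_bij_witness[of _ Suc "\<lambda>k. k - 1"]) auto
    also have "\<dots> = (\<Prod>i<n. 1 + of_real (sinh_inv_root i) * w)"
      by (intro prod.cong refl) (simp add: sinh_inv_root_def x_def power_divide z2 mult.commute del: of_nat_Suc)
    finally show ?thesis .
  qed
  have "(\<lambda>n. z * (\<Prod>i<n. 1 + of_real (sinh_inv_root i) * w)) \<longlonglongrightarrow> sin z"
    using sin_product_formula_complex[of x] unfolding * px .
  then have "(\<lambda>n. of_real (2 / sqrt pi) / z * (z * (\<Prod>i<n. 1 + of_real (sinh_inv_root i) * w))) \<longlonglongrightarrow>
      of_real (2 / sqrt pi) / z * sin z"
    by (rule tendsto_mult_left)
  moreover have "- (z\<^sup>2) / 4 = w" by (simp add: z2)
  ultimately show ?thesis using z bessel_S_0_sin[OF z] by simp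
qed

lemma sinh_inv_root_pos: "sinh_inv_root i > 0"
  by (simp add: sinh_inv_root_def)

text \<open>Strictness means that the zeros are simple, the property that Rolle's theorem passes on
  to derivatives.\<close>

lemma sinh_inv_root_strict_antimono: "i < j \<Longrightarrow> sinh_inv_root j < sinh_inv_root i"
  unfolding sinh_inv_root_def
  by (intro divide_strict_left_mono mult_strict_left_mono power_strict_mono mult_pos_pos) auto

lemma summable_sinh_inv_root: "summable sinh_inv_root"
proof -
  have "summable (\<lambda>n. 1 / real (Suc n) ^ 2)"
    using inverse_squares_sums by (simp add: sums_iff add.commute)
  then have "summable (\<lambda>n. 4 / pi\<^sup>2 * (1 / real (Suc n) ^ 2))"
    by (rule summable_mult)
  then show ?thesis by (simp add: sinh_inv_root_def[abs_def])
qed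

text \<open>Pointwise limits do not pass to derivatives, uniform limits of holomorphic functions on
  discs do. The product test supplies some uniform limit, and the pointwise product formula
  identifies it.\<close>

lemma uniform_limit_bessel_S_0:
  "uniform_limit (cball 0 r) (\<lambda>n w. of_real (2 / sqrt pi) * (\<Prod>i<n. 1 + of_real (sinh_inv_root i) * w))
     (bessel_S 0) sequentially"
proof -
  have "uniformly_convergent_on (cball 0 r) (\<lambda>N w::complex. \<Sum>n<N. norm (of_real (sinh_inv_root n) * w))"
  proof (rule Weierstrass_m_test')
    show "summable (\<lambda>n. sinh_inv_root n * r)" by (intro summable_mult2 summable_sinh_inv_root)
    show "norm (norm (of_real (sinh_inv_root n) * w)) \<le> sinh_inv_root n * r" if "w \<in> cball 0 r" for n and w :: complex
      using that sinh_inv_root_pos[of n] by (simp add: norm_mult)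
  qed
  then have "uniformly_convergent_on (cball 0 r) (\<lambda>N w::complex. \<Prod>n<N. 1 + of_real (sinh_inv_root n) * w)"
    by (intro uniformly_convergent_on_prod) (auto intro!: continuous_intros)
  then obtain g where g: "uniform_limit (cball 0 r)
      (\<lambda>N w::complex. \<Prod>n<N. 1 + of_real (sinh_inv_root n) * w) g sequentially"
    by (auto simp: uniformly_convergent_on_def)
  then have *: "uniform_limit (cball 0 r)
      (\<lambda>N w. of_real (2 / sqrt pi) * (\<Prod>n<N. 1 + of_real (sinh_inv_root n) * w))
      (\<lambda>w. of_real (2 / sqrt pi) * g w) sequentially"
    by (intro bounded_linear.uniform_limit[OF bounded_linear_mult_right])
  have "of_real (2 / sqrt pi) * g w = bessel_S 0 w" if "w \<in> cball 0 r" for w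
    using tendsto_uniform_limitI[OF * that] bessel_S_0_product[of w] by (rule LIMSEQ_unique)
  then show ?thesis
    by (intro iffD1[OF uniform_limit_cong' *]) auto
qed

section \<open>Polynomials with simple negative roots and their derivatives\<close>

lemma map_poly_of_real_pderiv:
  "map_poly complex_of_real (pderiv p) = pderiv (map_poly of_real p)"
  by (intro poly_eqI) (simp add: coeff_pderiv coeff_map_poly)

lemma map_poly_of_real_mult:
  "map_poly complex_of_real (p * q) = map_poly of_real p * map_poly of_real q"
  by (intro poly_eqI) (simp add: coeff_mult coeff_map_poly)

lemma poly_map_poly_of_real: "poly (map_poly complex_of_real p) (of_real x) = of_real (poly p x)"
  by (induction p) (auto simp: map_poly_pCons)

lemma higher_deriv_poly: "(deriv ^^ k) (poly p) = poly ((pderiv ^^ k) (p :: complex poly))"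
  by (induction k) (auto intro!: ext DERIV_imp_deriv poly_DERIV)

lemma map_poly_of_real_higher_pderiv:
  "map_poly complex_of_real ((pderiv ^^ k) p) = (pderiv ^^ k) (map_poly of_real p)"
  by (induction k) (auto simp: map_poly_of_real_pderiv)

definition sinh_poly :: "nat \<Rightarrow> real poly" where
  "sinh_poly n = smult (2 / sqrt pi) (\<Prod>i<n. [:1, sinh_inv_root i:])"

text \<open>Rolle's theorem lives on the real line, convergence of derivatives under uniform limits
  in the complex plane. The polynomials are therefore complexified, and the limit is read off at
  real points.\<close>

lemma higher_pderiv_sinh_poly_tendsto:
  "(\<lambda>n. poly ((pderiv ^^ k) (sinh_poly n)) x) \<longlonglongrightarrow> bessel_s k x"
proof -
  have "map_poly complex_of_real (\<Prod>i<n. [:1, sinh_inv_root i:]) = (\<Prod>i<n. [:1, of_real (sinh_inv_root i):])" for n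
    by (induction n) (simp_all add: map_poly_of_real_mult map_poly_pCons del: mult_pCons_right)
  moreover have "map_poly complex_of_real (smult c p) = smult (of_real c) (map_poly of_real p)" for c p
    by (intro poly_eqI) (simp add: coeff_map_poly)
  ultimately have *: "poly (map_poly complex_of_real (sinh_poly n)) =
      (\<lambda>w. of_real (2 / sqrt pi) * (\<Prod>i<n. 1 + of_real (sinh_inv_root i) * w))" for n
    by (auto simp: sinh_poly_def poly_prod fun_eq_iff mult.commute)
  have "(\<lambda>n. (deriv ^^ k) (poly (map_poly of_real (sinh_poly n))) (of_real x)) \<longlonglongrightarrow>
      (deriv ^^ k) (bessel_S 0) (of_real x)"
  proof (rule higher_deriv_complex_uniform_limit)
    show "uniform_limit (ball 0 (\<bar>x\<bar> + 1)) (\<lambda>n. poly (map_poly of_real (sinh_poly n))) (bessel_S 0) sequentially"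
      unfolding * by (rule uniform_limit_on_subset[OF uniform_limit_bessel_S_0[of "\<bar>x\<bar> + 1"]]) auto
  qed (auto intro!: always_eventually holomorphic_intros)
  then have "(\<lambda>n. complex_of_real (poly ((pderiv ^^ k) (sinh_poly n)) x)) \<longlonglongrightarrow> of_real (bessel_s k x)"
    unfolding higher_deriv_poly map_poly_of_real_higher_pderiv[symmetric] poly_map_poly_of_real
      higher_deriv_bessel_S bessel_S_of_real .
  then show ?thesis by (simp only: tendsto_of_real_iff)
qed

text \<open>The logarithmic derivative of the product; in the limit it becomes the series for
  \<open>bessel_s (Suc k) w / bessel_s k w\<close>.\<close>

lemma pderiv_prod_linear:
  fixes v :: "'a \<Rightarrow> real"
  assumes "finite A" "\<And>i. i \<in> A \<Longrightarrow> 1 + v i * w \<noteq> 0"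
  shows "poly (pderiv (\<Prod>i\<in>A. [:1, v i:])) w = poly (\<Prod>i\<in>A. [:1, v i:]) w * (\<Sum>i\<in>A. v i / (1 + v i * w))"
  using assms
proof (induction A)
  case (insert a A)
  let ?P = "\<Prod>i\<in>A. [:1, v i:]"
  have "poly (pderiv ([:1, v a:] * ?P)) w = (1 + v a * w) * poly (pderiv ?P) w + v a * poly ?P w"
    by (simp add: pderiv_mult pderiv_pCons mult.commute del: mult_pCons_left mult_pCons_right)
  also have "poly (pderiv ?P) w = poly ?P w * (\<Sum>i\<in>A. v i / (1 + v i * w))"
    using insert by simp
  also have "(1 + v a * w) * (poly ?P w * (\<Sum>i\<in>A. v i / (1 + v i * w))) + v a * poly ?P w =
      ((1 + v a * w) * poly ?P w) * (v a / (1 + v a * w) + (\<Sum>i\<in>A. v i / (1 + v i * w)))"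
    using insert.prems[of a] by (simp add: distrib_left)
  also have "(1 + v a * w) * poly ?P w = poly ([:1, v a:] * ?P) w"
    by (simp add: mult.commute del: mult_pCons_left mult_pCons_right)
  finally show ?case using insert.hyps by simp
qed simp

text \<open>Rolle's theorem puts a zero of the derivative strictly between the neighbouring roots
  \<open>- 1 / u (Suc i)\<close> and \<open>- 1 / u i\<close>. This gives \<open>n - 1\<close>
  distinct zeros, as many as the degree allows. Recording roots by their negative reciprocals turns
  interlacing into \<open>v i \<le> u i\<close>, which later serves as a domination.\<close>

lemma pderiv_simple_negative_roots:
  fixes u :: "nat \<Rightarrow> real"
  assumes p: "p = smult c (\<Prod>i<n. [:1, u i:])"
    and pos: "\<And>i. i < n \<Longrightarrow> u i > 0" and dec: "\<And>i j. i < j \<Longrightarrow> j < n \<Longrightarrow> u j < u i"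
  obtains d v where "pderiv p = smult d (\<Prod>i<n-1. [:1, v i:])"
    "\<And>i. i < n - 1 \<Longrightarrow> 0 < v i \<and> v i \<le> u i" "\<And>i j. i < j \<Longrightarrow> j < n - 1 \<Longrightarrow> v j < v i"
proof (cases n)
  case 0
  \<comment> \<open>A constant polynomial: the truncated \<open>n - 1\<close> is \<open>0\<close>,
    and the empty product is scaled by \<open>0\<close>.\<close>
  then have "pderiv p = smult 0 (\<Prod>i<n-1. [:1, u i:])" using p by (simp add: pderiv_smult)
  then show ?thesis using that[of 0 u] 0 by simp
next
  case (Suc m)
  have root: "poly p (- 1 / u i) = 0" if "i < n" for i
    using that pos[OF that] unfolding p by (auto simp: poly_prod intro!: bexI[of _ i])
  have "\<exists>x. - 1 / u (Suc i) < x \<and> x < - 1 / u i \<and> poly (pderiv p) x = 0" if i: "i < m" for i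
  proof -
    have "- 1 / u (Suc i) < - 1 / u i"
      using dec[of i "Suc i"] pos[of i] pos[of "Suc i"] i Suc by (simp add: field_simps)
    moreover have "poly p (- 1 / u (Suc i)) = poly p (- 1 / u i)"
      using root[of i] root[of "Suc i"] i Suc by simp
    ultimately show ?thesis
      using Rolle_deriv[of "- 1 / u (Suc i)" "- 1 / u i" "poly p" "\<lambda>x y. poly (pderiv p) x * y"]
      by (auto simp: continuous_on_poly has_field_derivative_imp_has_derivative poly_DERIV fun_eq_iff
          intro!: continuous_intros)
  qed
  then obtain x where x: "\<And>i. i < m \<Longrightarrow> - 1 / u (Suc i) < x i" "\<And>i. i < m \<Longrightarrow> x i < - 1 / u i"
    "\<And>i. i < m \<Longrightarrow> poly (pderiv p) (x i) = 0" by metis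
  define v where "v i = - 1 / x i" for i
  have neg: "x i < 0" if "i < m" for i
    using x(2)[OF that] pos[of i] that Suc by (smt (verit) divide_neg_pos less_SucI)
  \<comment> \<open>The lower neighbour \<open>u (Suc i)\<close> separates consecutive values and so
    yields the strict decrease of \<open>v\<close>.\<close>
  have v: "0 < v i" "v i < u i" "u (Suc i) < v i" if "i < m" for i
    using neg[OF that] x(1,2)[OF that] pos[of i] pos[of "Suc i"] that Suc
    by (auto simp: v_def field_simps)
  have vdec: "v j < v i" if "i < j" "j < m" for i j
  proof -
    have "v j < u j" using v that by simp
    also have "u j \<le> u (Suc i)" using dec[of "Suc i" j] that Suc by (cases "j = Suc i") auto
    also have "\<dots> < v i" using v that by simp
    finally show ?thesis .
  qed
  define d where "d = poly (pderiv p) 0"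
  have xinj: "inj_on x {..<m}"
    using vdec by (intro linorder_inj_onI) (force simp: v_def)+
  have deg: "degree (\<Prod>i<k. [:1, f i:]) \<le> k" for k and f :: "nat \<Rightarrow> real"
    using degree_prod_sum_le[of "{..<k}" "\<lambda>i. [:1, f i:]"] sum_bounded_above[of "{..<k}" "\<lambda>i. degree [:1, f i:]" 1]
    by (simp add: le_trans)
  \<comment> \<open>Both sides have degree at most \<open>m\<close> and agree at
    \<open>m + 1\<close> points: the \<open>m\<close> zeros, and \<open>0\<close>, where
    \<open>d\<close> was chosen to fit.\<close>
  have "pderiv p = smult d (\<Prod>i<m. [:1, v i:])"
  proof (rule poly_eqI_degree)
    fix y assume y: "y \<in> insert 0 (x ` {..<m})"
    show "poly (pderiv p) y = poly (smult d (\<Prod>i<m. [:1, v i:])) y"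
    proof (cases "y = 0")
      case True then show ?thesis by (simp add: d_def poly_prod)
    next
      case False
      then obtain i where i: "i < m" "y = x i" using y by auto
      then have "1 + y * v i = 0" using neg[OF i(1)] by (simp add: v_def)
      then have "(\<Prod>i<m. 1 + y * v i) = 0" using i(1) by auto
      then show ?thesis using x(3)[OF i(1)] i by (simp add: poly_prod)
    qed
  next
    have "0 \<notin> x ` {..<m}" using neg by fastforce
    then have c: "card (insert 0 (x ` {..<m})) = Suc m" by (simp add: card_image[OF xinj])
    have "degree p \<le> Suc m" unfolding p using deg[where k = n and f = u] Suc by (simp add: degree_smult_eq)
    then have "degree (pderiv p) \<le> m" by (simp add: degree_pderiv)
    then show "degree (pderiv p) < card (insert 0 (x ` {..<m}))" using c by simp
    show "degree (smult d (\<Prod>i<m. [:1, v i:])) < card (insert 0 (x ` {..<m}))"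
      using c deg[where k = m and f = v] by (simp add: degree_smult_eq)
  qed
  then show ?thesis using that[of d v] v vdec Suc by (simp add: less_imp_le)
qed

lemma higher_pderiv_simple_negative_roots:
  fixes u :: "nat \<Rightarrow> real"
  assumes p: "p = smult c (\<Prod>i<n. [:1, u i:])"
    and pos: "\<And>i. i < n \<Longrightarrow> u i > 0" and dec: "\<And>i j. i < j \<Longrightarrow> j < n \<Longrightarrow> u j < u i"
  shows "\<exists>d v. (pderiv ^^ k) p = smult d (\<Prod>i<n-k. [:1, v i:]) \<and>
    (\<forall>i < n - k. 0 < v i \<and> v i \<le> u i) \<and> (\<forall>i j. i < j \<longrightarrow> j < n - k \<longrightarrow> v j < v i)"
proof (induction k)
  case 0
  then show ?case using assms by (auto intro!: exI[of _ c] exI[of _ u])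
next
  case (Suc k)
  then obtain d v where IH: "(pderiv ^^ k) p = smult d (\<Prod>i<n-k. [:1, v i:])"
    "\<And>i. i < n - k \<Longrightarrow> 0 < v i \<and> v i \<le> u i" "\<And>i j. i < j \<Longrightarrow> j < n - k \<Longrightarrow> v j < v i"
    by metis
  obtain e w where "pderiv ((pderiv ^^ k) p) = smult e (\<Prod>i<n-k-1. [:1, w i:])"
    "\<And>i. i < n - k - 1 \<Longrightarrow> 0 < w i \<and> w i \<le> v i" "\<And>i j. i < j \<Longrightarrow> j < n - k - 1 \<Longrightarrow> w j < w i"
  proof (rule pderiv_simple_negative_roots[OF IH(1)])
    show "0 < v i" if "i < n - k" for i using IH(2) that by blast
    show "v j < v i" if "i < j" "j < n - k" for i j using IH(3) that by blast
  qed blast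
  then have w: "(pderiv ^^ Suc k) p = smult e (\<Prod>i<n-Suc k. [:1, w i:])"
    "\<And>i. i < n - Suc k \<Longrightarrow> 0 < w i \<and> w i \<le> v i" "\<And>i j. i < j \<Longrightarrow> j < n - Suc k \<Longrightarrow> w j < w i"
    by simp_all
  have "w i \<le> u i" if "i < n - Suc k" for i
    using w(2)[OF that] IH(2)[of i] that by linarith
  with w show ?case by blast
qed

text \<open>Compactness replaces a study of the zeros of \<open>bessel_s k\<close>. The
  \<open>i\<close>-th reciprocal roots of the approximating polynomials lie in
  \<open>[0, sinh_inv_root i]\<close>, so along a diagonal subsequence all of them converge. The
  same summable bound dominates the logarithms (up to the factor \<open>w\<close>) and the
  logarithmic derivatives, so both formulas survive the limit with one and the same sequence
  \<open>l\<close>.\<close>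

theorem bessel_s_product:
  obtains l :: "nat \<Rightarrow> real" where "\<And>i. l i \<ge> 0" "summable l"
    "\<And>w. w \<ge> 0 \<Longrightarrow> bessel_s k w = bessel_s k 0 * exp (\<Sum>i. ln (1 + l i * w))"
    "\<And>w. w \<ge> 0 \<Longrightarrow> bessel_s (Suc k) w = bessel_s k w * (\<Sum>i. l i / (1 + l i * w))"
proof -
  have "\<exists>d v. (pderiv ^^ k) (sinh_poly n) = smult d (\<Prod>i<n-k. [:1, v i:]) \<and>
    (\<forall>i < n - k. 0 < v i \<and> v i \<le> sinh_inv_root i)" for n
    using higher_pderiv_simple_negative_roots[OF sinh_poly_def sinh_inv_root_pos sinh_inv_root_strict_antimono, of n k]
    by blast
  then obtain d v' where v': "\<And>n. (pderiv ^^ k) (sinh_poly n) = smult (d n) (\<Prod>i<n-k. [:1, v' n i:])"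
    "\<And>n i. i < n - k \<Longrightarrow> 0 < v' n i \<and> v' n i \<le> sinh_inv_root i" by metis
  \<comment> \<open>Padding with \<open>0\<close> turns the finite products and sums into series
    over a fixed index range, as Tannery's theorem requires.\<close>
  define v where "v n i = (if i < n - k then v' n i else 0)" for n i
  have v: "0 \<le> v n i" "v n i \<le> sinh_inv_root i" for n i
    using v'(2)[of i n] sinh_inv_root_pos[of i] by (auto simp: v_def less_imp_le)
  have pv: "(pderiv ^^ k) (sinh_poly n) = smult (d n) (\<Prod>i<n-k. [:1, v n i:])" for n
    unfolding v'(1) v_def by simp
  have fin: "v n i = 0" if "i \<notin> {..<n - k}" for n i using that by (simp add: v_def)
  \<comment> \<open>The diagonal argument asks for one bound valid for all \<open>i\<close>; the
    largest of the \<open>sinh_inv_root i\<close> serves.\<close>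
  have "norm (v n i) \<le> sinh_inv_root 0" for n i
  proof -
    have "sinh_inv_root i \<le> sinh_inv_root 0" using sinh_inv_root_strict_antimono[of 0 i] by (cases "i = 0") auto
    then show ?thesis using v[of n i] by simp
  qed
  then obtain \<kappa> where \<kappa>: "strict_mono (\<kappa> :: nat \<Rightarrow> nat)" "\<And>i. \<exists>l. (\<lambda>n. v (\<kappa> n) i) \<longlonglongrightarrow> l"
    using function_convergent_subsequence[of UNIV v "sinh_inv_root 0"] by (metis UNIV_I countableI_type)
  have "\<exists>l. \<forall>i. (\<lambda>n. v (\<kappa> n) i) \<longlonglongrightarrow> l i" by (rule choice) (use \<kappa>(2) in blast)
  then obtain l where l: "\<And>i. (\<lambda>n. v (\<kappa> n) i) \<longlonglongrightarrow> l i" by blast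
  have l0: "l i \<ge> 0" for i by (rule LIMSEQ_le_const[OF l]) (use v in auto)
  have "l i \<le> sinh_inv_root i" for i by (rule LIMSEQ_le_const2[OF l]) (use v in auto)
  then have suml: "summable l" using l0 by (intro summable_comparison_test'[OF summable_sinh_inv_root]) auto
  have lim: "(\<lambda>n. poly ((pderiv ^^ j) (sinh_poly (\<kappa> n))) x) \<longlonglongrightarrow> bessel_s j x" for j x
    using LIMSEQ_subseq_LIMSEQ[OF higher_pderiv_sinh_poly_tendsto \<kappa>(1)] by (simp add: o_def)
  \<comment> \<open>The product is \<open>1\<close> at the origin, so the leading constants are
    values there and converge to \<open>bessel_s k 0\<close>.\<close>
  have d: "poly ((pderiv ^^ k) (sinh_poly n)) 0 = d n" for n
    unfolding pv by (simp add: poly_prod)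
  have prod: "bessel_s k w = bessel_s k 0 * exp (\<Sum>i. ln (1 + l i * w))" if w: "w \<ge> 0" for w
  proof -
    have vw: "0 \<le> v n i * w" "v n i * w \<le> sinh_inv_root i * w" for n i
      using v[of n i] w by (auto intro: mult_right_mono)
    have p: "poly ((pderiv ^^ k) (sinh_poly n)) w = d n * exp (\<Sum>i. ln (1 + v n i * w))" for n
    proof -
      have "(\<Sum>i. ln (1 + v n i * w)) = (\<Sum>i<n-k. ln (1 + v n i * w))"
        by (rule suminf_finite) (auto simp: fin)
      moreover have "exp (\<Sum>i<n-k. ln (1 + v n i * w)) = (\<Prod>i<n-k. 1 + v n i * w)"
        unfolding exp_sum[OF finite_lessThan] using vw by (intro prod.cong refl) (smt (verit) exp_ln)
      ultimately show ?thesis unfolding pv by (simp add: poly_prod mult.commute)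
    qed
    have "(\<lambda>n. \<Sum>i. ln (1 + v (\<kappa> n) i * w)) \<longlonglongrightarrow> (\<Sum>i. ln (1 + l i * w))"
    proof (rule conjunct2[OF conjunct2[OF tannerys_theorem]])
      show "(\<lambda>n. ln (1 + v (\<kappa> n) i * w)) \<longlonglongrightarrow> ln (1 + l i * w)" for i
        using l0[of i] w by (intro tendsto_intros l) (smt (verit) mult_nonneg_nonneg)
      show "\<forall>\<^sub>F (i, n) in sequentially \<times>\<^sub>F sequentially. norm (ln (1 + v (\<kappa> n) i * w)) \<le> sinh_inv_root i * w"
      proof (intro always_eventually allI, clarify)
        fix i n
        have "ln (1 + v (\<kappa> n) i * w) \<le> v (\<kappa> n) i * w" using vw by (intro ln_add_one_self_le_self) auto
        moreover have "0 \<le> ln (1 + v (\<kappa> n) i * w)" using vw by (intro ln_ge_zero) auto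
        ultimately show "norm (ln (1 + v (\<kappa> n) i * w)) \<le> sinh_inv_root i * w"
          using vw(2)[of "\<kappa> n" i] by simp
      qed
      show "summable (\<lambda>i. sinh_inv_root i * w)" by (intro summable_mult2 summable_sinh_inv_root)
    qed simp
    then have "(\<lambda>n. d (\<kappa> n) * exp (\<Sum>i. ln (1 + v (\<kappa> n) i * w))) \<longlonglongrightarrow>
        bessel_s k 0 * exp (\<Sum>i. ln (1 + l i * w))"
      by (intro tendsto_intros lim[of k 0, unfolded d])
    with lim[of k w, unfolded p] show ?thesis by (rule LIMSEQ_unique)
  qed
  have quot: "bessel_s (Suc k) w = bessel_s k w * (\<Sum>i. l i / (1 + l i * w))" if w: "w \<ge> 0" for w
  proof -
    have vw: "0 \<le> v n i * w" for n i using v[of n i] w by auto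
    have p: "poly ((pderiv ^^ Suc k) (sinh_poly n)) w =
        poly ((pderiv ^^ k) (sinh_poly n)) w * (\<Sum>i. v n i / (1 + v n i * w))" for n
    proof -
      have "(\<Sum>i. v n i / (1 + v n i * w)) = (\<Sum>i<n-k. v n i / (1 + v n i * w))"
        by (rule suminf_finite) (auto simp: fin)
      moreover have "1 + v n i * w \<noteq> 0" for i using vw[of n i] by linarith
      ultimately show ?thesis
        unfolding funpow.simps o_def pv by (simp add: pderiv_smult pderiv_prod_linear)
    qed
    have "(\<lambda>n. \<Sum>i. v (\<kappa> n) i / (1 + v (\<kappa> n) i * w)) \<longlonglongrightarrow> (\<Sum>i. l i / (1 + l i * w))"
    proof (rule conjunct2[OF conjunct2[OF tannerys_theorem]])
      show "(\<lambda>n. v (\<kappa> n) i / (1 + v (\<kappa> n) i * w)) \<longlonglongrightarrow> l i / (1 + l i * w)" for i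
        using l0[of i] w by (intro tendsto_intros l) (smt (verit) mult_nonneg_nonneg)
      show "\<forall>\<^sub>F (i, n) in sequentially \<times>\<^sub>F sequentially.
          norm (v (\<kappa> n) i / (1 + v (\<kappa> n) i * w)) \<le> sinh_inv_root i"
      proof (intro always_eventually allI, clarify)
        fix i n
        have "v (\<kappa> n) i / (1 + v (\<kappa> n) i * w) \<le> v (\<kappa> n) i / 1"
          using vw v by (intro divide_left_mono) (auto intro!: add_pos_nonneg)
        moreover have "0 \<le> v (\<kappa> n) i / (1 + v (\<kappa> n) i * w)"
          using vw[of "\<kappa> n" i] v(1)[of "\<kappa> n" i] by (intro divide_nonneg_nonneg) linarith+
        ultimately show "norm (v (\<kappa> n) i / (1 + v (\<kappa> n) i * w)) \<le> sinh_inv_root i"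
          using v(2)[of "\<kappa> n" i] unfolding real_norm_def by linarith
      qed
    qed (auto intro: summable_sinh_inv_root)
    then have "(\<lambda>n. poly ((pderiv ^^ k) (sinh_poly (\<kappa> n))) w * (\<Sum>i. v (\<kappa> n) i / (1 + v (\<kappa> n) i * w))) \<longlonglongrightarrow>
        bessel_s k w * (\<Sum>i. l i / (1 + l i * w))"
      by (intro tendsto_intros lim)
    with lim[of "Suc k" w, unfolded p] show ?thesis by (rule LIMSEQ_unique)
  qed
  show ?thesis using that[OF l0 suml prod quot] by blast
qed

section \<open>Diagonalization\<close>

text \<open>A maximum of the quadratic form on the unit sphere of \<open>S\<close> is an
  eigenvector. An arbitrary Euclidean space is allowed so that the lemma serves real symmetric
  matrices and, with the real part of the Hermitian product, complex Hermitian ones.\<close>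

lemma selfadjoint_eigenvector:
  fixes f :: "'a::euclidean_space \<Rightarrow> 'a"
  assumes lin: "linear f" and sa: "\<And>x y. f x \<bullet> y = x \<bullet> f y"
    and S: "subspace S" "f ` S \<subseteq> S" "S \<noteq> {0}"
  obtains v c where "v \<in> S" "norm v = 1" "f v = c *\<^sub>R v"
proof -
  let ?K = "sphere 0 1 \<inter> S"
  have "compact ?K" using S(1) by (intro compact_Int_closed compact_sphere closed_subspace)
  moreover have "0 \<in> S" using S(1) by (rule subspace_0)
  then obtain w where w: "w \<in> S" "w \<noteq> 0" using S(3) by auto
  then have "w /\<^sub>R norm w \<in> ?K" using S(1) by (simp add: subspace_scale)
  then have "?K \<noteq> {}" by blast
  moreover have "continuous_on ?K (\<lambda>x. f x \<bullet> x)"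
    using lin by (intro continuous_intros linear_continuous_on linear_conv_bounded_linear[THEN iffD1])
  ultimately obtain v where v: "v \<in> ?K" and max: "\<And>x. x \<in> ?K \<Longrightarrow> f x \<bullet> x \<le> f v \<bullet> v"
    using continuous_attains_sup[of ?K "\<lambda>x. f x \<bullet> x"] by meson
  define c where "c = f v \<bullet> v"
  have le: "f x \<bullet> x \<le> c * (x \<bullet> x)" if "x \<in> S" for x
  proof (cases "x = 0")
    case True then show ?thesis using lin by (simp add: linear_0)
  next
    case False
    have "x /\<^sub>R norm x \<in> ?K" using False that S(1) by (simp add: subspace_scale)
    from max[OF this] have "(f x \<bullet> x) / (norm x)\<^sup>2 \<le> c"
      unfolding c_def using lin by (simp add: linear_scale field_simps power2_eq_square)
    then show ?thesis using False by (simp add: field_simps power2_norm_eq_inner)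
  qed
  define g where "g x = c *\<^sub>R x - f x" for x
  have gS: "g x \<in> S" if "x \<in> S" for x
    unfolding g_def using that S by (intro subspace_diff subspace_scale) auto
  have vv: "v \<bullet> v = 1" using v by (simp add: dot_square_norm)
  have "g v = 0"
  proof (rule ccontr)
    assume nz: "g v \<noteq> 0"
    \<comment> \<open>the form \<open>x \<bullet> g x\<close> is nonnegative on \<open>S\<close> and vanishes at \<open>v\<close>, so its derivative at \<open>v\<close> vanishes\<close>
    have q: "0 \<le> 2 * t * (g v \<bullet> g v) + t\<^sup>2 * (g v \<bullet> g (g v))" for t
    proof -
      let ?x = "v + t *\<^sub>R g v"
      have "?x \<in> S" using v S(1) gS by (intro subspace_add subspace_scale) auto
      from le[OF this] have "0 \<le> ?x \<bullet> g ?x" by (simp add: g_def algebra_simps inner_commute)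
      also have "g ?x = g v + t *\<^sub>R g (g v)"
        using lin by (simp add: g_def linear_add linear_scale linear_diff algebra_simps)
      also have "?x \<bullet> (g v + t *\<^sub>R g (g v)) = v \<bullet> g v + t * (v \<bullet> g (g v)) + t * (g v \<bullet> g v) + t\<^sup>2 * (g v \<bullet> g (g v))"
        by (simp add: algebra_simps power2_eq_square)
      also have "v \<bullet> g v = 0" using vv by (simp add: g_def c_def algebra_simps inner_commute)
      also have "v \<bullet> g (g v) = g v \<bullet> g v"
        using sa[of v "g v"] by (simp add: g_def algebra_simps inner_commute)
      finally show ?thesis by simp
    qed
    let ?a = "g v \<bullet> g v" and ?b = "g v \<bullet> g (g v)"
    have a: "?a > 0" using nz by simp
    \<comment> \<open>With \<open>a\<close> and \<open>b\<close> the two inner products,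
      \<open>t^2 * b \<le> t^2 * (|b| + a) = - t * a\<close>, so the quadratic term can undo only
      half of the negative linear term \<open>2 * t * a\<close>.\<close>
    let ?t = "- ?a / (\<bar>?b\<bar> + ?a)"
    have "?t\<^sup>2 * ?b \<le> ?t\<^sup>2 * (\<bar>?b\<bar> + ?a)" using a by (intro mult_left_mono) (linarith, simp)
    also have "\<dots> = - ?t * ?a" using a by (simp add: power2_eq_square)
    finally have "2 * ?t * ?a + ?t\<^sup>2 * ?b \<le> ?t * ?a" by simp
    moreover have "?t * ?a < 0" using a by (intro mult_neg_pos divide_neg_pos) linarith+
    ultimately show False using q[of ?t] by simp
  qed
  then have "f v = c *\<^sub>R v" by (simp add: g_def)
  then show ?thesis using v that by auto
qed

lemma card_orthonormal_le_DIM: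
  fixes E :: "'a::euclidean_space set"
  assumes "pairwise orthogonal E" "\<And>v. v \<in> E \<Longrightarrow> norm v = 1"
  shows "finite E" "card E \<le> DIM('a)"
proof -
  have "0 \<notin> E" using assms(2) by force
  then have "independent E" using assms(1) pairwise_orthogonal_independent by blast
  then show "finite E" "card E \<le> DIM('a)" using independent_bound by auto
qed

text \<open>A family of largest cardinality takes the place of an induction on the dimension in both
  diagonalizations.\<close>

lemma maximal_set_card_bounded:
  assumes "P E0" "\<And>E. P E \<Longrightarrow> finite E \<and> card E \<le> (N::nat)"
  obtains E where "P E" "\<And>E'. P E' \<Longrightarrow> card E' \<le> card E"
  using ex_has_greatest_nat[of P E0 card "Suc N"] assms by (auto simp: less_Suc_eq_le)

text \<open>The orthogonal complement of an orthonormal set of eigenvectors is invariant because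
  \<open>f\<close> is self-adjoint. If the set is largest possible, the complement is zero, as it
  would otherwise contain one more eigenvector.\<close>

theorem selfadjoint_orthonormal_eigenbasis:
  fixes f :: "real^'n \<Rightarrow> real^'n"
  assumes lin: "linear f" and sa: "\<And>x y. f x \<bullet> y = x \<bullet> f y"
  obtains e :: "'n \<Rightarrow> real^'n" and b where "\<And>i j. e i \<bullet> e j = (if i = j then 1 else 0)"
    "\<And>i. f (e i) = b i *\<^sub>R e i"
proof -
  define P where "P E \<longleftrightarrow> pairwise orthogonal E \<and> (\<forall>v\<in>E. norm v = 1 \<and> (\<exists>c. f v = c *\<^sub>R v))" for E
  have "P {}" by (simp add: P_def)
  moreover have "finite E \<and> card E \<le> DIM(real^'n)" if "P E" for E
    using that card_orthonormal_le_DIM[of E] by (auto simp: P_def)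
  ultimately obtain E where E: "P E" "\<And>E'. P E' \<Longrightarrow> card E' \<le> card E" and fin: "finite E"
    using maximal_set_card_bounded[of P "{}" "DIM(real^'n)"] by metis
  define S where "S = {x. \<forall>v\<in>E. v \<bullet> x = 0}"
  have "S = {0}"
  proof (rule ccontr)
    assume "S \<noteq> {0}"
    moreover have "subspace S" by (auto simp: S_def subspace_def algebra_simps)
    moreover have "f ` S \<subseteq> S"
      using E(1) by (auto simp: S_def P_def sa[symmetric])
    ultimately obtain v c where v: "v \<in> S" "norm v = 1" "f v = c *\<^sub>R v"
      using selfadjoint_eigenvector[OF lin sa, of S] by metis
    have "P (insert v E)" using E(1) v
      by (auto simp: P_def S_def pairwise_insert orthogonal_def inner_commute)
    moreover have "v \<notin> E" using v by (auto simp: S_def norm_eq_1)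
    ultimately show False using E(2)[of "insert v E"] fin by simp
  qed
  moreover have "0 \<notin> E" using E(1) by (auto simp: P_def)
  then have ind: "independent E" using E(1) pairwise_orthogonal_independent by (auto simp: P_def)
  have "card E = CARD('n)"
  proof (rule ccontr)
    assume "card E \<noteq> CARD('n)"
    then have "dim E < DIM(real^'n)"
      using ind independent_bound[OF ind] by (simp add: dim_eq_card_independent)
    then obtain a where "a \<noteq> 0" "span E \<subseteq> {x. a \<bullet> x = 0}" using lowdim_subset_hyperplane by blast
    then have "a \<in> S" by (auto simp: S_def inner_commute dest!: subsetD[OF _ span_base])
    with \<open>S = {0}\<close> \<open>a \<noteq> 0\<close> show False by simp
  qed
  \<comment> \<open>Indexing the basis by \<open>'n\<close> itself lets \<open>x $ i\<close> act as
    the coefficient of \<open>e i\<close>.\<close>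
  then obtain e where e: "bij_betw e (UNIV :: 'n set) E"
    using fin by (metis finite_same_card_bij finite_class.finite_UNIV)
  have on: "e i \<bullet> e j = (if i = j then 1 else 0)" for i j
  proof (cases "i = j")
    case True
    then show ?thesis using E(1) bij_betwE[OF e] by (simp add: P_def norm_eq_1[symmetric])
  next
    case False
    then have "e i \<noteq> e j" using e by (auto simp: bij_betw_def inj_on_def)
    then show ?thesis using E(1) bij_betwE[OF e] False by (auto simp: P_def pairwise_def orthogonal_def)
  qed
  have "\<exists>b. \<forall>i. f (e i) = b i *\<^sub>R e i" using E(1) bij_betwE[OF e] unfolding P_def by (intro choice) blast
  then show ?thesis using on that by blast
qed

section \<open>Complex Hermitian matrices\<close>

lemma hermitian_inner_self: "hermitian_inner x x = of_real ((norm x)\<^sup>2)"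
  by (simp add: hermitian_inner_def norm_vec_def L2_set_def sum_nonneg complex_norm_square[symmetric])

lemma inner_complex_vec: "x \<bullet> y = Re (hermitian_inner x y)" for x y :: "complex^'n"
  by (simp add: inner_vec_def hermitian_inner_def inner_complex_def)

lemma hermitian_inner_scale:
  "hermitian_inner (c *s x) y = c * hermitian_inner x y"
  "hermitian_inner x (c *s y) = cnj c * hermitian_inner x y"
  by (simp_all add: hermitian_inner_def sum_distrib_left mult_ac)

lemma hermitian_inner_add:
  "hermitian_inner (x + y) z = hermitian_inner x z + hermitian_inner y z"
  "hermitian_inner x (y + z) = hermitian_inner x y + hermitian_inner x z"
  by (simp_all add: hermitian_inner_def algebra_simps sum.distrib)

lemma hermitian_inner_commute: "hermitian_inner y x = cnj (hermitian_inner x y)"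
  by (simp add: hermitian_inner_def mult.commute)

lemma hermitian_inner_scaleR:
  "hermitian_inner (c *\<^sub>R x) y = of_real c * hermitian_inner x y"
  "hermitian_inner x (c *\<^sub>R y) = of_real c * hermitian_inner x y"
  by (simp_all add: hermitian_inner_def sum_distrib_left scaleR_conv_of_real[where 'a=complex] mult_ac)

lemma hermitian_inner_adjoint:
  "hermitian_inner (A *v x) y = hermitian_inner x (adjoint_mat A *v y)"
proof -
  have "hermitian_inner (A *v x) y = (\<Sum>a\<in>UNIV. \<Sum>b\<in>UNIV. A $ a $ b * x $ b * cnj (y $ a))"
    unfolding hermitian_inner_def matrix_vector_mult_def by (simp add: sum_distrib_right)
  also have "\<dots> = (\<Sum>b\<in>UNIV. \<Sum>a\<in>UNIV. A $ a $ b * x $ b * cnj (y $ a))" by (rule sum.swap)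
  also have "\<dots> = (\<Sum>b\<in>UNIV. x $ b * cnj (\<Sum>a\<in>UNIV. cnj (A $ a $ b) * y $ a))"
    by (intro sum.cong refl) (simp add: sum_distrib_left mult_ac)
  also have "\<dots> = hermitian_inner x (adjoint_mat A *v y)"
    by (simp add: hermitian_inner_def matrix_vector_mult_def adjoint_mat_def)
  finally show ?thesis .
qed

text \<open>The real part of the Hermitian product is a real inner product, so
  \<open>selfadjoint_eigenvector\<close> applies over the reals. The price is that a
  Hermitian-orthonormal set \<open>E\<close> must be counted against the doubled real dimension;
  adjoining \<open>\<i> *s v\<close> for every \<open>v\<close> in \<open>E\<close> doubles it
  too.\<close>

theorem hermitian_unitary_diagonalization:
  fixes A :: "complex^'n^'n"
  assumes herm: "adjoint_mat A = A"
  obtains V d where "unitary_mat V" "A = V ** diag_mat d ** adjoint_mat V"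
proof -
  define P where "P E \<longleftrightarrow> (\<forall>v\<in>E. \<forall>w\<in>E. hermitian_inner v w = (if v = w then 1 else 0)) \<and>
    (\<forall>v\<in>E. \<exists>c. A *v v = c *s v)" for E
  have lin: "linear ((*v) A)"
    by (intro linearI) (simp_all add: vec_eq_iff matrix_vector_mult_def sum.distrib algebra_simps
        scaleR_sum_right)
  have "P {}" by (simp add: P_def)
  moreover have bound: "finite E \<and> card E \<le> DIM(complex^'n)" if "P E" for E
  proof -
    have "pairwise orthogonal E" using that
      by (auto simp: P_def pairwise_def orthogonal_def inner_complex_vec)
    moreover have "norm v = 1" if "v \<in> E" for v
    proof -
      have "v \<bullet> v = 1" using \<open>P E\<close> that by (simp add: P_def inner_complex_vec)
      then show ?thesis by (simp add: norm_eq_1)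
    qed
    ultimately show ?thesis using card_orthonormal_le_DIM[of E] by auto
  qed
  ultimately obtain E where E: "P E" "\<And>E'. P E' \<Longrightarrow> card E' \<le> card E" and fin: "finite E"
    using maximal_set_card_bounded[of P "{}" "DIM(complex^'n)"] by metis
  define S where "S = {x. \<forall>v\<in>E. hermitian_inner v x = 0}"
  have S0: "S = {0}"
  proof (rule ccontr)
    assume "S \<noteq> {0}"
    moreover have "subspace S"
      by (auto simp: S_def subspace_def hermitian_inner_add hermitian_inner_scaleR) (simp add: hermitian_inner_def)
    moreover have "(*v) A ` S \<subseteq> S"
    proof safe
      fix x assume x: "x \<in> S"
      have "hermitian_inner v (A *v x) = 0" if vE: "v \<in> E" for v
      proof -
        obtain c where "A *v v = c *s v" using E(1) vE unfolding P_def by blast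
        then show ?thesis
          using hermitian_inner_adjoint[of A v x] x vE by (simp add: herm hermitian_inner_scale S_def)
      qed
      then show "A *v x \<in> S" by (simp add: S_def)
    qed
    moreover have "(A *v x) \<bullet> y = x \<bullet> (A *v y)" for x y
      by (simp add: inner_complex_vec hermitian_inner_adjoint herm)
    ultimately obtain v c where v: "v \<in> S" "norm v = 1" "A *v v = c *\<^sub>R v"
      using selfadjoint_eigenvector[OF lin, of S] by metis
    have vv: "hermitian_inner v v = 1" using v(2) by (simp add: hermitian_inner_self)
    have vE: "v \<notin> E" using v(1) vv by (auto simp: S_def)
    have "A *v v = of_real c *s v" using v(3) by (simp add: vec_eq_iff scaleR_conv_of_real[where 'a=complex])
    moreover have "hermitian_inner v w = 0 \<and> hermitian_inner w v = 0" if "w \<in> E" for w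
      using v(1) that hermitian_inner_commute[of v w] by (simp add: S_def)
    ultimately have "P (insert v E)" using E(1) vv vE
      by (auto simp: P_def)
    then show False using E(2)[of "insert v E"] fin vE by simp
  qed
  let ?i = "\<lambda>v::complex^'n. \<i> *s v"
  have on: "hermitian_inner v w = (if v = w then 1 else 0)" if "v \<in> E" "w \<in> E" for v w
    using E(1) that by (auto simp: P_def)
  have inj: "inj_on ?i E" by (auto simp: inj_on_def vec_eq_iff)
  have disj: "E \<inter> ?i ` E = {}"
  proof (rule ccontr)
    assume "E \<inter> ?i ` E \<noteq> {}"
    then obtain v w where vw: "v \<in> E" "w \<in> E" "v = ?i w" by auto
    then have "hermitian_inner v w = \<i>" using on[OF vw(2) vw(2)] by (simp add: hermitian_inner_scale)
    then show False using on[OF vw(1,2)] by (auto split: if_splits simp: complex_eq_iff)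
  qed
  let ?F = "E \<union> ?i ` E"
  have F: "pairwise orthogonal ?F" "\<And>v. v \<in> ?F \<Longrightarrow> norm v = 1"
  proof -
    show "pairwise orthogonal ?F"
      by (auto simp: pairwise_def orthogonal_def inner_complex_vec hermitian_inner_scale on)
    fix v assume "v \<in> ?F"
    then have "v \<bullet> v = 1" by (auto simp: inner_complex_vec hermitian_inner_scale on)
    then show "norm v = 1" by (simp add: norm_eq_1)
  qed
  have "0 \<notin> ?F" using F(2)[of 0] by (metis norm_zero zero_neq_one)
  with F(1) have ind: "independent ?F" by (rule pairwise_orthogonal_independent)
  have cardF: "card ?F = 2 * card E"
    using card_Un_disjoint[OF fin _ disj] fin card_image[OF inj] by simp
  have DIM: "DIM(complex^'n) = 2 * CARD('n)" by simp
  have "card E = CARD('n)"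
  proof (rule ccontr)
    assume ne: "card E \<noteq> CARD('n)"
    then have "dim ?F < DIM(complex^'n)"
    proof -
      have "dim ?F = 2 * card E" using dim_eq_card_independent[OF ind] cardF by simp
      moreover have "2 * card E \<le> DIM(complex^'n)"
        using independent_bound[OF ind] unfolding cardF by (rule conjunct2)
      ultimately show ?thesis using ne DIM by linarith
    qed
    from lowdim_subset_hyperplane[OF this]
    obtain a where a: "a \<noteq> 0" "span ?F \<subseteq> {x. a \<bullet> x = 0}" by (elim exE conjE)
    \<comment> \<open>Real orthogonality to \<open>v\<close> and to \<open>\<i> *s v\<close>
      annihilates the real and the imaginary part of the Hermitian product.\<close>
    have "hermitian_inner v a = 0" if "v \<in> E" for v
    proof -
      have "v \<in> span ?F" "?i v \<in> span ?F" using that by (auto intro: span_base)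
      then have "a \<bullet> v = 0" "a \<bullet> ?i v = 0" using a(2) by auto
      then have "hermitian_inner a v = 0"
        by (auto simp: inner_complex_vec hermitian_inner_scale complex_eq_iff)
      then show ?thesis using hermitian_inner_commute[of v a] by simp
    qed
    then have "a \<in> S" by (auto simp: S_def)
    with S0 a(1) show False by simp
  qed
  then obtain e where e: "bij_betw e (UNIV :: 'n set) E"
    using fin by (metis finite_same_card_bij finite_class.finite_UNIV)
  have one: "hermitian_inner (e i) (e j) = (if i = j then 1 else 0)" for i j
    using on[of "e i" "e j"] bij_betwE[OF e] e by (auto simp: bij_betw_def inj_eq)
  have "\<exists>d. \<forall>i. A *v e i = d i *s e i" using E(1) bij_betwE[OF e] unfolding P_def by (intro choice) blast
  then obtain d where d: "\<And>i. A *v e i = d i *s e i" by blast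
  define V where "V = (\<chi> a i. e i $ a)"
  have "adjoint_mat V ** V = mat 1"
  proof -
    have "(adjoint_mat V ** V) $ i $ j = hermitian_inner (e j) (e i)" for i j
      by (simp add: matrix_matrix_mult_def adjoint_mat_def V_def hermitian_inner_def mult.commute)
    then show ?thesis by (auto simp: vec_eq_iff one mat_def)
  qed
  moreover from this have VV: "V ** adjoint_mat V = mat 1" by (simp add: matrix_left_right_inverse)
  ultimately have V: "unitary_mat V" by (simp add: unitary_mat_def)
  have "A ** V = V ** diag_mat d"
  proof -
    have "(A ** V) $ a $ i = (A *v e i) $ a" for a i
      by (simp add: matrix_matrix_mult_def V_def matrix_vector_mult_def)
    then show ?thesis by (simp add: vec_eq_iff diag_mat_mult_nth d V_def mult.commute)
  qed
  then have "V ** diag_mat d ** adjoint_mat V = A ** (V ** adjoint_mat V)"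
    by (simp add: matrix_mul_assoc)
  then show ?thesis using that[OF V, of d] VV by simp
qed

section \<open>Gaussian integrals\<close>

lemma nn_integral_lborel_translation:
  fixes f :: "'a::euclidean_space \<Rightarrow> ennreal"
  assumes [measurable]: "f \<in> borel_measurable borel"
  shows "(\<integral>\<^sup>+x. f (c + x) \<partial>lborel) = (\<integral>\<^sup>+x. f x \<partial>lborel)"
proof -
  have "(\<integral>\<^sup>+x. f x \<partial>lborel) = (\<integral>\<^sup>+x. f x \<partial>distr lborel borel ((+) c))"
    by (simp add: lborel_distr_plus)
  also have "\<dots> = (\<integral>\<^sup>+x. f (c + x) \<partial>lborel)" by (subst nn_integral_distr) auto
  finally show ?thesis by simp
qed

text \<open>
  Both \<open>lborel\<close> and its image under \<open>g\<close> are translation invariant, so they are proportional; the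
  unit ball, which \<open>g\<close> preserves, shows that the factor is \<open>1\<close>.
\<close>

lemma lborel_distr_orthogonal_transformation:
  fixes g :: "'a::euclidean_space \<Rightarrow> 'a"
  assumes g: "orthogonal_transformation g"
  shows "distr lborel borel g = lborel"
proof (rule measure_eqI)
  show "sets (distr lborel borel g) = sets (lborel :: 'a measure)" by simp
  fix B :: "'a set" assume "B \<in> sets (distr lborel borel g)"
  then have [measurable]: "B \<in> sets borel" by simp
  have lin: "linear g" using g by (rule orthogonal_transformation_linear)
  have [measurable]: "g \<in> borel_measurable borel"
    by (intro borel_measurable_continuous_onI linear_continuous_on lin[unfolded linear_conv_bounded_linear])
  obtain h where gh: "\<And>x. g (h x) = x"
    using orthogonal_transformation_surj[OF g] by (metis surj_f_inv_f)
  define b where "b = (indicator (ball 0 1) :: 'a \<Rightarrow> ennreal)"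
  define iB where "iB = (indicator B :: 'a \<Rightarrow> ennreal)"
  have [measurable]: "b \<in> borel_measurable borel" "iB \<in> borel_measurable borel"
    by (auto simp: b_def iB_def intro!: borel_measurable_indicator)
  let ?\<beta> = "emeasure lborel (ball (0::'a) 1)"
  have ball: "emeasure lborel (ball x 1) = ?\<beta>" for x :: 'a
    by (simp add: emeasure_ball)
  \<comment> \<open>A translation by \<open>h x\<close>, where \<open>g (h x) = x\<close>, inserts
    \<open>x\<close> into \<open>iB\<close>. Fubini and a translation by \<open>g y\<close> then
    shift \<open>g\<close> from \<open>iB\<close> to the ball, where it is harmless because
    \<open>g\<close> is an isometry.\<close>
  have "?\<beta> * (\<integral>\<^sup>+y. iB (g y) \<partial>lborel) = (\<integral>\<^sup>+x. b x * (\<integral>\<^sup>+y. iB (g y) \<partial>lborel) \<partial>lborel)"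
    by (subst nn_integral_multc, measurable) (simp add: b_def)
  also have "\<dots> = (\<integral>\<^sup>+x. b x * (\<integral>\<^sup>+y. iB (x + g y) \<partial>lborel) \<partial>lborel)"
  proof (rule nn_integral_cong)
    fix x
    have "(\<integral>\<^sup>+y. iB (g (h x + y)) \<partial>lborel) = (\<integral>\<^sup>+y. iB (g y) \<partial>lborel)"
      by (rule nn_integral_lborel_translation[of "\<lambda>y. iB (g y)"]) measurable
    then show "b x * (\<integral>\<^sup>+y. iB (g y) \<partial>lborel) = b x * (\<integral>\<^sup>+y. iB (x + g y) \<partial>lborel)"
      by (simp add: linear_add[OF lin] gh)
  qed
  also have "\<dots> = (\<integral>\<^sup>+x. (\<integral>\<^sup>+y. b x * iB (x + g y) \<partial>lborel) \<partial>lborel)"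
    by (intro nn_integral_cong nn_integral_cmult[symmetric]) measurable
  also have "\<dots> = (\<integral>\<^sup>+y. (\<integral>\<^sup>+x. b x * iB (x + g y) \<partial>lborel) \<partial>lborel)"
    by (rule lborel_pair.Fubini') measurable
  also have "\<dots> = (\<integral>\<^sup>+y. (\<integral>\<^sup>+x. b (x - g y) * iB x \<partial>lborel) \<partial>lborel)"
  proof (rule nn_integral_cong)
    fix y
    show "(\<integral>\<^sup>+x. b x * iB (x + g y) \<partial>lborel) = (\<integral>\<^sup>+x. b (x - g y) * iB x \<partial>lborel)"
      using nn_integral_lborel_translation[of "\<lambda>x. b (x - g y) * iB x" "g y"]
      by (simp add: add.commute)
  qed
  also have "\<dots> = (\<integral>\<^sup>+x. (\<integral>\<^sup>+y. b (x - g y) * iB x \<partial>lborel) \<partial>lborel)"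
    by (rule lborel_pair.Fubini') measurable
  also have "\<dots> = (\<integral>\<^sup>+x. ?\<beta> * iB x \<partial>lborel)"
  proof (rule nn_integral_cong)
    fix x
    have "norm (x - g y) = dist (h x) y" for y
    proof -
      have "x - g y = g (h x - y)" by (simp add: linear_diff[OF lin] gh)
      then show ?thesis using orthogonal_transformation_norm[OF g] by (simp add: dist_norm)
    qed
    then have pt: "b (x - g y) = indicator (ball (h x) 1) y" for y by (simp add: b_def indicator_def)
    have "(\<integral>\<^sup>+y. b (x - g y) \<partial>lborel) = (\<integral>\<^sup>+y. indicator (ball (h x) 1) y \<partial>lborel)"
      by (rule nn_integral_cong) (rule pt)
    also have "\<dots> = ?\<beta>" using ball[of "h x"] by simp
    finally have "(\<integral>\<^sup>+y. b (x - g y) \<partial>lborel) = ?\<beta>" .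
    moreover have "(\<integral>\<^sup>+y. b (x - g y) * iB x \<partial>lborel) = (\<integral>\<^sup>+y. b (x - g y) \<partial>lborel) * iB x"
      by (rule nn_integral_multc) measurable
    ultimately show "(\<integral>\<^sup>+y. b (x - g y) * iB x \<partial>lborel) = ?\<beta> * iB x" by simp
  qed
  also have "\<dots> = ?\<beta> * emeasure lborel B" by (simp add: nn_integral_cmult iB_def)
  finally have "?\<beta> * (\<integral>\<^sup>+y. iB (g y) \<partial>lborel) = ?\<beta> * emeasure lborel B" .
  moreover have "(\<integral>\<^sup>+y. iB (g y) \<partial>lborel) = emeasure (distr lborel borel g) B"
    unfolding iB_def by (subst nn_integral_indicator[symmetric], simp, subst nn_integral_distr) auto
  moreover have "?\<beta> \<noteq> 0" "?\<beta> \<noteq> \<infinity>"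
    by (simp_all add: emeasure_ball unit_ball_vol_pos less_imp_neq[symmetric])
  ultimately show "emeasure (distr lborel borel g) B = emeasure lborel B"
    by (simp add: ennreal_mult_cancel_left)
qed

lemma orthonormal_family:
  fixes e :: "'n::finite \<Rightarrow> real^'n"
  assumes e: "\<And>i j. e i \<bullet> e j = (if i = j then 1 else 0)"
  shows "orthogonal_transformation (\<lambda>x. \<Sum>i\<in>UNIV. x $ i *\<^sub>R e i)"
    and "(\<Sum>i\<in>UNIV. x $ i *\<^sub>R e i) \<bullet> e j = x $ j"
    and "(\<Sum>i\<in>UNIV. (x \<bullet> e i) *\<^sub>R e i) = x"
proof -
  let ?g = "\<lambda>x. \<Sum>i\<in>UNIV. x $ i *\<^sub>R e i"
  show ge: "?g x \<bullet> e j = x $ j" for x j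
    by (simp add: inner_sum_left e if_distrib cong: if_cong)
  have lin: "linear ?g"
    by (intro linearI) (simp_all add: scaleR_add_left sum.distrib scaleR_sum_right)
  have "?g x \<bullet> ?g y = x \<bullet> y" for x y
  proof -
    have "?g x \<bullet> ?g y = (\<Sum>i\<in>UNIV. y $ i * (?g x \<bullet> e i))"
      by (simp only: inner_sum_right inner_scaleR_right)
    then show ?thesis by (simp only: ge) (simp add: inner_vec_def mult.commute)
  qed
  with lin show ot: "orthogonal_transformation ?g"
    by (auto simp: orthogonal_transformation_def)
  obtain y where y: "x = ?g y" using orthogonal_transformation_surj[OF ot] by blast
  show "(\<Sum>i\<in>UNIV. (x \<bullet> e i) *\<^sub>R e i) = x" unfolding y ge ..
qed

lemma selfadjoint_quadratic_form:
  fixes f :: "real^'n::finite \<Rightarrow> real^'n" and e :: "'n \<Rightarrow> real^'n"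
  assumes lin: "linear f" and e: "\<And>i j. e i \<bullet> e j = (if i = j then 1 else 0)"
    and fe: "\<And>i. f (e i) = b i *\<^sub>R e i"
  shows "f v \<bullet> v = (\<Sum>i\<in>UNIV. b i * (v \<bullet> e i)\<^sup>2)"
proof -
  have "f v = f (\<Sum>i\<in>UNIV. (v \<bullet> e i) *\<^sub>R e i)" by (simp only: orthonormal_family(3)[OF e])
  also have "\<dots> = (\<Sum>i\<in>UNIV. (v \<bullet> e i) *\<^sub>R b i *\<^sub>R e i)"
    using lin by (simp add: linear_sum linear_scale fe)
  also have "\<dots> \<bullet> v = (\<Sum>i\<in>UNIV. b i * (v \<bullet> e i)\<^sup>2)"
    unfolding inner_sum_left inner_scaleR_left
    by (intro sum.cong refl) (simp add: inner_commute[of v] power2_eq_square)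
  finally show ?thesis .
qed

lemma nn_integral_lborel_rotate:
  fixes e :: "'n::finite \<Rightarrow> real^'n"
  assumes e: "\<And>i j. e i \<bullet> e j = (if i = j then 1 else 0)" and [measurable]: "f \<in> borel_measurable borel"
  shows "(\<integral>\<^sup>+x. f x \<partial>lborel) = (\<integral>\<^sup>+x. f (\<Sum>i\<in>UNIV. x $ i *\<^sub>R e i) \<partial>lborel)"
proof -
  let ?g = "\<lambda>x. \<Sum>i\<in>UNIV. x $ i *\<^sub>R e i"
  have "(\<integral>\<^sup>+x. f x \<partial>lborel) = (\<integral>\<^sup>+x. f x \<partial>distr lborel borel ?g)"
    by (simp add: lborel_distr_orthogonal_transformation[OF orthonormal_family(1)[OF e]])
  then show ?thesis by (subst (asm) nn_integral_distr) auto
qed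

lemma lborel_integral_rotate:
  fixes e :: "'n::finite \<Rightarrow> real^'n" and f :: "real^'n \<Rightarrow> 'b::{banach, second_countable_topology}"
  assumes e: "\<And>i j. e i \<bullet> e j = (if i = j then 1 else 0)" and [measurable]: "f \<in> borel_measurable borel"
  shows "(\<integral>x. f x \<partial>lborel) = (\<integral>x. f (\<Sum>i\<in>UNIV. x $ i *\<^sub>R e i) \<partial>lborel)"
proof -
  let ?g = "\<lambda>x. \<Sum>i\<in>UNIV. x $ i *\<^sub>R e i"
  have "(\<integral>x. f x \<partial>lborel) = (\<integral>x. f x \<partial>distr lborel borel ?g)"
    by (simp add: lborel_distr_orthogonal_transformation[OF orthonormal_family(1)[OF e]])
  then show ?thesis by (subst (asm) integral_distr) auto
qed

section \<open>Integrals of products over the coordinates\<close>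

lemma prod_Basis_vec: "(\<Prod>b\<in>Basis. F b) = (\<Prod>i\<in>UNIV. F (axis i (1::real)))" for F :: "real^'n::finite \<Rightarrow> _"
proof -
  have inj: "inj (\<lambda>i::'n. axis i (1::real))" by (auto simp: inj_on_def axis_eq_axis)
  moreover have "Basis = range (\<lambda>i::'n. axis i (1::real))" by (auto simp: Basis_vec_def)
  ultimately show ?thesis using prod.reindex[OF inj, of F] by simp
qed

lemma nn_integral_lborel_vec_prod:
  fixes f :: "'n::finite \<Rightarrow> real \<Rightarrow> ennreal"
  assumes [measurable]: "\<And>i. f i \<in> borel_measurable borel"
  shows "(\<integral>\<^sup>+x. (\<Prod>i\<in>UNIV. f i (x $ i)) \<partial>(lborel :: (real^'n) measure)) = (\<Prod>i\<in>UNIV. \<integral>\<^sup>+t. f i t \<partial>lborel)"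
proof -
  \<comment> \<open>\<open>lborel\<close> factors along basis vectors; \<open>THE\<close> recovers
    the coordinate \<open>i\<close> from \<open>axis i 1\<close>.\<close>
  define F where "F b = f (THE i. b = axis i (1::real))" for b
  have F: "F (axis i 1) = f i" for i by (simp add: F_def axis_eq_axis)
  have "(\<integral>\<^sup>+x. (\<Prod>b\<in>Basis. F b (x \<bullet> b)) \<partial>(lborel :: (real^'n) measure)) = (\<Prod>b\<in>Basis. \<integral>\<^sup>+t. F b t \<partial>lborel)"
    by (rule nn_integral_lborel_prod) (auto simp: F_def)
  then show ?thesis by (simp add: prod_Basis_vec F inner_axis)
qed

lemma lborel_integral_vec_prod:
  fixes f :: "'n::finite \<Rightarrow> real \<Rightarrow> complex"
  assumes f: "\<And>i. integrable lborel (f i)"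
  shows "(\<integral>x. (\<Prod>i\<in>UNIV. f i (x $ i)) \<partial>(lborel :: (real^'n) measure)) = (\<Prod>i\<in>UNIV. \<integral>t. f i t \<partial>lborel)"
proof -
  interpret product_sigma_finite "\<lambda>b :: real^'n::finite. lborel :: real measure" ..
  define F where "F b = f (THE i. b = axis i (1::real))" for b
  have F: "F (axis i 1) = f i" for i by (simp add: F_def axis_eq_axis)
  have [measurable]: "F b \<in> borel_measurable borel" for b
    using f unfolding F_def by (simp add: borel_measurable_integrable)
  have "(\<integral>x. (\<Prod>b\<in>Basis. F b (x \<bullet> b)) \<partial>(lborel :: (real^'n) measure)) =
      (\<integral>x. (\<Prod>b\<in>Basis. F b (x \<bullet> b)) \<partial>distr (\<Pi>\<^sub>M b\<in>Basis. lborel) borel (\<lambda>f. \<Sum>b\<in>(Basis :: (real^'n) set). f b *\<^sub>R b))"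
    by (simp only: lborel_eq[symmetric])
  also have "\<dots> = (\<integral>x. (\<Prod>b\<in>Basis. F b ((\<Sum>b\<in>(Basis :: (real^'n) set). x b *\<^sub>R b) \<bullet> b)) \<partial>(\<Pi>\<^sub>M b\<in>Basis. lborel))"
    by (rule integral_distr) measurable
  also have "\<dots> = (\<integral>x. (\<Prod>b\<in>(Basis :: (real^'n) set). F b (x b)) \<partial>(\<Pi>\<^sub>M b\<in>Basis. lborel))"
    by simp
  also have "\<dots> = (\<Prod>b\<in>Basis. \<integral>t. F b t \<partial>lborel)"
    using f by (intro product_integral_prod) (auto simp: F_def)
  finally show ?thesis by (simp add: prod_Basis_vec F inner_axis)
qed

lemma nn_integral_normal_density: "\<sigma> > 0 \<Longrightarrow> (\<integral>\<^sup>+t. ennreal (normal_density \<mu> \<sigma> t) \<partial>lborel) = 1"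
  by (simp add: nn_integral_eq_integral)

lemma nn_integral_std_normal_quadratic:
  assumes b: "b \<ge> 0"
  shows "(\<integral>\<^sup>+t. ennreal (std_normal_density t * exp (- (b * (t + y)\<^sup>2) / 2)) \<partial>lborel) =
    ennreal ((1 + b) powr (- 1 / 2) * exp (- (b * y\<^sup>2 / (1 + b)) / 2))"
proof -
  \<comment> \<open>Completing the square in \<open>t^2 + b * (t + y)^2\<close>: the coefficient of
    \<open>t^2\<close> is \<open>1 + b\<close>, the inverse of the variance.\<close>
  let ?\<mu> = "- b * y / (1 + b)" and ?\<sigma> = "1 / sqrt (1 + b)"
  let ?c = "(1 + b) powr (- 1 / 2) * exp (- (b * y\<^sup>2 / (1 + b)) / 2)"
  have \<sigma>2: "?\<sigma>\<^sup>2 = 1 / (1 + b)" using b by (simp add: power_divide)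
  have "std_normal_density t * exp (- (b * (t + y)\<^sup>2) / 2) = ?c * normal_density ?\<mu> ?\<sigma> t" for t
  proof -
    have "1 / sqrt (2 * pi * ?\<sigma>\<^sup>2) = sqrt (1 + b) / sqrt (2 * pi)"
      unfolding \<sigma>2 using b by (simp add: real_sqrt_divide)
    moreover have "(1 + b) powr (- 1 / 2) * sqrt (1 + b) = 1"
      using b by (simp add: powr_half_sqrt[symmetric] powr_add[symmetric])
    moreover have "exp (- t\<^sup>2 / 2) * exp (- (b * (t + y)\<^sup>2) / 2) =
        exp (- (b * y\<^sup>2 / (1 + b)) / 2) * exp (- (t - ?\<mu>)\<^sup>2 / (2 * ?\<sigma>\<^sup>2))"
    proof -
      have "- t\<^sup>2 / 2 + - (b * (t + y)\<^sup>2) / 2 =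
          - (b * y\<^sup>2 / (1 + b)) / 2 + - (t - ?\<mu>)\<^sup>2 / (2 * ?\<sigma>\<^sup>2)"
        unfolding \<sigma>2 using b by (simp add: divide_simps) (simp add: power2_eq_square algebra_simps)
      then show ?thesis by (simp only: exp_add[symmetric])
    qed
    ultimately have eq: "1 / sqrt (2 * pi * ?\<sigma>\<^sup>2) = sqrt (1 + b) / sqrt (2 * pi)"
      "(1 + b) powr (- 1 / 2) * sqrt (1 + b) = 1"
      "exp (- t\<^sup>2 / 2) * exp (- (b * (t + y)\<^sup>2) / 2) =
        exp (- (b * y\<^sup>2 / (1 + b)) / 2) * exp (- (t - ?\<mu>)\<^sup>2 / (2 * ?\<sigma>\<^sup>2))" by blast+
    have "?c * normal_density ?\<mu> ?\<sigma> t = ((1 + b) powr (- 1 / 2) * sqrt (1 + b)) / sqrt (2 * pi) *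
        (exp (- (b * y\<^sup>2 / (1 + b)) / 2) * exp (- (t - ?\<mu>)\<^sup>2 / (2 * ?\<sigma>\<^sup>2)))"
      unfolding normal_density_def eq(1) by (simp add: mult_ac)
    also have "\<dots> = std_normal_density t * exp (- (b * (t + y)\<^sup>2) / 2)"
      unfolding eq(2) eq(3)[symmetric] std_normal_density_def by simp
    finally show ?thesis by simp
  qed
  then show ?thesis using b
    by (simp add: ennreal_mult nn_integral_cmult nn_integral_normal_density)
qed

section \<open>The standard Gaussian vector\<close>

definition gauss_vec :: "(real^'n) measure" where
  "gauss_vec = density lborel (\<lambda>x. \<Prod>i\<in>UNIV. ennreal (std_normal_density (x $ i)))"

lemma sets_gauss_vec [simp, measurable_cong]: "sets gauss_vec = sets borel"
  by (simp add: gauss_vec_def)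

lemma space_gauss_vec [simp]: "space gauss_vec = UNIV"
  by (simp add: gauss_vec_def)

lemma prob_space_gauss_vec: "prob_space (gauss_vec :: (real^'n::finite) measure)"
proof
  show "emeasure (gauss_vec :: (real^'n) measure) (space gauss_vec) = 1"
    using nn_integral_lborel_vec_prod[where f = "\<lambda>(_::'n) t. ennreal (std_normal_density t)"]
    by (simp add: gauss_vec_def emeasure_density nn_integral_normal_density)
qed

lemma nn_integral_gauss_vec:
  fixes f :: "real^'n \<Rightarrow> ennreal"
  assumes [measurable]: "f \<in> borel_measurable borel"
  shows "(\<integral>\<^sup>+x. f x \<partial>gauss_vec) = (\<integral>\<^sup>+x. (\<Prod>i\<in>UNIV. ennreal (std_normal_density (x $ i))) * f x \<partial>lborel)"
  unfolding gauss_vec_def by (subst nn_integral_density) auto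

lemma prod_std_normal_density:
  fixes x :: "real^'n"
  shows "(\<Prod>i\<in>UNIV. std_normal_density (x $ i)) = (1 / sqrt (2 * pi)) ^ CARD('n) * exp (- (norm x)\<^sup>2 / 2)"
proof -
  have "(\<Prod>i\<in>UNIV. exp (- (x $ i)\<^sup>2 / 2)) = exp (- (norm x)\<^sup>2 / 2)"
    by (simp add: norm_vec_def L2_set_def sum_nonneg exp_sum[symmetric] sum_negf sum_divide_distrib)
  then show ?thesis unfolding std_normal_density_def prod.distrib prod_constant by simp
qed

text \<open>The density depends only on the norm, so the coordinates may be rotated into the basis
  \<open>e\<close>, where the integral splits. If \<open>B\<close> is the symmetric matrix with
  eigenvalues \<open>b i\<close> on \<open>e i\<close>, the right-hand side is
  \<open>det (1 + B)\<close> to the power \<open>- 1 / 2\<close> times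
  \<open>exp (- <B (1 + B)^(-1) y, y> / 2)\<close>.\<close>

lemma nn_integral_gauss_vec_quadratic:
  fixes e :: "'n::finite \<Rightarrow> real^'n"
  assumes e: "\<And>i j. e i \<bullet> e j = (if i = j then 1 else 0)" and b: "\<And>i. b i \<ge> 0"
  shows "(\<integral>\<^sup>+x. ennreal (exp (- (\<Sum>i\<in>UNIV. b i * ((x + y) \<bullet> e i)\<^sup>2) / 2)) \<partial>gauss_vec) =
    ennreal (\<Prod>i\<in>UNIV. (1 + b i) powr (- 1 / 2) * exp (- (b i * (y \<bullet> e i)\<^sup>2 / (1 + b i)) / 2))"
proof -
  let ?g = "\<lambda>x. \<Sum>i\<in>UNIV. x $ i *\<^sub>R e i"
  have norm: "norm (?g x) = norm x" for x
    by (rule orthogonal_transformation_norm[OF orthonormal_family(1)[OF e]])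
  have "(\<integral>\<^sup>+x. ennreal (exp (- (\<Sum>i\<in>UNIV. b i * ((x + y) \<bullet> e i)\<^sup>2) / 2)) \<partial>gauss_vec) =
      (\<integral>\<^sup>+x. (\<Prod>i\<in>UNIV. ennreal (std_normal_density (x $ i))) *
         ennreal (exp (- (\<Sum>i\<in>UNIV. b i * ((x + y) \<bullet> e i)\<^sup>2) / 2)) \<partial>lborel)"
    by (rule nn_integral_gauss_vec) measurable
  also have "\<dots> = (\<integral>\<^sup>+x. (\<Prod>i\<in>UNIV. ennreal (std_normal_density (?g x $ i))) *
         ennreal (exp (- (\<Sum>i\<in>UNIV. b i * ((?g x + y) \<bullet> e i)\<^sup>2) / 2)) \<partial>lborel)"
    by (rule nn_integral_lborel_rotate[OF e]) measurable
  also have "\<dots> = (\<integral>\<^sup>+x. (\<Prod>i\<in>UNIV. ennreal (std_normal_density (x $ i) * exp (- (b i * (x $ i + y \<bullet> e i)\<^sup>2) / 2))) \<partial>lborel)"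
  proof (intro nn_integral_cong)
    fix x :: "real^'n"
    have "(\<Prod>i\<in>UNIV. std_normal_density (?g x $ i)) = (\<Prod>i\<in>UNIV. std_normal_density (x $ i))"
      unfolding prod_std_normal_density norm ..
    then have "(\<Prod>i\<in>UNIV. ennreal (std_normal_density (?g x $ i))) = (\<Prod>i\<in>UNIV. ennreal (std_normal_density (x $ i)))"
      by (simp add: prod_ennreal)
    moreover have "exp (- (\<Sum>i\<in>UNIV. b i * ((?g x + y) \<bullet> e i)\<^sup>2) / 2) = (\<Prod>i\<in>UNIV. exp (- (b i * (x $ i + y \<bullet> e i)\<^sup>2) / 2))"
      by (simp add: inner_add_left orthonormal_family(2)[OF e] exp_sum[symmetric] sum_negf sum_divide_distrib)
    ultimately show "(\<Prod>i\<in>UNIV. ennreal (std_normal_density (?g x $ i))) *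
         ennreal (exp (- (\<Sum>i\<in>UNIV. b i * ((?g x + y) \<bullet> e i)\<^sup>2) / 2)) =
        (\<Prod>i\<in>UNIV. ennreal (std_normal_density (x $ i) * exp (- (b i * (x $ i + y \<bullet> e i)\<^sup>2) / 2)))"
      by (simp add: ennreal_mult prod.distrib prod_ennreal)
  qed
  also have "\<dots> = (\<Prod>i\<in>UNIV. ennreal ((1 + b i) powr (- 1 / 2) * exp (- (b i * (y \<bullet> e i)\<^sup>2 / (1 + b i)) / 2)))"
    by (subst nn_integral_lborel_vec_prod, measurable) (simp only: nn_integral_std_normal_quadratic[OF b])
  also have "\<dots> = ennreal (\<Prod>i\<in>UNIV. (1 + b i) powr (- 1 / 2) * exp (- (b i * (y \<bullet> e i)\<^sup>2 / (1 + b i)) / 2))"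
    by (rule prod_ennreal) auto
  finally show ?thesis .
qed

text \<open>The factor \<open>exp (- t\<^sup>2 / 4)\<close> of the density absorbs the second moment.\<close>

lemma nn_integral_gauss_vec_norm_power2_finite:
  "(\<integral>\<^sup>+x. ennreal ((norm (x + y))\<^sup>2) \<partial>gauss_vec) < \<infinity>" for y :: "real^'n"
proof -
  \<comment> \<open>Up to normalization this is the normal density with variance
    \<open>2\<close>.\<close>
  have exp2: "(\<integral>\<^sup>+t. ennreal (exp (- t\<^sup>2 / 4)) \<partial>lborel) = ennreal (sqrt (4 * pi))"
  proof -
    have "(\<integral>\<^sup>+t. ennreal (exp (- t\<^sup>2 / 4)) \<partial>lborel) =
        (\<integral>\<^sup>+t. ennreal (sqrt (4 * pi)) * ennreal (normal_density 0 (sqrt 2) t) \<partial>lborel)"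
      by (intro nn_integral_cong) (simp add: normal_density_def ennreal_mult[symmetric])
    also have "\<dots> = ennreal (sqrt (4 * pi))"
      by (subst nn_integral_cmult) (auto simp: nn_integral_normal_density)
    finally show ?thesis .
  qed
  let ?K = "(1 / sqrt (2 * pi)) ^ CARD('n)"
  \<comment> \<open>The \<open>8\<close> comes from \<open>8 + 2 * s \<le> 8 * exp (s / 4)\<close>,
    that is \<open>1 + r \<le> exp r\<close> at \<open>r = s / 4\<close>; the rest comes from
    \<open>|x + y|^2 \<le> 2 * |x|^2 + 2 * |y|^2\<close>.\<close>
  let ?c = "?K * (8 + 2 * (norm y)\<^sup>2)"
  have "(\<integral>\<^sup>+x. ennreal ((norm (x + y))\<^sup>2) \<partial>gauss_vec) =
      (\<integral>\<^sup>+x. (\<Prod>i\<in>UNIV. ennreal (std_normal_density (x $ i))) * ennreal ((norm (x + y))\<^sup>2) \<partial>lborel)"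
    by (rule nn_integral_gauss_vec) measurable
  also have "\<dots> \<le> (\<integral>\<^sup>+x. ennreal ?c * (\<Prod>i\<in>UNIV. ennreal (exp (- (x $ i)\<^sup>2 / 4))) \<partial>(lborel :: (real^'n) measure))"
  proof (intro nn_integral_mono)
    fix x :: "real^'n"
    let ?s = "(norm x)\<^sup>2"
    have "(norm (x + y))\<^sup>2 \<le> (norm x + norm y)\<^sup>2" by (intro power_mono norm_triangle_ineq) auto
    also have "\<dots> \<le> 2 * ?s + 2 * (norm y)\<^sup>2"
      using zero_le_power2[of "norm x - norm y"] by (simp add: power2_eq_square algebra_simps)
    finally have 1: "(norm (x + y))\<^sup>2 \<le> 2 * ?s + 2 * (norm y)\<^sup>2" .
    have "1 + ?s / 4 \<le> exp (?s / 4)" by (rule exp_ge_add_one_self)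
    then have "8 + 2 * ?s \<le> 8 * exp (?s / 4)" by linarith
    moreover have "1 * (norm y)\<^sup>2 \<le> exp (?s / 4) * (norm y)\<^sup>2" by (intro mult_right_mono) auto
    moreover have "(8 + 2 * (norm y)\<^sup>2) * exp (?s / 4) = 8 * exp (?s / 4) + 2 * (exp (?s / 4) * (norm y)\<^sup>2)"
      by (simp add: algebra_simps)
    ultimately have "2 * ?s + 2 * (norm y)\<^sup>2 \<le> (8 + 2 * (norm y)\<^sup>2) * exp (?s / 4)" by linarith
    with 1 have "exp (- ?s / 2) * (norm (x + y))\<^sup>2 \<le> exp (- ?s / 2) * ((8 + 2 * (norm y)\<^sup>2) * exp (?s / 4))"
      by (intro mult_left_mono) auto
    also have "\<dots> = (8 + 2 * (norm y)\<^sup>2) * exp (- ?s / 4)"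
      by (simp add: exp_add[symmetric] mult.left_commute)
    finally have "?K * (exp (- ?s / 2) * (norm (x + y))\<^sup>2) \<le> ?K * ((8 + 2 * (norm y)\<^sup>2) * exp (- ?s / 4))"
      by (intro mult_left_mono) auto
    moreover have "exp (- ?s / 4) = (\<Prod>i\<in>UNIV. exp (- (x $ i)\<^sup>2 / 4))"
      by (simp add: norm_vec_def L2_set_def sum_nonneg exp_sum[symmetric] sum_negf sum_divide_distrib)
    ultimately have "(\<Prod>i\<in>UNIV. std_normal_density (x $ i)) * (norm (x + y))\<^sup>2 \<le> ?c * (\<Prod>i\<in>UNIV. exp (- (x $ i)\<^sup>2 / 4))"
      unfolding prod_std_normal_density by (simp only: mult.assoc)
    then show "(\<Prod>i\<in>UNIV. ennreal (std_normal_density (x $ i))) * ennreal ((norm (x + y))\<^sup>2) \<le>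
        ennreal ?c * (\<Prod>i\<in>UNIV. ennreal (exp (- (x $ i)\<^sup>2 / 4)))"
      by (simp add: prod_ennreal ennreal_mult[symmetric] prod_nonneg)
  qed
  also have "\<dots> = ennreal ?c * (\<Prod>i\<in>(UNIV::'n set). ennreal (sqrt (4 * pi)))"
    by (subst nn_integral_cmult, measurable) (subst nn_integral_lborel_vec_prod, simp_all only: exp2, simp)
  also have "\<dots> < \<infinity>"
    by (simp add: ennreal_mult_eq_top_iff ennreal_power less_top[symmetric])
  finally show ?thesis .
qed

section \<open>Fourier integrals of Gaussian functions\<close>

lemma integrable_gaussian: "c > 0 \<Longrightarrow> integrable lborel (\<lambda>t::real. exp (- (c * t\<^sup>2) / 2))"
proof -
  assume c: "c > 0"
  have "integrable lborel (\<lambda>t. sqrt (2 * pi / c) * normal_density 0 (1 / sqrt c) t)"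
    using c by (intro integrable_mult_right integrable_normal_density) auto
  then show ?thesis
    using c by (simp add: normal_density_def power_divide real_sqrt_divide real_sqrt_mult mult.commute)
qed

text \<open>Rescaling by \<open>1 / sqrt c\<close> leads to the characteristic function of the
  standard normal distribution.\<close>

lemma integral_gaussian_iexp:
  assumes c: "c > 0"
  shows "(\<integral>t. complex_of_real (exp (- (c * t\<^sup>2) / 2)) * exp (\<i> * complex_of_real (s * t)) \<partial>lborel) =
    complex_of_real (sqrt (2 * pi / c) * exp (- s\<^sup>2 / (2 * c)))"
proof -
  let ?f = "\<lambda>t. complex_of_real (exp (- (c * t\<^sup>2) / 2)) * exp (\<i> * complex_of_real (s * t))"
  let ?r = "s / sqrt c"
  have "(\<integral>t. ?f t \<partial>lborel) = \<bar>1 / sqrt c\<bar> *\<^sub>R (\<integral>t. ?f (0 + 1 / sqrt c * t) \<partial>lborel)"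
    using c by (intro lborel_integral_real_affine) auto
  also have "(\<integral>t. ?f (0 + 1 / sqrt c * t) \<partial>lborel) = (\<integral>t. complex_of_real (sqrt (2 * pi)) * (std_normal_density t *\<^sub>R iexp (?r * t)) \<partial>lborel)"
    using c by (intro Bochner_Integration.integral_cong refl)
      (simp add: std_normal_density_def scaleR_conv_of_real power_mult_distrib power_divide mult_ac)
  also have "\<dots> = complex_of_real (sqrt (2 * pi)) * (\<integral>t. std_normal_density t *\<^sub>R iexp (?r * t) \<partial>lborel)"
    by (rule integral_mult_right_zero)
  also have "(\<integral>t. std_normal_density t *\<^sub>R iexp (?r * t) \<partial>lborel) = char std_normal_distribution ?r"
    unfolding char_def by (subst integral_density) auto
  also have "\<dots> = complex_of_real (exp (- ?r\<^sup>2 / 2))" by (simp add: char_std_normal_distribution)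
  finally show ?thesis using c
    by (simp add: power_divide real_sqrt_divide scaleR_conv_of_real mult_ac)
qed

text \<open>If \<open>c j \<le> 0\<close> for some \<open>j\<close> the Gaussian does not decay along \<open>e j\<close> and the integral diverges.\<close>

lemma gaussian_fourier_pos:
  fixes e :: "'n::finite \<Rightarrow> real^'n"
  assumes e: "\<And>i j. e i \<bullet> e j = (if i = j then 1 else 0)"
    and fin: "(\<integral>\<^sup>+x. ennreal (exp (- (\<Sum>i\<in>UNIV. c i * (x \<bullet> e i)\<^sup>2) / 2)) \<partial>lborel) < \<infinity>"
  obtains r where "r > 0"
    "(\<integral>x. complex_of_real (exp (- (\<Sum>i\<in>UNIV. c i * (x \<bullet> e i)\<^sup>2) / 2)) * exp (\<i> * complex_of_real (s \<bullet> x)) \<partial>lborel) =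
       complex_of_real r"
proof -
  let ?g = "\<lambda>x. \<Sum>i\<in>UNIV. x $ i *\<^sub>R e i"
  have pr: "exp (- (\<Sum>i\<in>UNIV. c i * (?g x \<bullet> e i)\<^sup>2) / 2) = (\<Prod>i\<in>UNIV. exp (- (c i * (x $ i)\<^sup>2) / 2))" for x
    by (simp add: orthonormal_family(2)[OF e] exp_sum[symmetric] sum_negf sum_divide_distrib)
  have "(\<integral>\<^sup>+x. ennreal (exp (- (\<Sum>i\<in>UNIV. c i * (x \<bullet> e i)\<^sup>2) / 2)) \<partial>lborel) =
      (\<integral>\<^sup>+x. ennreal (exp (- (\<Sum>i\<in>UNIV. c i * (?g x \<bullet> e i)\<^sup>2) / 2)) \<partial>lborel)"
    by (rule nn_integral_lborel_rotate[OF e]) measurable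
  also have "\<dots> = (\<integral>\<^sup>+x. (\<Prod>i\<in>UNIV. ennreal (exp (- (c i * (x $ i)\<^sup>2) / 2))) \<partial>lborel)"
    unfolding pr by (simp add: prod_ennreal)
  also have "\<dots> = (\<Prod>i\<in>UNIV. \<integral>\<^sup>+t. ennreal (exp (- (c i * t\<^sup>2) / 2)) \<partial>lborel)"
    by (rule nn_integral_lborel_vec_prod) measurable
  finally have "(\<Prod>i\<in>UNIV. \<integral>\<^sup>+t. ennreal (exp (- (c i * t\<^sup>2) / 2)) \<partial>lborel) \<noteq> top" using fin by auto
  \<comment> \<open>As \<open>0 * top = 0\<close>, a vanishing factor could hide an infinite one. No
    factor vanishes, so finiteness of the product forces finiteness of each.\<close>
  moreover have "(\<integral>\<^sup>+t. ennreal (exp (- (c i * t\<^sup>2) / 2)) \<partial>lborel) \<noteq> 0" for i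
    by (subst nn_integral_0_iff_AE) (auto simp: eventually_False ae_filter_eq_bot_iff)
  ultimately have "(\<integral>\<^sup>+t. ennreal (exp (- (c i * t\<^sup>2) / 2)) \<partial>lborel) \<noteq> top" for i
    by (auto simp: ennreal_prod_eq_top)
  moreover have "(\<integral>\<^sup>+t. ennreal (exp (- (c i * t\<^sup>2) / 2)) \<partial>lborel) = top" if "c i \<le> 0" for i
  proof -
    have "(\<integral>\<^sup>+t. 1 \<partial>(lborel :: real measure)) \<le> (\<integral>\<^sup>+t. ennreal (exp (- (c i * t\<^sup>2) / 2)) \<partial>lborel)"
      using that by (intro nn_integral_mono) (auto simp: mult_nonpos_nonneg)
    then show ?thesis by (simp add: top_unique)
  qed
  ultimately have c: "c i > 0" for i by (meson not_le)
  let ?r = "\<Prod>i\<in>UNIV. sqrt (2 * pi / c i) * exp (- (s \<bullet> e i)\<^sup>2 / (2 * c i))"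
  have "(\<integral>x. complex_of_real (exp (- (\<Sum>i\<in>UNIV. c i * (x \<bullet> e i)\<^sup>2) / 2)) * exp (\<i> * complex_of_real (s \<bullet> x)) \<partial>lborel) =
      (\<integral>x. complex_of_real (exp (- (\<Sum>i\<in>UNIV. c i * (?g x \<bullet> e i)\<^sup>2) / 2)) * exp (\<i> * complex_of_real (s \<bullet> ?g x)) \<partial>lborel)"
    by (rule lborel_integral_rotate[OF e]) measurable
  also have "\<dots> = (\<integral>x. (\<Prod>i\<in>UNIV. complex_of_real (exp (- (c i * (x $ i)\<^sup>2) / 2)) * exp (\<i> * complex_of_real ((s \<bullet> e i) * x $ i))) \<partial>lborel)"
  proof -
    have "exp (\<i> * complex_of_real (s \<bullet> ?g x)) = (\<Prod>i\<in>UNIV. exp (\<i> * complex_of_real ((s \<bullet> e i) * x $ i)))" for x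
      by (simp add: inner_sum_right exp_sum[symmetric] sum_distrib_left mult_ac)
    then show ?thesis unfolding pr by (simp add: prod.distrib)
  qed
  also have "\<dots> = (\<Prod>i\<in>UNIV. \<integral>t. complex_of_real (exp (- (c i * t\<^sup>2) / 2)) * exp (\<i> * complex_of_real ((s \<bullet> e i) * t)) \<partial>lborel)"
  proof (rule lborel_integral_vec_prod)
    fix i
    show "integrable lborel (\<lambda>t. complex_of_real (exp (- (c i * t\<^sup>2) / 2)) * exp (\<i> * complex_of_real ((s \<bullet> e i) * t)))"
      by (rule Bochner_Integration.integrable_bound[OF integrable_gaussian[OF c[of i]]]) (auto simp: norm_mult)
  qed
  also have "\<dots> = complex_of_real ?r" by (simp only: integral_gaussian_iexp[OF c] of_real_prod)
  finally have eq: "(\<integral>x. complex_of_real (exp (- (\<Sum>i\<in>UNIV. c i * (x \<bullet> e i)\<^sup>2) / 2)) * exp (\<i> * complex_of_real (s \<bullet> x)) \<partial>lborel) =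
      complex_of_real ?r" .
  have "?r > 0" using c by (intro prod_pos) simp
  with eq show ?thesis using that by blast
qed

section \<open>The matrix pencil\<close>

text \<open>Eigenvalues of opposite sign merge in \<open>M ** M\<close>, so its eigenbasis
  \<open>W\<close> need not diagonalize \<open>M\<close>. Since \<open>f\<close> is even,
  \<open>mat_fun f M\<close> equals \<open>mat_fun g (M ** M)\<close>, which by
  \<open>mat_fun_diag\<close> may be computed in any diagonalization of the square. For the pencil
  this permits a real basis.\<close>

lemma mat_fun_even:
  assumes herm: "adjoint_mat M = M" and W: "unitary_mat W"
    and sq: "M ** M = W ** diag_mat s ** adjoint_mat W" and f: "\<And>z. f z = g (z\<^sup>2)"
  shows "mat_fun f M = W ** diag_mat (g \<circ> s) ** adjoint_mat W"
proof -
  obtain V d where V: "unitary_mat V" and M: "M = V ** diag_mat d ** adjoint_mat V"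
    using hermitian_unitary_diagonalization[OF herm] by metis
  have "M ** M = V ** (diag_mat d ** (adjoint_mat V ** V) ** diag_mat d) ** adjoint_mat V"
    by (simp add: M matrix_mul_assoc)
  also have "adjoint_mat V ** V = mat 1" using V by (simp add: unitary_mat_def)
  also have "diag_mat d ** mat 1 ** diag_mat d = diag_mat (\<lambda>i. (d i)\<^sup>2)"
    by (simp add: vec_eq_iff diag_mat_mult_nth) (simp add: diag_mat_def power2_eq_square)
  finally have "mat_fun g (M ** M) = V ** diag_mat (g \<circ> (\<lambda>i. (d i)\<^sup>2)) ** adjoint_mat V"
    by (rule mat_fun_diag[OF V])
  also have "g \<circ> (\<lambda>i. (d i)\<^sup>2) = f \<circ> d" by (auto simp: f)
  also have "V ** diag_mat (f \<circ> d) ** adjoint_mat V = mat_fun f M"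
    by (rule mat_fun_diag[OF V M, symmetric])
  finally show ?thesis using mat_fun_diag[OF W sq, of g] by simp
qed

lemma det_unitary_conjugate:
  assumes W: "unitary_mat W"
  shows "det (W ** diag_mat d ** adjoint_mat W) = (\<Prod>i\<in>UNIV. d i)"
proof -
  have "det (W ** diag_mat d ** adjoint_mat W) = det (W ** adjoint_mat W) * det (diag_mat d)"
    by (simp add: det_mul)
  also have "det (W ** adjoint_mat W) = 1" using W by (simp add: unitary_mat_def)
  also have "det (diag_mat d) = (\<Prod>i\<in>UNIV. d i)" by (subst det_diagonal) (auto simp: diag_mat_def)
  finally show ?thesis by simp
qed

lemma hermitian_inner_unitary_conjugate:
  "hermitian_inner ((W ** diag_mat d ** adjoint_mat W) *v x) x =
    (\<Sum>i\<in>UNIV. d i * of_real ((cmod ((adjoint_mat W *v x) $ i))\<^sup>2))"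
proof -
  let ?y = "adjoint_mat W *v x"
  have "hermitian_inner ((W ** diag_mat d ** adjoint_mat W) *v x) x = hermitian_inner (W *v (diag_mat d *v ?y)) x"
    by (simp add: matrix_vector_mul_assoc matrix_mul_assoc)
  also have "\<dots> = hermitian_inner (diag_mat d *v ?y) ?y" by (rule hermitian_inner_adjoint)
  also have "\<dots> = (\<Sum>i\<in>UNIV. d i * (?y $ i * cnj (?y $ i)))"
    unfolding hermitian_inner_def
    by (intro sum.cong refl)
      (simp add: matrix_vector_mult_def diag_mat_def if_distrib[of "\<lambda>t. t * _"] mult.assoc cong: if_cong)
  finally show ?thesis by (simp only: complex_norm_square)
qed

definition pencil :: "('m::finite \<Rightarrow> real^'q::finite^'q) \<Rightarrow> real^'m \<Rightarrow> real^'q^'q" where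
  "pencil U l = (\<Sum>j\<in>UNIV. l $ j *\<^sub>R U j)"

lemma U_pencil_nth: "U_pencil U l $ a $ b = \<i> * of_real (pencil U l $ a $ b)"
  by (simp add: U_pencil_def pencil_def)

lemma pencil_skew:
  assumes "\<And>j. transpose (U j) = - U j"
  shows "pencil U l $ a $ b = - pencil U l $ b $ a"
proof -
  have "U j $ a $ b = - U j $ b $ a" for j
    using arg_cong[OF assms[of j], of "\<lambda>M. M $ b $ a"] by (simp add: transpose_def)
  then show ?thesis
    unfolding pencil_def by (simp add: sum_negf[symmetric])
qed

text \<open>Skew-symmetry gives \<open>(i A)^2 = A^T A\<close> for \<open>A = pencil U l\<close>, a
  real symmetric matrix, so even functions of \<open>U_pencil U l\<close> are diagonal in a real
  orthonormal basis. The \<open>b i\<close> are the eigenvalues of \<open>A^T A / 4\<close>, the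
  variable of the Bessel series; hence \<open>4 * b i\<close> as argument of
  \<open>g\<close>.\<close>

lemma pencil_eigenbasis:
  fixes U :: "'m::finite \<Rightarrow> real^'q::finite^'q"
  assumes skew: "\<And>j. transpose (U j) = - U j"
  obtains e :: "'q \<Rightarrow> real^'q" and b where "\<And>i j. e i \<bullet> e j = (if i = j then 1 else 0)"
    "\<And>i. b i \<ge> 0" "\<And>v. (norm (pencil U l *v v))\<^sup>2 / 4 = (\<Sum>i\<in>UNIV. b i * (v \<bullet> e i)\<^sup>2)"
    "\<And>i. b i = (norm (pencil U l *v e i))\<^sup>2 / 4"
    "\<And>f g. (\<And>z. f z = g (z\<^sup>2)) \<Longrightarrow> det (mat_fun f (U_pencil U l)) = (\<Prod>i\<in>UNIV. g (of_real (4 * b i)))"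
    "\<And>f g X. (\<And>z. f z = g (z\<^sup>2)) \<Longrightarrow>
      hermitian_inner (mat_fun f (U_pencil U l) *v complexify X) (complexify X) =
        (\<Sum>i\<in>UNIV. g (of_real (4 * b i)) * of_real ((X \<bullet> e i)\<^sup>2))"
proof -
  define A where "A = pencil U l"
  define F where "F v = (1 / 4) *\<^sub>R (transpose A *v (A *v v))" for v
  have "linear F"
    unfolding F_def by (intro linear_compose_scale_right linear_compose[unfolded o_def, of "(*v) A" "(*v) (transpose A)"]) auto
  moreover have Fdot: "F x \<bullet> y = (A *v x) \<bullet> (A *v y) / 4" for x y
    by (simp add: F_def dot_lmul_matrix[symmetric] transpose_matrix_vector)
  then have "F x \<bullet> y = x \<bullet> F y" for x y by (metis inner_commute)
  ultimately obtain e :: "'q \<Rightarrow> real^'q" and b where e: "\<And>i j. e i \<bullet> e j = (if i = j then 1 else 0)"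
    and Fe: "\<And>i. F (e i) = b i *\<^sub>R e i"
    using selfadjoint_orthonormal_eigenbasis[of F] by metis
  have b: "b i = (norm (A *v e i))\<^sup>2 / 4" for i
    using Fdot[of "e i" "e i"] by (simp add: Fe e power2_norm_eq_inner)
  have q: "(norm (A *v v))\<^sup>2 / 4 = (\<Sum>i\<in>UNIV. b i * (v \<bullet> e i)\<^sup>2)" for v
  proof -
    have "(norm (A *v v))\<^sup>2 / 4 = F v \<bullet> v" by (simp add: Fdot power2_norm_eq_inner)
    also have "\<dots> = (\<Sum>i\<in>UNIV. b i * (v \<bullet> e i)\<^sup>2)" using \<open>linear F\<close> e Fe by (rule selfadjoint_quadratic_form)
    finally show ?thesis .
  qed
  define M where "M = U_pencil U l"
  define W where "W = (\<chi> a i. complex_of_real (e i $ a))"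
  define s where "s i = complex_of_real (4 * b i)" for i
  have Mn: "M $ a $ c = \<i> * of_real (A $ a $ c)" for a c
    by (simp add: M_def A_def U_pencil_nth)
  have As: "A $ a $ c = - A $ c $ a" for a c unfolding A_def by (rule pencil_skew[OF skew])
  have herm: "adjoint_mat M = M"
  proof -
    have "cnj (M $ c $ a) = M $ a $ c" for a c using As[of a c] by (simp add: Mn)
    then show ?thesis by (simp add: vec_eq_iff adjoint_mat_def)
  qed
  have "(adjoint_mat W ** W) $ i $ j = of_real (e i \<bullet> e j)" for i j
    by (simp add: matrix_matrix_mult_def adjoint_mat_def W_def inner_vec_def)
  then have W1: "adjoint_mat W ** W = mat 1" by (auto simp: vec_eq_iff e mat_def)
  then have W2: "W ** adjoint_mat W = mat 1" by (simp add: matrix_left_right_inverse)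
  with W1 have W: "unitary_mat W" by (simp add: unitary_mat_def)
  have "(M ** M ** W) $ a $ i = (W ** diag_mat s) $ a $ i" for a i
  proof -
    have MM: "(M ** M) $ a $ c = of_real ((transpose A ** A) $ a $ c)" for c
    proof -
      have "(M ** M) $ a $ c = (\<Sum>k\<in>UNIV. of_real (- A $ a $ k * A $ k $ c))"
        unfolding matrix_matrix_mult_def by (simp add: Mn algebra_simps)
      also have "\<dots> = (\<Sum>k\<in>UNIV. of_real (A $ k $ a * A $ k $ c))"
        by (intro sum.cong refl) (simp add: As[of a])
      finally show ?thesis by (simp add: matrix_matrix_mult_def transpose_def)
    qed
    have "(M ** M ** W) $ a $ i = (\<Sum>c\<in>UNIV. (M ** M) $ a $ c * W $ c $ i)"
      by (simp add: matrix_matrix_mult_def)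
    also have "\<dots> = of_real (((transpose A ** A) *v e i) $ a)"
      by (simp add: MM W_def matrix_vector_mult_def)
    also have "(transpose A ** A) *v e i = 4 *\<^sub>R F (e i)"
      by (simp add: F_def matrix_vector_mul_assoc)
    also have "of_real ((4 *\<^sub>R F (e i)) $ a) = (W ** diag_mat s) $ a $ i"
      by (simp add: diag_mat_mult_nth Fe W_def s_def)
    finally show ?thesis .
  qed
  then have "M ** M ** W = W ** diag_mat s" by (simp add: vec_eq_iff)
  then have sq: "M ** M = W ** diag_mat s ** adjoint_mat W"
    by (metis W2 matrix_mul_assoc matrix_mul_rid)
  show ?thesis
  proof (rule that[OF e])
    show "b i \<ge> 0" for i by (simp add: b)
    show "(norm (pencil U l *v v))\<^sup>2 / 4 = (\<Sum>i\<in>UNIV. b i * (v \<bullet> e i)\<^sup>2)" for v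
      using q by (simp add: A_def)
    show "b i = (norm (pencil U l *v e i))\<^sup>2 / 4" for i using b by (simp add: A_def)
    fix f g :: "complex \<Rightarrow> complex" assume fg: "\<And>z. f z = g (z\<^sup>2)"
    have mf: "mat_fun f (U_pencil U l) = W ** diag_mat (g \<circ> s) ** adjoint_mat W"
      using mat_fun_even[where f = f and g = g, OF herm W sq fg] by (simp add: M_def)
    show "det (mat_fun f (U_pencil U l)) = (\<Prod>i\<in>UNIV. g (of_real (4 * b i)))"
      unfolding mf det_unitary_conjugate[OF W] by (simp add: s_def)
    fix X
    have "(adjoint_mat W *v complexify X) $ i = of_real (X \<bullet> e i)" for i
      by (simp add: matrix_vector_mult_def adjoint_mat_def W_def complexify_def inner_vec_def mult.commute)
    then show "hermitian_inner (mat_fun f (U_pencil U l) *v complexify X) (complexify X) =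
        (\<Sum>i\<in>UNIV. g (of_real (4 * b i)) * of_real ((X \<bullet> e i)\<^sup>2))"
      unfolding mf hermitian_inner_unitary_conjugate by (simp add: s_def)
  qed
qed

section \<open>Sequences of independent Gaussian vectors\<close>

text \<open>All coefficients of the series are positive, so its first \<open>M + 1\<close> terms
  dominate a multiple of the binomial expansion. Growth of arbitrary polynomial order is what beats
  the dimension of the \<open>l\<close>-space.\<close>

lemma bessel_s_ge_power:
  obtains c where "c > 0" "\<And>w. w \<ge> 0 \<Longrightarrow> c * (1 + w) ^ M \<le> bessel_s k w"
proof -
  \<comment> \<open>The sum of the ratios bounds each of them at once.\<close>
  define C where "C = (\<Sum>n\<le>M. real (M choose n) / Q_coeff k n)"
  have nn: "0 \<le> real (M choose n) / Q_coeff k n" for n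
    using Q_coeff_pos[of k n] by (simp add: less_imp_le)
  have "0 < real (M choose 0) / Q_coeff k 0" using Q_coeff_pos[of k 0] by simp
  also have "\<dots> \<le> C" unfolding C_def by (rule member_le_sum) (auto simp: nn)
  finally have C: "C > 0" .
  have "(1 / C) * (1 + w) ^ M \<le> bessel_s k w" if w: "w \<ge> 0" for w
  proof -
    have "(1 + w) ^ M = (\<Sum>n\<le>M. real (M choose n) * w ^ n)"
      using binomial_ring[of w 1 M] by (simp add: add.commute)
    also have "\<dots> \<le> (\<Sum>n\<le>M. C * (Q_coeff k n * w ^ n))"
    proof (rule sum_mono)
      fix n assume n: "n \<in> {..M}"
      have "real (M choose n) / Q_coeff k n \<le> C"
        unfolding C_def using n by (intro member_le_sum) (auto simp: nn)
      then have "real (M choose n) \<le> C * Q_coeff k n"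
        using Q_coeff_pos[of k n] by (simp add: field_simps)
      then have "real (M choose n) * w ^ n \<le> (C * Q_coeff k n) * w ^ n"
        using w by (intro mult_right_mono) auto
      then show "real (M choose n) * w ^ n \<le> C * (Q_coeff k n * w ^ n)" by (simp add: mult.assoc)
    qed
    also have "\<dots> = C * (\<Sum>n\<le>M. Q_coeff k n * w ^ n)" by (simp add: sum_distrib_left)
    also have "\<dots> \<le> C * bessel_s k w"
      unfolding bessel_s_def using C w Q_coeff_pos[of k]
      by (intro mult_left_mono sum_le_suminf summable_Q_coeff_real) (auto simp: less_imp_le)
    finally show ?thesis using C by (simp add: field_simps)
  qed
  then show ?thesis using that[of "1 / C"] C by simp
qed

text \<open>Links trace and determinant: a lower bound for the sum of the eigenvalues becomes one
  for the product over them.\<close>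

lemma one_plus_sum_le_prod:
  fixes b :: "'a \<Rightarrow> real"
  assumes "finite I" "\<And>i. i \<in> I \<Longrightarrow> b i \<ge> 0"
  shows "1 + (\<Sum>i\<in>I. b i) \<le> (\<Prod>i\<in>I. 1 + b i)"
  using assms
proof (induction I)
  case (insert i I)
  have "1 + (b i + (\<Sum>i\<in>I. b i)) \<le> (1 + b i) * (1 + (\<Sum>i\<in>I. b i))"
    using insert.prems by (simp add: algebra_simps sum_nonneg)
  also have "\<dots> \<le> (1 + b i) * (\<Prod>i\<in>I. 1 + b i)"
    using insert by (intro mult_left_mono) auto
  finally show ?case using insert.hyps by simp
qed simp

text \<open>One independent Gaussian vector for every factor in the product formula for
  \<open>bessel_s\<close>.\<close>

definition gauss_seq :: "(nat \<Rightarrow> real^'n::finite) measure" where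
  "gauss_seq = PiM UNIV (\<lambda>_. gauss_vec)"

lemma product_prob_space_gauss_vec: "product_prob_space (\<lambda>_. gauss_vec :: (real^'n::finite) measure)"
  by (intro product_prob_spaceI prob_space_gauss_vec)

lemma prob_space_gauss_seq: "prob_space (gauss_seq :: (nat \<Rightarrow> real^'n::finite) measure)"
  unfolding gauss_seq_def by (intro prob_space_PiM prob_space_gauss_vec)

lemma measurable_gauss_seq_component: "(\<lambda>\<omega>. \<omega> n) \<in> borel_measurable gauss_seq"
proof -
  have "(\<lambda>\<omega>. \<omega> n) \<in> measurable (PiM UNIV (\<lambda>_. gauss_vec)) gauss_vec"
    by (rule measurable_component_singleton) simp
  then show ?thesis by (simp add: gauss_seq_def cong: measurable_cong_sets)
qed

text \<open>Only finitely many coordinates occur, so the infinite product measure may be replaced by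
  a finite marginal, on which the integral factors.\<close>

lemma nn_integral_gauss_seq_prod:
  fixes f :: "nat \<Rightarrow> real^'n::finite \<Rightarrow> ennreal"
  assumes [measurable]: "\<And>n. f n \<in> borel_measurable borel"
  shows "(\<integral>\<^sup>+\<omega>. (\<Prod>n<N. f n (\<omega> n)) \<partial>gauss_seq) = (\<Prod>n<N. \<integral>\<^sup>+v. f n v \<partial>gauss_vec)"
proof -
  interpret product_prob_space "\<lambda>_::nat. gauss_vec :: (real^'n) measure" UNIV
    by (rule product_prob_space_gauss_vec)
  have m: "f n \<in> borel_measurable gauss_vec" for n
    using assms by (simp cong: measurable_cong_sets)
  have "(\<Prod>n<N. \<integral>\<^sup>+v. f n v \<partial>gauss_vec) = (\<integral>\<^sup>+\<omega>. (\<Prod>n<N. f n (\<omega> n)) \<partial>PiM {..<N} (\<lambda>_. gauss_vec))"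
    by (rule product_nn_integral_prod[symmetric]) (auto simp: m)
  also have "\<dots> = (\<integral>\<^sup>+\<omega>. (\<Prod>n<N. f n (\<omega> n)) \<partial>distr (PiM UNIV (\<lambda>_. gauss_vec)) (PiM {..<N} (\<lambda>_. gauss_vec)) (\<lambda>x. restrict x {..<N}))"
    by (subst distr_PiM_restrict_finite) auto
  also have "\<dots> = (\<integral>\<^sup>+\<omega>. (\<Prod>n<N. f n (restrict \<omega> {..<N} n)) \<partial>PiM UNIV (\<lambda>_. gauss_vec))"
  proof (rule nn_integral_distr)
    show "(\<lambda>x. restrict x {..<N}) \<in> PiM UNIV (\<lambda>_. gauss_vec) \<rightarrow>\<^sub>M PiM {..<N} (\<lambda>_. gauss_vec)"
      by (rule measurable_restrict_subset) simp
    have "(\<lambda>\<omega>. \<Prod>n<N. f n (\<omega> n)) \<in> borel_measurable (PiM {..<N} (\<lambda>_. gauss_vec))"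
    proof (rule borel_measurable_prod_ennreal)
      fix i assume "i \<in> {..<N}"
      then have "(\<lambda>\<omega>. \<omega> i) \<in> PiM {..<N} (\<lambda>_. gauss_vec) \<rightarrow>\<^sub>M gauss_vec"
        by (rule measurable_component_singleton)
      then show "(\<lambda>\<omega>. f i (\<omega> i)) \<in> borel_measurable (PiM {..<N} (\<lambda>_. gauss_vec))"
        by (rule measurable_compose) (rule m)
    qed
    then show "(\<lambda>\<omega>. \<Prod>n<N. f n (\<omega> n)) \<in> borel_measurable (distr (PiM UNIV (\<lambda>_. gauss_vec)) (PiM {..<N} (\<lambda>_. gauss_vec)) (\<lambda>x. restrict x {..<N}))"
      by simp
  qed
  also have "\<dots> = (\<integral>\<^sup>+\<omega>. (\<Prod>n<N. f n (\<omega> n)) \<partial>gauss_seq)"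
    unfolding gauss_seq_def by (intro nn_integral_cong prod.cong refl) simp
  finally show ?thesis ..
qed

lemma nn_integral_gauss_seq_component:
  fixes f :: "real^'n::finite \<Rightarrow> ennreal"
  assumes [measurable]: "f \<in> borel_measurable borel"
  shows "(\<integral>\<^sup>+\<omega>. f (\<omega> n) \<partial>gauss_seq) = (\<integral>\<^sup>+v. f v \<partial>gauss_vec)"
proof -
  interpret product_prob_space "\<lambda>_::nat. gauss_vec :: (real^'n) measure" UNIV
    by (rule product_prob_space_gauss_vec)
  have m: "f \<in> borel_measurable gauss_vec"
    using assms by (simp cong: measurable_cong_sets)
  have "(\<integral>\<^sup>+v. f v \<partial>gauss_vec) = (\<integral>\<^sup>+v. f v \<partial>distr (PiM UNIV (\<lambda>_. gauss_vec)) gauss_vec (\<lambda>\<omega>. \<omega> n))"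
    by (subst PiM_component) auto
  also have "\<dots> = (\<integral>\<^sup>+\<omega>. f (\<omega> n) \<partial>PiM UNIV (\<lambda>_. gauss_vec))"
    by (rule nn_integral_distr) (auto simp: m)
  finally show ?thesis by (simp add: gauss_seq_def)
qed

text \<open>The expectation of the series is the sum of the \<open>u n\<close> times a finite second
  moment. Convergence has to be secured because \<open>suminf\<close> is a limit of partial sums
  only for summable series.\<close>

lemma AE_gauss_seq_summable:
  fixes x :: "real^'n::finite"
  assumes u: "\<And>n. u n \<ge> 0" "summable u"
  shows "AE \<omega> in gauss_seq. summable (\<lambda>n. u n * (norm (\<omega> n + x))\<^sup>2)"
proof -
  let ?m = "\<integral>\<^sup>+v. ennreal ((norm (v + x))\<^sup>2) \<partial>gauss_vec"
  have [measurable]: "(\<lambda>\<omega>. ennreal (u n * (norm (\<omega> n + x))\<^sup>2)) \<in> borel_measurable gauss_seq" for n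
    by (rule measurable_compose[OF measurable_gauss_seq_component]) measurable
  have "(\<integral>\<^sup>+\<omega>. (\<Sum>n. ennreal (u n * (norm (\<omega> n + x))\<^sup>2)) \<partial>gauss_seq) =
      (\<Sum>n. \<integral>\<^sup>+\<omega>. ennreal (u n * (norm (\<omega> n + x))\<^sup>2) \<partial>gauss_seq)"
    by (rule nn_integral_suminf) measurable
  also have "\<dots> = (\<Sum>n. ennreal (u n) * ?m)"
  proof (intro suminf_cong)
    fix n
    have "(\<integral>\<^sup>+\<omega>. ennreal (u n * (norm (\<omega> n + x))\<^sup>2) \<partial>gauss_seq) =
        (\<integral>\<^sup>+v. ennreal (u n * (norm (v + x))\<^sup>2) \<partial>gauss_vec)"
      by (rule nn_integral_gauss_seq_component) measurable
    also have "\<dots> = ennreal (u n) * ?m"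
      unfolding ennreal_mult[OF u(1) zero_le_power2] by (rule nn_integral_cmult) measurable
    finally show "(\<integral>\<^sup>+\<omega>. ennreal (u n * (norm (\<omega> n + x))\<^sup>2) \<partial>gauss_seq) = ennreal (u n) * ?m" .
  qed
  also have "\<dots> = ennreal (\<Sum>n. u n) * ?m"
    using u by (simp add: suminf_ennreal2[symmetric])
  also have "\<dots> < \<infinity>"
    using nn_integral_gauss_vec_norm_power2_finite[of x] by (simp add: ennreal_mult_less_top)
  finally have "AE \<omega> in gauss_seq. (\<Sum>n. ennreal (u n * (norm (\<omega> n + x))\<^sup>2)) \<noteq> \<infinity>"
    by (intro nn_integral_noteq_infinite) auto
  then show ?thesis
    by eventually_elim (auto intro!: summable_suminf_not_top simp: u)
qed

text \<open>By independence the integrals of finite products factor. Since \<open>t n\<close> is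
  nonnegative these products are at most \<open>1\<close>, so dominated convergence applies on the
  probability space.\<close>

lemma gauss_seq_exp_series:
  fixes t :: "nat \<Rightarrow> real^'n::finite \<Rightarrow> real"
  assumes [measurable]: "\<And>n. t n \<in> borel_measurable borel" and t: "\<And>n v. t n v \<ge> 0"
    and sm: "AE \<omega> in gauss_seq. summable (\<lambda>n. t n (\<omega> n))"
    and G: "\<And>n. (\<integral>\<^sup>+v. ennreal (exp (- t n v)) \<partial>gauss_vec) = ennreal (G n)" "\<And>n. G n \<ge> 0"
  shows "(\<lambda>N. \<Prod>n<N. G n) \<longlonglongrightarrow> (\<integral>\<omega>. exp (- (\<Sum>n. t n (\<omega> n))) \<partial>gauss_seq)"
proof -
  interpret prob_space "gauss_seq :: (nat \<Rightarrow> real^'n) measure" by (rule prob_space_gauss_seq)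
  have [measurable]: "(\<lambda>\<omega>. t n (\<omega> n)) \<in> borel_measurable gauss_seq" for n
    by (rule measurable_compose[OF measurable_gauss_seq_component]) measurable
  have "(\<integral>\<omega>. (\<Prod>n<N. exp (- t n (\<omega> n))) \<partial>gauss_seq) = (\<Prod>n<N. G n)" for N
  proof -
    have "(\<integral>\<^sup>+\<omega>. ennreal (\<Prod>n<N. exp (- t n (\<omega> n))) \<partial>gauss_seq) =
        (\<integral>\<^sup>+\<omega>. (\<Prod>n<N. ennreal (exp (- t n (\<omega> n)))) \<partial>gauss_seq)"
      by (simp add: prod_ennreal)
    also have "\<dots> = (\<Prod>n<N. ennreal (G n))"
      by (subst nn_integral_gauss_seq_prod) (measurable, simp only: G)
    also have "\<dots> = ennreal (\<Prod>n<N. G n)" using G by (simp add: prod_ennreal)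
    finally show ?thesis
      using G by (subst integral_eq_nn_integral) (auto simp: prod_nonneg)
  qed
  moreover have "(\<lambda>N. \<integral>\<omega>. (\<Prod>n<N. exp (- t n (\<omega> n))) \<partial>gauss_seq) \<longlonglongrightarrow>
      (\<integral>\<omega>. exp (- (\<Sum>n. t n (\<omega> n))) \<partial>gauss_seq)"
  proof (rule integral_dominated_convergence[where w = "\<lambda>_. 1"])
    show "AE \<omega> in gauss_seq. (\<lambda>N. \<Prod>n<N. exp (- t n (\<omega> n))) \<longlonglongrightarrow> exp (- (\<Sum>n. t n (\<omega> n)))"
      using sm
    proof eventually_elim
      case (elim \<omega>)
      then have "(\<lambda>N. exp (- (\<Sum>n<N. t n (\<omega> n)))) \<longlonglongrightarrow> exp (- (\<Sum>n. t n (\<omega> n)))"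
        by (intro tendsto_intros summable_LIMSEQ)
      then show ?case by (simp add: exp_sum sum_negf[symmetric])
    qed
    show "AE \<omega> in gauss_seq. norm (\<Prod>n<N. exp (- t n (\<omega> n))) \<le> 1" for N
      by (intro AE_I2) (auto simp: prod_nonneg t intro!: prod_le_1)
    show "integrable (gauss_seq :: (nat \<Rightarrow> real^'n) measure) (\<lambda>_. 1 :: real)" by simp
  qed measurable
  ultimately show ?thesis by simp
qed

section \<open>The pencil as a function of its parameter\<close>

lemma pencil_mult_vec: "pencil U l *v v = (\<Sum>j\<in>UNIV. l $ j *\<^sub>R (U j *v v))"
proof -
  have lin: "linear (\<lambda>A. A *v v)"
    by (intro linearI) (simp_all add: matrix_vector_mult_add_rdistrib scaleR_matrix_vector_assoc)
  show ?thesis unfolding pencil_def by (simp add: linear_sum[OF lin] linear_scale[OF lin])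
qed

lemma norm_matrix_vector_mult_le:
  fixes A :: "real^'n::finite^'m::finite"
  obtains K where "K > 0" "\<And>v. norm (A *v v) \<le> K * norm v"
proof -
  have "bounded_linear ((*v) A)" by (simp add: linear_conv_bounded_linear[symmetric])
  from bounded_linear.pos_bounded[OF this] show ?thesis using that by (metis mult.commute)
qed

lemma summable_norm_matrix_vector_mult:
  fixes A :: "real^'n::finite^'m::finite"
  assumes u: "\<And>n. u n \<ge> 0" and sm: "summable (\<lambda>n. u n * (norm (v n))\<^sup>2)"
  shows "summable (\<lambda>n. u n * (norm (A *v v n))\<^sup>2)"
proof -
  obtain K where K: "K > 0" "\<And>v. norm (A *v v) \<le> K * norm v" using norm_matrix_vector_mult_le by blast
  show ?thesis
  proof (rule summable_comparison_test')
    show "summable (\<lambda>n. K\<^sup>2 * (u n * (norm (v n))\<^sup>2))" by (intro summable_mult sm)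
    fix n
    have "(norm (A *v v n))\<^sup>2 \<le> (K * norm (v n))\<^sup>2" by (intro power_mono K) auto
    then have "u n * (norm (A *v v n))\<^sup>2 \<le> u n * (K * norm (v n))\<^sup>2"
      using u by (intro mult_left_mono) auto
    then show "norm (u n * (norm (A *v v n))\<^sup>2) \<le> K\<^sup>2 * (u n * (norm (v n))\<^sup>2)"
      using u[of n] by (simp add: power_mult_distrib mult_ac)
  qed
qed

lemma borel_measurable_matrix_vector_mult_add:
  fixes A :: "real^'n::finite^'m::finite"
  shows "(\<lambda>v. A *v (v + x)) \<in> borel_measurable borel"
proof -
  have "continuous_on UNIV ((*v) A)"
    by (rule linear_continuous_on) (simp add: linear_conv_bounded_linear[symmetric])
  then have "continuous_on UNIV (\<lambda>v. A *v (v + x))"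
    by (rule continuous_on_compose2) (auto intro!: continuous_intros)
  then show ?thesis by (rule borel_measurable_continuous_onI)
qed

text \<open>Linearity of \<open>pencil U l *v v n\<close> in \<open>l\<close> makes the series a
  quadratic form in \<open>l\<close>, whose matrix is the weighted sum of the Gram matrices of the
  vectors \<open>U j *v v n\<close>; Cauchy-Schwarz makes its entries converge. The basis
  \<open>e\<close> belongs to the \<open>l\<close>-space and is unrelated to the eigenbases of the
  pencil.\<close>

lemma pencil_series_quadratic_form:
  fixes U :: "'m::finite \<Rightarrow> real^'q::finite^'q"
  assumes u: "\<And>n. u n \<ge> 0" and sm: "summable (\<lambda>n. u n * (norm (v n))\<^sup>2)"
  obtains e :: "'m \<Rightarrow> real^'m" and c where "\<And>i j. e i \<bullet> e j = (if i = j then 1 else 0)"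
    "\<And>l. (\<Sum>n. u n * (norm (pencil U l *v v n))\<^sup>2) = (\<Sum>j\<in>UNIV. c j * (l \<bullet> e j)\<^sup>2)"
proof -
  define a where "a j k n = u n * ((U j *v v n) \<bullet> (U k *v v n))" for j k n
  have sma: "summable (a j k)" for j k
  proof -
    obtain K1 where K1: "K1 > 0" "\<And>v. norm (U j *v v) \<le> K1 * norm v" using norm_matrix_vector_mult_le by blast
    obtain K2 where K2: "K2 > 0" "\<And>v. norm (U k *v v) \<le> K2 * norm v" using norm_matrix_vector_mult_le by blast
    show ?thesis
    proof (rule summable_comparison_test')
      show "summable (\<lambda>n. (K1 * K2) * (u n * (norm (v n))\<^sup>2))" by (intro summable_mult sm)
      fix n
      have "\<bar>(U j *v v n) \<bullet> (U k *v v n)\<bar> \<le> norm (U j *v v n) * norm (U k *v v n)"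
        by (rule Cauchy_Schwarz_ineq2)
      also have "\<dots> \<le> (K1 * norm (v n)) * (K2 * norm (v n))"
        using K1 K2 by (intro mult_mono) (auto simp: less_imp_le)
      finally have "u n * \<bar>(U j *v v n) \<bullet> (U k *v v n)\<bar> \<le> u n * ((K1 * norm (v n)) * (K2 * norm (v n)))"
        using u by (intro mult_left_mono) auto
      then show "norm (a j k n) \<le> (K1 * K2) * (u n * (norm (v n))\<^sup>2)"
        using u[of n] by (simp add: a_def abs_mult power2_eq_square mult_ac)
    qed
  qed
  define C where "C = (\<chi> j k. \<Sum>n. a j k n)"
  have sym: "C $ j $ k = C $ k $ j" for j k by (simp add: C_def a_def inner_commute)
  have lin: "linear ((*v) C)" by simp
  have "transpose C = C" by (simp add: vec_eq_iff transpose_def sym)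
  then have "(C *v x) \<bullet> y = x \<bullet> (C *v y)" for x y
    by (metis dot_lmul_matrix inner_commute transpose_matrix_vector)
  from selfadjoint_orthonormal_eigenbasis[OF lin this]
  obtain e :: "'m \<Rightarrow> real^'m" and c where e: "\<And>i j. e i \<bullet> e j = (if i = j then 1 else 0)"
    and Ce: "\<And>i. C *v e i = c i *\<^sub>R e i" by metis
  have "(\<Sum>n. u n * (norm (pencil U l *v v n))\<^sup>2) = (C *v l) \<bullet> l" for l
  proof -
    have "u n * (norm (pencil U l *v v n))\<^sup>2 = (\<Sum>j\<in>UNIV. \<Sum>k\<in>UNIV. l $ j * l $ k * a j k n)" for n
      unfolding pencil_mult_vec power2_norm_eq_inner inner_sum_left inner_sum_right a_def sum_distrib_left
      by (intro sum.cong refl) (simp add: mult_ac inner_commute)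
    moreover have "(\<lambda>n. \<Sum>j\<in>UNIV. \<Sum>k\<in>UNIV. l $ j * l $ k * a j k n) sums
        (\<Sum>j\<in>UNIV. \<Sum>k\<in>UNIV. l $ j * l $ k * C $ j $ k)"
      by (intro sums_sum sums_mult) (simp add: C_def summable_sums[OF sma])
    moreover have "(\<Sum>j\<in>UNIV. \<Sum>k\<in>UNIV. l $ j * l $ k * C $ j $ k) = (C *v l) \<bullet> l"
      by (simp add: inner_vec_def matrix_vector_mult_def sum_distrib_left sum_distrib_right mult_ac)
    ultimately show ?thesis by (simp add: sums_iff)
  qed
  then show ?thesis using that[OF e] selfadjoint_quadratic_form[OF lin e Ce] by simp
qed

section \<open>The kernel as a mixture\<close>

text \<open>The value of \<open>bessel_Q k z\<close> as a real number when
  \<open>z^2 / 4 = b\<close>.\<close>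

definition bessel_q :: "nat \<Rightarrow> real \<Rightarrow> real" where
  "bessel_q k b = 2 powr (- (real k + 1 / 2)) * bessel_s k b"

lemma bessel_q_pos: "b \<ge> 0 \<Longrightarrow> bessel_q k b > 0"
  by (simp add: bessel_q_def bessel_s_pos)

lemma bessel_Q_eq_bessel_S: "bessel_Q k z = of_real (2 powr (- (real k + 1 / 2))) * bessel_S k (z\<^sup>2 / 4)"
proof -
  have "complex_of_real (2 powr (- (real k + 1 / 2))) = 2 powr (- (of_nat k + 1 / 2))"
    using powr_of_real[of 2 "- (real k + 1 / 2)"] by simp
  then show ?thesis by (simp only: bessel_Q_eq_series bessel_S_def)
qed

lemma pencil_bessel_diagonalization:
  fixes U :: "'m::finite \<Rightarrow> real^'q::finite^'q"
  assumes skew: "\<And>j. transpose (U j) = - U j"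
  obtains e :: "'q \<Rightarrow> real^'q" and b where "\<And>i j. e i \<bullet> e j = (if i = j then 1 else 0)"
    "\<And>i. b i \<ge> 0" "\<And>v. (norm (pencil U l *v v))\<^sup>2 / 4 = (\<Sum>i\<in>UNIV. b i * (v \<bullet> e i)\<^sup>2)"
    "\<And>i. b i = (norm (pencil U l *v e i))\<^sup>2 / 4"
    "det (mat_fun (bessel_Q k) (U_pencil U l)) = of_real (\<Prod>i\<in>UNIV. bessel_q k (b i))"
    "\<And>X. hermitian_inner (mat_fun (bessel_R k) (U_pencil U l) *v complexify X) (complexify X) =
        of_real (\<Sum>i\<in>UNIV. 2 * b i * (bessel_s (Suc k) (b i) / bessel_s k (b i)) * (X \<bullet> e i)\<^sup>2)"
proof -
  from pencil_eigenbasis[of U l, OF skew]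
  obtain e :: "'q \<Rightarrow> real^'q" and b where e: "\<And>i j. e i \<bullet> e j = (if i = j then 1 else 0)"
    and b: "\<And>i. b i \<ge> 0" and q: "\<And>v. (norm (pencil U l *v v))\<^sup>2 / 4 = (\<Sum>i\<in>UNIV. b i * (v \<bullet> e i)\<^sup>2)"
    and bi: "\<And>i. b i = (norm (pencil U l *v e i))\<^sup>2 / 4"
    and det: "\<And>f g. (\<And>z. f z = g (z\<^sup>2)) \<Longrightarrow> det (mat_fun f (U_pencil U l)) = (\<Prod>i\<in>UNIV. g (of_real (4 * b i)))"
    and herm: "\<And>f g X. (\<And>z. f z = g (z\<^sup>2)) \<Longrightarrow>
      hermitian_inner (mat_fun f (U_pencil U l) *v complexify X) (complexify X) =
        (\<Sum>i\<in>UNIV. g (of_real (4 * b i)) * of_real ((X \<bullet> e i)\<^sup>2))" by blast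
  define g where "g k s = complex_of_real (2 powr (- (real k + 1 / 2))) * bessel_S k (s / 4)" for k s
  have g: "g k (of_real (4 * b)) = of_real (bessel_q k b)" for k b
    using bessel_S_of_real[of k b] by (simp add: g_def bessel_q_def)
  have Q: "bessel_Q k z = g k (z\<^sup>2)" for k z by (simp add: g_def bessel_Q_eq_bessel_S)
  have "det (mat_fun (bessel_Q k) (U_pencil U l)) = of_real (\<Prod>i\<in>UNIV. bessel_q k (b i))"
    using det[of "bessel_Q k" "g k"] Q g by simp
  moreover have "hermitian_inner (mat_fun (bessel_R k) (U_pencil U l) *v complexify X) (complexify X) =
      of_real (\<Sum>i\<in>UNIV. 2 * b i * (bessel_s (Suc k) (b i) / bessel_s k (b i)) * (X \<bullet> e i)\<^sup>2)" for X
  proof -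
    have "bessel_R k z = (\<lambda>s. s * (g (Suc k) s / g k s)) (z\<^sup>2)" for z
      by (simp add: bessel_R_def Q)
    from herm[where f = "bessel_R k" and g = "\<lambda>s. s * (g (Suc k) s / g k s)", OF this, of X]
    have "hermitian_inner (mat_fun (bessel_R k) (U_pencil U l) *v complexify X) (complexify X) =
        of_real (\<Sum>i\<in>UNIV. 4 * b i * (bessel_q (Suc k) (b i) / bessel_q k (b i)) * (X \<bullet> e i)\<^sup>2)"
      unfolding g by simp
    \<comment> \<open>Raising \<open>k\<close> by one halves the power of two in front of the
      series; together with \<open>z^2 = 4 * b i\<close> this leaves the factor \<open>2\<close> in
      the Hermitian form.\<close>
    moreover have "bessel_q (Suc k) w / bessel_q k w = bessel_s (Suc k) w / bessel_s k w / 2" for w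
    proof -
      have "(2::real) powr (- (real k + 1 / 2)) = 2 * 2 powr (- (real (Suc k) + 1 / 2))"
        by (simp add: powr_mult_base algebra_simps)
      then show ?thesis by (simp add: bessel_q_def)
    qed
    then have "4 * b i * (bessel_q (Suc k) (b i) / bessel_q k (b i)) = 2 * b i * (bessel_s (Suc k) (b i) / bessel_s k (b i))" for i
      by simp
    ultimately show ?thesis by (simp only:)
  qed
  ultimately show ?thesis using that[OF e b q bi] by blast
qed

lemma summable_ln_one_plus:
  fixes u :: "nat \<Rightarrow> real"
  assumes u: "\<And>n. u n \<ge> 0" "summable u" and w: "w \<ge> 0"
  shows "summable (\<lambda>n. ln (1 + u n * w))" "summable (\<lambda>n. u n / (1 + u n * w))"
proof -
  have 1: "0 \<le> u n * w" for n using u w by simp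
  show "summable (\<lambda>n. ln (1 + u n * w))"
  proof (rule summable_comparison_test')
    show "summable (\<lambda>n. u n * w)" by (intro summable_mult2 u)
    show "norm (ln (1 + u n * w)) \<le> u n * w" for n
      using ln_add_one_self_le_self[OF 1, of n] ln_ge_zero[of "1 + u n * w"] 1[of n] by simp
  qed
  show "summable (\<lambda>n. u n / (1 + u n * w))"
  proof (rule summable_comparison_test'[OF u(2)])
    fix n
    have "u n / (1 + u n * w) \<le> u n / 1"
      using 1[of n] u(1)[of n] by (intro divide_left_mono) auto
    then show "norm (u n / (1 + u n * w)) \<le> u n" using 1[of n] u(1)[of n] by simp
  qed
qed

text \<open>Both sides are limits of the same products of the \<open>G n\<close>. In the eigenbasis
  at this \<open>l\<close> these are exponentials of partial sums for the logarithm of the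
  integrand; as Gaussian integrals they are the expectations of finitely many of the exponential
  factors.\<close>

lemma kernel_integrand_mixture:
  fixes U :: "'m::finite \<Rightarrow> real^'q::finite^'q"
  assumes skew: "\<And>j. transpose (U j) = - U j" and h: "h > 0"
    and u: "\<And>n. u n \<ge> 0" "summable u"
    and prod: "\<And>w. w \<ge> 0 \<Longrightarrow> bessel_s k w = bessel_s k 0 * exp (\<Sum>n. ln (1 + u n * w))"
    and quot: "\<And>w. w \<ge> 0 \<Longrightarrow> bessel_s (Suc k) w = bessel_s k w * (\<Sum>n. u n / (1 + u n * w))"
  obtains D R where "D > 0" "det (mat_fun (bessel_Q k) (U_pencil U l)) = of_real D" "R \<ge> 0"
    "hermitian_inner (mat_fun (bessel_R k) (U_pencil U l) *v complexify X) (complexify X) = of_real R"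
    "D powr (- 1 / 2) * exp (- R / (2 * h)) = (bessel_q k 0 ^ CARD('q)) powr (- 1 / 2) *
      (\<integral>\<omega>. exp (- (\<Sum>n. u n / 8 * (norm (pencil U l *v (\<omega> n + sqrt (2 / h) *\<^sub>R X)))\<^sup>2)) \<partial>gauss_seq)"
proof -
  obtain e :: "'q \<Rightarrow> real^'q" and b where e: "\<And>i j. e i \<bullet> e j = (if i = j then 1 else 0)"
    and b: "\<And>i. b i \<ge> 0" and q: "\<And>v. (norm (pencil U l *v v))\<^sup>2 / 4 = (\<Sum>i\<in>UNIV. b i * (v \<bullet> e i)\<^sup>2)"
    and "\<And>i. b i = (norm (pencil U l *v e i))\<^sup>2 / 4"
    and det: "det (mat_fun (bessel_Q k) (U_pencil U l)) = of_real (\<Prod>i\<in>UNIV. bessel_q k (b i))"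
    and herm: "\<And>X. hermitian_inner (mat_fun (bessel_R k) (U_pencil U l) *v complexify X) (complexify X) =
        of_real (\<Sum>i\<in>UNIV. 2 * b i * (bessel_s (Suc k) (b i) / bessel_s k (b i)) * (X \<bullet> e i)\<^sup>2)"
    by (rule pencil_bessel_diagonalization[of U l k, OF skew]) (rule that)
  \<comment> \<open>The scaling is dictated by
    \<open>R / (2 * h) = (\<Sum>i. b i * (x \<bullet> e i)^2 * S i / 2)\<close>: the form
    \<open>R\<close> carries a factor \<open>2\<close>, the Gaussian formula a factor
    \<open>1 / 2\<close>.\<close>
  define x where "x = sqrt (2 / h) *\<^sub>R X"
  have xe: "(x \<bullet> e i)\<^sup>2 = 2 / h * (X \<bullet> e i)\<^sup>2" for i
    using h by (simp add: x_def power_mult_distrib)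
  define L where "L i = (\<Sum>n. ln (1 + u n * b i))" for i
  define S where "S i = (\<Sum>n. u n / (1 + u n * b i))" for i
  define D where "D = (\<Prod>i\<in>UNIV. bessel_q k (b i))"
  define R where "R = (\<Sum>i\<in>UNIV. 2 * b i * (bessel_s (Suc k) (b i) / bessel_s k (b i)) * (X \<bullet> e i)\<^sup>2)"
  \<comment> \<open>\<open>1 / 8\<close> is the \<open>1 / 4\<close> relating the \<open>b i\<close>
    to the pencil times the \<open>1 / 2\<close> of the Gaussian exponent.\<close>
  define t where "t n v = u n / 8 * (norm (pencil U l *v (v + x)))\<^sup>2" for n v
  define G where "G n = (\<Prod>i\<in>UNIV. (1 + u n * b i) powr (- 1 / 2) * exp (- (u n * b i * (x \<bullet> e i)\<^sup>2 / (1 + u n * b i)) / 2))" for n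
  \<comment> \<open>The logarithm of the integrand without its phase, up to the constant coming from
    \<open>bessel_q k 0\<close>.\<close>
  define E where "E = (\<Sum>i\<in>UNIV. - L i / 2 - b i * (x \<bullet> e i)\<^sup>2 * S i / 2)"
  have ub: "0 \<le> u n * b i" for n i using u b by simp
  have "(\<lambda>N. \<Prod>n<N. G n) \<longlonglongrightarrow> exp E"
  proof -
    have "(\<lambda>n. \<Sum>i\<in>UNIV. - ln (1 + u n * b i) / 2 - b i * (x \<bullet> e i)\<^sup>2 * (u n / (1 + u n * b i)) / 2) sums E"
      unfolding E_def L_def S_def
      by (intro sums_sum sums_diff sums_divide sums_minus sums_mult summable_sums summable_ln_one_plus u b)
    then have "(\<lambda>N. exp (\<Sum>n<N. \<Sum>i\<in>UNIV. - ln (1 + u n * b i) / 2 - b i * (x \<bullet> e i)\<^sup>2 * (u n / (1 + u n * b i)) / 2)) \<longlonglongrightarrow> exp E"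
      unfolding sums_def by (rule tendsto_exp)
    moreover have "exp (\<Sum>i\<in>UNIV. - ln (1 + u n * b i) / 2 - b i * (x \<bullet> e i)\<^sup>2 * (u n / (1 + u n * b i)) / 2) = G n" for n
      unfolding G_def exp_sum[OF finite]
    proof (intro prod.cong refl)
      fix i
      have "1 + u n * b i > 0" using ub[of n i] by linarith
      then have "(1 + u n * b i) powr (- 1 / 2) = exp (- ln (1 + u n * b i) / 2)"
        by (simp add: powr_def)
      moreover have "b i * (x \<bullet> e i)\<^sup>2 * (u n / (1 + u n * b i)) / 2 = (u n * b i * (x \<bullet> e i)\<^sup>2 / (1 + u n * b i)) / 2"
        by (simp add: mult_ac)
      ultimately show "exp (- ln (1 + u n * b i) / 2 - b i * (x \<bullet> e i)\<^sup>2 * (u n / (1 + u n * b i)) / 2) =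
          (1 + u n * b i) powr (- 1 / 2) * exp (- (u n * b i * (x \<bullet> e i)\<^sup>2 / (1 + u n * b i)) / 2)"
        by (simp only: mult_exp_exp) simp
    qed
    ultimately show ?thesis by (simp add: exp_sum)
  qed
  moreover have "(\<lambda>N. \<Prod>n<N. G n) \<longlonglongrightarrow> (\<integral>\<omega>. exp (- (\<Sum>n. t n (\<omega> n))) \<partial>gauss_seq)"
  proof (rule gauss_seq_exp_series)
    show "t n \<in> borel_measurable borel" for n
      unfolding t_def using borel_measurable_matrix_vector_mult_add[of "pencil U l" x] by measurable
    show "t n v \<ge> 0" for n v using u by (simp add: t_def)
    have "AE \<omega> in gauss_seq. summable (\<lambda>n. u n / 8 * (norm (\<omega> n + x))\<^sup>2)"
      by (rule AE_gauss_seq_summable) (use u in \<open>auto intro: summable_divide\<close>)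
    then show "AE \<omega> in gauss_seq. summable (\<lambda>n. t n (\<omega> n))"
      unfolding t_def by eventually_elim (rule summable_norm_matrix_vector_mult, use u in simp_all)
    show "(\<integral>\<^sup>+v. ennreal (exp (- t n v)) \<partial>gauss_vec) = ennreal (G n)" for n
    proof -
      have "t n v = (\<Sum>i\<in>UNIV. (u n * b i) * ((v + x) \<bullet> e i)\<^sup>2) / 2" for v
      proof -
        have "t n v = u n * ((norm (pencil U l *v (v + x)))\<^sup>2 / 4) / 2" by (simp add: t_def)
        then show ?thesis unfolding q by (simp add: sum_distrib_left mult.assoc)
      qed
      then have "- t n v = - (\<Sum>i\<in>UNIV. (u n * b i) * ((v + x) \<bullet> e i)\<^sup>2) / 2" for v by simp
      then show ?thesis
        using nn_integral_gauss_vec_quadratic[OF e, of "\<lambda>i. u n * b i" x, OF ub] by (simp only: G_def)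
    qed
    show "G n \<ge> 0" for n unfolding G_def by (intro prod_nonneg) auto
  qed
  ultimately have E: "(\<integral>\<omega>. exp (- (\<Sum>n. t n (\<omega> n))) \<partial>gauss_seq) = exp E"
    using LIMSEQ_unique by blast
  have K0: "bessel_q k 0 > 0" by (rule bessel_q_pos) simp
  have Dpos: "D > 0" unfolding D_def by (intro prod_pos) (auto intro: bessel_q_pos b)
  have D: "D = bessel_q k 0 ^ CARD('q) * exp (\<Sum>i\<in>UNIV. L i)"
    unfolding D_def bessel_q_def using prod[OF b] by (simp add: L_def exp_sum prod.distrib mult.assoc power_mult_distrib)
  have R: "R = (\<Sum>i\<in>UNIV. 2 * b i * S i * (X \<bullet> e i)\<^sup>2)"
    unfolding R_def
  proof (intro sum.cong refl)
    fix i
    have "bessel_s (Suc k) (b i) / bessel_s k (b i) = S i"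
      using quot[OF b, of i] bessel_s_pos[OF b, of k i] by (simp add: S_def)
    then show "2 * b i * (bessel_s (Suc k) (b i) / bessel_s k (b i)) * (X \<bullet> e i)\<^sup>2 = 2 * b i * S i * (X \<bullet> e i)\<^sup>2"
      by simp
  qed
  have "R \<ge> 0" unfolding R_def
    by (intro sum_nonneg mult_nonneg_nonneg divide_nonneg_nonneg) (auto intro: b less_imp_le bessel_s_pos)
  have "D powr (- 1 / 2) * exp (- R / (2 * h)) = (bessel_q k 0 ^ CARD('q)) powr (- 1 / 2) * exp E"
  proof -
    have "D powr (- 1 / 2) = (bessel_q k 0 ^ CARD('q)) powr (- 1 / 2) * exp (\<Sum>i\<in>UNIV. L i) powr (- 1 / 2)"
      unfolding D using K0 by (simp add: powr_mult)
    also have "exp (\<Sum>i\<in>UNIV. L i) powr (- 1 / 2) = exp (- (\<Sum>i\<in>UNIV. L i) / 2)"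
      by (simp add: powr_def)
    finally have "D powr (- 1 / 2) * exp (- R / (2 * h)) =
        (bessel_q k 0 ^ CARD('q)) powr (- 1 / 2) * exp (- (\<Sum>i\<in>UNIV. L i) / 2 + - R / (2 * h))"
      by (simp only: mult.assoc mult_exp_exp)
    also have "- (\<Sum>i\<in>UNIV. L i) / 2 + - R / (2 * h) = E"
    proof -
      have "R / (2 * h) = (\<Sum>i\<in>UNIV. b i * (x \<bullet> e i)\<^sup>2 * S i / 2)"
        unfolding R xe sum_divide_distrib using h by (intro sum.cong refl) (simp add: field_simps)
      then show ?thesis unfolding E_def by (simp add: sum_subtractf sum_negf sum_divide_distrib)
    qed
    finally show ?thesis .
  qed
  then show ?thesis
    using that[of D R] Dpos det herm \<open>R \<ge> 0\<close> E[unfolded t_def x_def] by (simp only: D_def R_def)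
qed

section \<open>Decay of the integrand in the parameter\<close>

lemma pencil_inj:
  fixes U :: "'m::finite \<Rightarrow> real^'q::finite^'q"
  assumes inj: "inj U" and ind: "independent (range U)"
  shows "linear (pencil U)" "inj (pencil U)"
proof -
  show lin: "linear (pencil U)"
    unfolding pencil_def by (intro linearI) (simp_all add: scaleR_add_left sum.distrib scaleR_sum_right)
  show "inj (pencil U)"
  proof (subst linear_injective_0[OF lin], intro allI impI)
    fix l assume l: "pencil U l = 0"
    \<comment> \<open>Independence speaks of the set \<open>range U\<close>; injectivity gives each
      matrix in it a single index, so that its coefficient is one coordinate of
      \<open>l\<close>.\<close>
    have "(\<Sum>v\<in>range U. (l $ inv U v) *\<^sub>R v) = pencil U l"
      unfolding pencil_def by (subst sum.reindex[OF inj]) (simp add: inj)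
    then have "l $ inv U v = 0" if "v \<in> range U" for v
      using independentD[OF ind, of "range U" "\<lambda>v. l $ inv U v" v] l that by simp
    then have "l $ j = 0" for j using inj by (metis inv_f_f rangeI)
    then show "l = 0" by (simp add: vec_eq_iff)
  qed
qed

text \<open>Linear independence bounds \<open>norm (pencil U l)\<close> from below by a multiple of
  \<open>norm l\<close>, and the square of that norm is four times the sum of the
  \<open>b i\<close>. The square in the bound anticipates the exponent \<open>- 1 / 2\<close>, which
  leaves the integrable product of the \<open>1 / (1 + c * (l $ j)^2)\<close>.\<close>

lemma det_bessel_Q_lower_bound:
  fixes U :: "'m::finite \<Rightarrow> real^'q::finite^'q"
  assumes skew: "\<And>j. transpose (U j) = - U j" and inj: "inj U" and ind: "independent (range U)"
  obtains C c where "C > 0" "c > 0"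
    "\<And>l. \<exists>D. det (mat_fun (bessel_Q k) (U_pencil U l)) = of_real D \<and> C * (\<Prod>j\<in>UNIV. 1 + c * (l $ j)\<^sup>2)\<^sup>2 \<le> D"
proof -
  obtain B where B: "B > 0" "\<And>l. B * norm l \<le> norm (pencil U l)"
    using linear_inj_bounded_below_pos[OF pencil_inj[OF inj ind]] by blast
  define c where "c = B\<^sup>2 / 4"
  \<comment> \<open>The exponent provides one factor \<open>1 + c * (norm l)^2\<close> for each
    coordinate of \<open>l\<close>, squared.\<close>
  obtain a where a: "a > 0" "\<And>w. w \<ge> 0 \<Longrightarrow> a * (1 + w) ^ (2 * CARD('m)) \<le> bessel_s k w"
    using bessel_s_ge_power by blast
  define a' where "a' = 2 powr (- (real k + 1 / 2)) * a"
  have a': "a' > 0" "\<And>w. w \<ge> 0 \<Longrightarrow> a' * (1 + w) ^ (2 * CARD('m)) \<le> bessel_q k w"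
    using a by (simp_all add: a'_def bessel_q_def mult.assoc)
  have c: "c > 0" using B by (simp add: c_def)
  have "\<exists>D. det (mat_fun (bessel_Q k) (U_pencil U l)) = of_real D \<and>
      a' ^ CARD('q) * (\<Prod>j\<in>UNIV. 1 + c * (l $ j)\<^sup>2)\<^sup>2 \<le> D" for l
  proof -
    obtain e :: "'q \<Rightarrow> real^'q" and b where e: "\<And>i j. e i \<bullet> e j = (if i = j then 1 else 0)"
      and b: "\<And>i. b i \<ge> 0" and "\<And>v. (norm (pencil U l *v v))\<^sup>2 / 4 = (\<Sum>i\<in>UNIV. b i * (v \<bullet> e i)\<^sup>2)"
      and bi: "\<And>i. b i = (norm (pencil U l *v e i))\<^sup>2 / 4"
      and det: "det (mat_fun (bessel_Q k) (U_pencil U l)) = of_real (\<Prod>i\<in>UNIV. bessel_q k (b i))"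
      and "\<And>X. hermitian_inner (mat_fun (bessel_R k) (U_pencil U l) *v complexify X) (complexify X) =
        of_real (\<Sum>i\<in>UNIV. 2 * b i * (bessel_s (Suc k) (b i) / bessel_s k (b i)) * (X \<bullet> e i)\<^sup>2)"
      by (rule pencil_bessel_diagonalization[of U l k, OF skew]) (rule that)
    have parseval: "v \<bullet> v = (\<Sum>i\<in>UNIV. (v \<bullet> e i)\<^sup>2)" for v
      using selfadjoint_quadratic_form[of "\<lambda>v. v" e "\<lambda>_. 1" v] e by (simp add: linear_ident)
    \<comment> \<open>Summing \<open>|A e_i|^2\<close> over an orthonormal basis gives the squared
      Frobenius norm, by Parseval's identity for each row of \<open>A\<close>; the norm of
      \<open>real^'q^'q\<close> is exactly the Frobenius norm.\<close>
    have "(\<Sum>i\<in>UNIV. b i) = (\<Sum>i\<in>UNIV. \<Sum>a\<in>UNIV. (pencil U l $ a \<bullet> e i)\<^sup>2) / 4"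
    proof -
      have "(norm (pencil U l *v e i))\<^sup>2 = (\<Sum>a\<in>UNIV. (pencil U l $ a \<bullet> e i)\<^sup>2)" for i
        unfolding power2_norm_eq_inner inner_vec_def[of "pencil U l *v _"] matrix_vector_mul_component
        by (simp add: power2_eq_square)
      then show ?thesis by (simp only: bi sum_divide_distrib[symmetric])
    qed
    also have "(\<Sum>i\<in>UNIV. \<Sum>a\<in>UNIV. (pencil U l $ a \<bullet> e i)\<^sup>2) = (\<Sum>a\<in>UNIV. \<Sum>i\<in>UNIV. (pencil U l $ a \<bullet> e i)\<^sup>2)"
      by (rule sum.swap)
    also have "\<dots> = (norm (pencil U l))\<^sup>2"
      by (simp only: parseval[symmetric] power2_norm_eq_inner inner_vec_def[of "pencil U l"])
    finally have "(\<Sum>i\<in>UNIV. b i) = (norm (pencil U l))\<^sup>2 / 4" .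
    moreover have "(B * norm l)\<^sup>2 \<le> (norm (pencil U l))\<^sup>2" using B by (intro power_mono) auto
    ultimately have sumb: "c * (norm l)\<^sup>2 \<le> (\<Sum>i\<in>UNIV. b i)" by (simp add: c_def power_mult_distrib)
    have "(\<Prod>j\<in>UNIV. 1 + c * (l $ j)\<^sup>2) \<le> (\<Prod>j\<in>(UNIV::'m set). 1 + c * (norm l)\<^sup>2)"
    proof (rule prod_mono, intro conjI)
      fix j
      have "(l $ j)\<^sup>2 \<le> (norm l)\<^sup>2"
        using component_le_norm_cart[of l j] by (metis abs_le_square_iff abs_norm_cancel)
      then show "1 + c * (l $ j)\<^sup>2 \<le> 1 + c * (norm l)\<^sup>2" using c by simp
      show "0 \<le> 1 + c * (l $ j)\<^sup>2" using c by (intro add_nonneg_nonneg mult_nonneg_nonneg) auto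
    qed
    also have "\<dots> = (1 + c * (norm l)\<^sup>2) ^ CARD('m)" by simp
    also have "\<dots> \<le> (\<Prod>i\<in>UNIV. 1 + b i) ^ CARD('m)"
    proof (rule power_mono)
      have "1 + c * (norm l)\<^sup>2 \<le> 1 + (\<Sum>i\<in>UNIV. b i)" using sumb by simp
      also have "\<dots> \<le> (\<Prod>i\<in>UNIV. 1 + b i)" using b by (intro one_plus_sum_le_prod) auto
      finally show "1 + c * (norm l)\<^sup>2 \<le> (\<Prod>i\<in>UNIV. 1 + b i)" .
      show "0 \<le> 1 + c * (norm l)\<^sup>2" using c by (intro add_nonneg_nonneg mult_nonneg_nonneg) auto
    qed
    finally have "(\<Prod>j\<in>UNIV. 1 + c * (l $ j)\<^sup>2)\<^sup>2 \<le> ((\<Prod>i\<in>UNIV. 1 + b i) ^ CARD('m))\<^sup>2"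
      using c by (intro power_mono prod_nonneg) (auto intro!: add_nonneg_nonneg mult_nonneg_nonneg)
    also have "\<dots> = (\<Prod>i\<in>UNIV. (1 + b i) ^ (2 * CARD('m)))"
      by (simp add: power_mult[symmetric] prod_power_distrib mult.commute)
    finally have "a' ^ CARD('q) * (\<Prod>j\<in>UNIV. 1 + c * (l $ j)\<^sup>2)\<^sup>2 \<le> a' ^ CARD('q) * (\<Prod>i\<in>UNIV. (1 + b i) ^ (2 * CARD('m)))"
      using a' by (intro mult_left_mono) auto
    also have "\<dots> = (\<Prod>i\<in>UNIV. a' * (1 + b i) ^ (2 * CARD('m)))" by (simp add: prod.distrib)
    also have "\<dots> \<le> (\<Prod>i\<in>UNIV. bessel_q k (b i))"
      using a' b by (intro prod_mono) (auto intro!: mult_nonneg_nonneg add_nonneg_nonneg simp: less_imp_le)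
    finally show ?thesis using det by blast
  qed
  then show ?thesis using that[of "a' ^ CARD('q)" c] a' c by simp
qed

lemma nn_integral_rational_decay_finite:
  assumes c: "c > 0"
  shows "(\<integral>\<^sup>+l. (\<Prod>j\<in>UNIV. ennreal (inverse (1 + c * (l $ j)\<^sup>2))) \<partial>(lborel :: (real^'m::finite) measure)) < \<infinity>"
proof -
  have "integrable lborel (\<lambda>t::real. inverse (1 + t\<^sup>2))"
    using integrable_inverse_1_plus_square by (simp add: set_integrable_def)
  then have "integrable lborel (\<lambda>t. inverse (1 + (0 + sqrt c * t)\<^sup>2))"
    by (rule lborel_integrable_real_affine) (use c in simp)
  then have int: "integrable lborel (\<lambda>t. inverse (1 + c * t\<^sup>2))"
    using c by (simp add: power_mult_distrib)
  have nn: "0 \<le> inverse (1 + c * t\<^sup>2)" for t using c by (simp add: add_nonneg_nonneg)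
  have "(\<integral>\<^sup>+t. ennreal (inverse (1 + c * t\<^sup>2)) \<partial>lborel) = ennreal (\<integral>t. inverse (1 + c * t\<^sup>2) \<partial>lborel)"
    by (rule nn_integral_eq_integral[OF int AE_I2[OF nn]])
  moreover have "0 \<le> (\<integral>t. inverse (1 + c * t\<^sup>2) \<partial>lborel)" by (intro integral_nonneg_AE AE_I2 nn)
  ultimately have "(\<Prod>j\<in>(UNIV::'m set). \<integral>\<^sup>+t. ennreal (inverse (1 + c * t\<^sup>2)) \<partial>lborel) < \<infinity>"
    by (simp add: less_top[symmetric] ennreal_power)
  moreover have "(\<integral>\<^sup>+l. (\<Prod>j\<in>UNIV. ennreal (inverse (1 + c * (l $ j)\<^sup>2))) \<partial>(lborel :: (real^'m) measure)) =
      (\<Prod>j\<in>(UNIV::'m set). \<integral>\<^sup>+t. ennreal (inverse (1 + c * t\<^sup>2)) \<partial>lborel)"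
    by (rule nn_integral_lborel_vec_prod) measurable
  ultimately show ?thesis by simp
qed

section \<open>Positivity of the kernel\<close>

theorem proposition2p2:
  fixes U :: "'m::finite \<Rightarrow> real^'q::finite^'q"
  assumes skew: "\<And>j. transpose (U j) = - U j"
    and lin_indep: "inj U" "independent (range U)"
  shows "\<forall>k :: nat. \<forall>h > 0. \<forall>(X :: real^'q) (T :: real^'m).
           P_kernel U k h X T \<in> \<real> \<and> Re (P_kernel U k h X T) > 0"
proof (intro allI impI)
  fix k :: nat and h :: real and X :: "real^'q" and T :: "real^'m"
  assume h: "h > 0"
  obtain u where u: "\<And>n. u n \<ge> 0" "summable u"
    and prod: "\<And>w. w \<ge> 0 \<Longrightarrow> bessel_s k w = bessel_s k 0 * exp (\<Sum>n. ln (1 + u n * w))"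
    and quot: "\<And>w. w \<ge> 0 \<Longrightarrow> bessel_s (Suc k) w = bessel_s k w * (\<Sum>n. u n / (1 + u n * w))"
    using bessel_s_product[of k] by blast
  define x where "x = sqrt (2 / h) *\<^sub>R X"
  \<comment> \<open>For almost every \<open>\<omega>\<close> the exponent is minus a quadratic form
    in \<open>l\<close>. On the exceptional null set the series may diverge and
    \<open>suminf\<close> is no limit, so bounds on \<open>H\<close> are claimed only almost
    everywhere.\<close>
  define H where "H \<omega> l = exp (- (\<Sum>n. u n / 8 * (norm (pencil U l *v (\<omega> n + x)))\<^sup>2))" for \<omega> l
  define E where "E l = (\<integral>\<omega>. H \<omega> l \<partial>gauss_seq)" for l
  define K where "K = (bessel_q k 0 ^ CARD('q)) powr (- 1 / 2)"
  \<comment> \<open>Chosen so that the phase \<open>2 * \<i> * (T \<bullet> l) / (2 * h)\<close>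
    reads \<open>\<i> * (s \<bullet> l)\<close>.\<close>
  define s where "s = (1 / h) *\<^sub>R T"
  have K: "K > 0" using bessel_q_pos[of 0 k] by (simp add: K_def)
  interpret G: prob_space "gauss_seq :: (nat \<Rightarrow> real^'q) measure" by (rule prob_space_gauss_seq)
  interpret pair_sigma_finite "lborel :: (real^'m) measure" "gauss_seq :: (nat \<Rightarrow> real^'q) measure" ..
  \<comment> \<open>Fubini needs measurability jointly in \<open>l\<close> and
    \<open>\<omega>\<close>; it is assembled from the finitely many summands of the pencil.\<close>
  have act: "(\<lambda>p. pencil U (fst p) *v (snd p n + x)) \<in> borel_measurable (lborel \<Otimes>\<^sub>M gauss_seq)" for n
  proof -
    from measurable_compose[OF measurable_compose[OF measurable_snd measurable_gauss_seq_component]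
        borel_measurable_matrix_vector_mult_add]
    have "(\<lambda>p. U j *v (snd p n + x)) \<in> borel_measurable (lborel \<Otimes>\<^sub>M gauss_seq)" for j .
    moreover have "(\<lambda>p :: (real^'m) \<times> (nat \<Rightarrow> real^'q). fst p $ j) \<in> borel_measurable (lborel \<Otimes>\<^sub>M gauss_seq)" for j
    proof (rule measurable_compose[OF measurable_fst])
      have "(\<lambda>l::real^'m. l $ j) \<in> borel_measurable borel"
        by (intro borel_measurable_continuous_onI continuous_intros)
      then show "(\<lambda>l::real^'m. l $ j) \<in> borel_measurable lborel" by simp
    qed
    ultimately show ?thesis unfolding pencil_mult_vec
      by (intro borel_measurable_sum borel_measurable_scaleR)
  qed
  have Hm [measurable]: "(\<lambda>p. H (snd p) (fst p)) \<in> borel_measurable (lborel \<Otimes>\<^sub>M gauss_seq)"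
  proof -
    have [measurable]: "(\<lambda>p. u n / 8 * (norm (pencil U (fst p) *v (snd p n + x)))\<^sup>2) \<in> borel_measurable (lborel \<Otimes>\<^sub>M gauss_seq)" for n
      using act[of n] by measurable
    show ?thesis unfolding H_def by measurable
  qed
  have Hm1: "(\<lambda>\<omega>. H \<omega> l) \<in> borel_measurable gauss_seq" for l
    using measurable_compose[OF measurable_Pair1' Hm, of l] by simp
  have Epos: "E l \<ge> 0" for l unfolding E_def by (intro integral_nonneg_AE) (auto simp: H_def)
  obtain C c where C: "C > 0" and c: "c > 0"
    and lower: "\<And>l. \<exists>D. det (mat_fun (bessel_Q k) (U_pencil U l)) = of_real D \<and> C * (\<Prod>j\<in>UNIV. 1 + c * (l $ j)\<^sup>2)\<^sup>2 \<le> D"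
    using det_bessel_Q_lower_bound[OF skew lin_indep, of k] by blast
  \<comment> \<open>\<open>K * E l\<close> is the integrand without its phase. Bounding
    \<open>exp (- R / (2 * h))\<close> by \<open>1\<close> leaves the determinant factor to provide
    the decay.\<close>
  have integrand: "det (mat_fun (bessel_Q k) (U_pencil U l)) powr (- 1 / 2) *
        exp (- (hermitian_inner (mat_fun (bessel_R k) (U_pencil U l) *v complexify X) (complexify X)
                 - 2 * \<i> * complex_of_real (T \<bullet> l)) / complex_of_real (2 * h)) =
      of_real K * (of_real (E l) * exp (\<i> * of_real (s \<bullet> l)))"
    and decay: "K * E l \<le> C powr (- 1 / 2) * (\<Prod>j\<in>UNIV. inverse (1 + c * (l $ j)\<^sup>2))" for l
  proof -
    obtain D R where D: "D > 0" "det (mat_fun (bessel_Q k) (U_pencil U l)) = of_real D" "R \<ge> 0"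
      and R: "hermitian_inner (mat_fun (bessel_R k) (U_pencil U l) *v complexify X) (complexify X) = of_real R"
      and mix: "D powr (- 1 / 2) * exp (- R / (2 * h)) = (bessel_q k 0 ^ CARD('q)) powr (- 1 / 2) *
        (\<integral>\<omega>. exp (- (\<Sum>n. u n / 8 * (norm (pencil U l *v (\<omega> n + sqrt (2 / h) *\<^sub>R X)))\<^sup>2)) \<partial>gauss_seq)"
      by (rule kernel_integrand_mixture[of U h u k l X, OF skew h u])
        (rule prod, assumption, rule quot, assumption, rule that)
    from mix have DR: "D powr (- 1 / 2) * exp (- R / (2 * h)) = K * E l"
      by (simp only: K_def E_def H_def x_def)
    have "exp (- (of_real R - 2 * \<i> * complex_of_real (T \<bullet> l)) / complex_of_real (2 * h)) =
        of_real (exp (- R / (2 * h))) * exp (\<i> * of_real (s \<bullet> l))"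
    proof -
      have "- (of_real R - 2 * \<i> * complex_of_real (T \<bullet> l)) / complex_of_real (2 * h) =
          of_real (- R / (2 * h)) + \<i> * of_real (s \<bullet> l)"
        using h by (simp add: s_def field_simps)
      then show ?thesis by (simp only: exp_add exp_of_real)
    qed
    moreover have "complex_of_real D powr (- 1 / 2) = of_real (D powr (- 1 / 2))"
      using powr_of_real[of D "- 1 / 2"] D by simp
    ultimately show "det (mat_fun (bessel_Q k) (U_pencil U l)) powr (- 1 / 2) *
        exp (- (hermitian_inner (mat_fun (bessel_R k) (U_pencil U l) *v complexify X) (complexify X)
                 - 2 * \<i> * complex_of_real (T \<bullet> l)) / complex_of_real (2 * h)) =
      of_real K * (of_real (E l) * exp (\<i> * of_real (s \<bullet> l)))"
      unfolding D(2) R by (simp only: mult.assoc[symmetric] of_real_mult[symmetric] DR)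
    let ?P = "\<Prod>j\<in>UNIV. 1 + c * (l $ j)\<^sup>2"
    have P: "?P > 0" using c by (intro prod_pos) (auto intro!: add_pos_nonneg)
    have "C * ?P\<^sup>2 \<le> D" using lower[of l] D(2) by auto
    then have "D powr (- 1 / 2) \<le> (C * ?P\<^sup>2) powr (- 1 / 2)"
      using C P by (intro powr_mono2' mult_pos_pos zero_less_power) auto
    also have "\<dots> = C powr (- 1 / 2) * inverse ?P"
    proof -
      have "(?P\<^sup>2) powr (- 1 / 2) = inverse ?P"
        using P by (simp add: powr_minus powr_half_sqrt)
      then show ?thesis using C P by (simp add: powr_mult)
    qed
    finally have "D powr (- 1 / 2) \<le> C powr (- 1 / 2) * inverse ?P" .
    moreover have "D powr (- 1 / 2) * exp (- R / (2 * h)) \<le> D powr (- 1 / 2) * 1"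
      using D h by (intro mult_left_mono) auto
    ultimately show "K * E l \<le> C powr (- 1 / 2) * (\<Prod>j\<in>UNIV. inverse (1 + c * (l $ j)\<^sup>2))"
      unfolding DR by (simp add: prod_inversef[symmetric] o_def)
  qed
  have Em [measurable]: "E \<in> borel_measurable lborel"
    unfolding E_def using Hm by (intro G.borel_measurable_lebesgue_integral) (simp add: case_prod_unfold)
  have Eint: "integrable lborel E"
  proof (rule integrableI_bounded)
    let ?c = "C powr (- 1 / 2) / K"
    have "(\<integral>\<^sup>+l. ennreal (norm (E l)) \<partial>lborel) \<le> (\<integral>\<^sup>+l. ennreal ?c * (\<Prod>j\<in>UNIV. ennreal (inverse (1 + c * (l $ j)\<^sup>2))) \<partial>(lborel :: (real^'m) measure))"
    proof (rule nn_integral_mono)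
      fix l :: "real^'m"
      have nn: "0 \<le> inverse (1 + c * (l $ j)\<^sup>2)" for j using c by (simp add: add_nonneg_nonneg)
      have "norm (E l) \<le> ?c * (\<Prod>j\<in>UNIV. inverse (1 + c * (l $ j)\<^sup>2))"
        using decay[of l] K Epos[of l] by (simp add: field_simps)
      then have "ennreal (norm (E l)) \<le> ennreal (?c * (\<Prod>j\<in>UNIV. inverse (1 + c * (l $ j)\<^sup>2)))"
        by (rule ennreal_leI)
      also have "\<dots> = ennreal ?c * (\<Prod>j\<in>UNIV. ennreal (inverse (1 + c * (l $ j)\<^sup>2)))"
        unfolding prod_ennreal[OF nn] by (rule ennreal_mult) (use K nn in \<open>auto intro!: prod_nonneg\<close>)
      finally show "ennreal (norm (E l)) \<le> ennreal ?c * (\<Prod>j\<in>UNIV. ennreal (inverse (1 + c * (l $ j)\<^sup>2)))" .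
    qed
    also have "\<dots> = ennreal ?c * (\<integral>\<^sup>+l. (\<Prod>j\<in>UNIV. ennreal (inverse (1 + c * (l $ j)\<^sup>2))) \<partial>(lborel :: (real^'m) measure))"
      by (rule nn_integral_cmult) measurable
    also have "\<dots> < \<infinity>"
      using nn_integral_rational_decay_finite[OF c, where 'm = 'm] by (simp add: ennreal_mult_less_top)
    finally show "(\<integral>\<^sup>+l. ennreal (norm (E l)) \<partial>lborel) < \<infinity>" .
  qed measurable
  define f where "f l \<omega> = complex_of_real (H \<omega> l) * exp (\<i> * of_real (s \<bullet> l))" for l \<omega>
  have norm_f: "norm (f l \<omega>) = H \<omega> l" for l \<omega> by (simp add: f_def norm_mult H_def)
  have AE_sum: "AE \<omega> in gauss_seq. summable (\<lambda>n. u n / 8 * (norm (\<omega> n + x))\<^sup>2)"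
    by (rule AE_gauss_seq_summable) (use u in \<open>auto intro: summable_divide\<close>)
  have Hint: "integrable gauss_seq (\<lambda>\<omega>. H \<omega> l)" for l
  proof (rule G.integrable_const_bound[where B = 1])
    show "AE \<omega> in gauss_seq. norm (H \<omega> l) \<le> 1"
      using AE_sum
    proof eventually_elim
      case (elim \<omega>)
      have "summable (\<lambda>n. u n / 8 * (norm (pencil U l *v (\<omega> n + x)))\<^sup>2)"
        by (rule summable_norm_matrix_vector_mult[OF _ elim]) (use u in simp)
      then have "(\<Sum>n. u n / 8 * (norm (pencil U l *v (\<omega> n + x)))\<^sup>2) \<ge> 0"
        using u by (intro suminf_nonneg) auto
      then show ?case by (simp add: H_def)
    qed
  qed (rule Hm1)
  have fm [measurable]: "(\<lambda>p. f (fst p) (snd p)) \<in> borel_measurable (lborel \<Otimes>\<^sub>M gauss_seq)"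
    unfolding f_def by measurable
  \<comment> \<open>The norm of \<open>f l \<omega>\<close> is \<open>H \<omega> l\<close>, whose
    integral over \<open>\<omega>\<close> is \<open>E l\<close>; absolute integrability on the
    product thus reduces to integrability of \<open>E\<close>.\<close>
  have fint: "integrable (lborel \<Otimes>\<^sub>M gauss_seq) (case_prod f)"
  proof (rule Fubini_integrable)
    show "case_prod f \<in> borel_measurable (lborel \<Otimes>\<^sub>M gauss_seq)" using fm by (simp add: case_prod_unfold)
    show "integrable lborel (\<lambda>l. \<integral>\<omega>. norm (case_prod f (l, \<omega>)) \<partial>gauss_seq)"
      using Eint by (simp add: norm_f E_def[abs_def])
    show "AE l in lborel. integrable gauss_seq (\<lambda>\<omega>. case_prod f (l, \<omega>))"
      using Hint by (auto simp: f_def)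
  qed
  define F where "F \<omega> = (\<integral>l. f l \<omega> \<partial>lborel)" for \<omega>
  have "(\<integral>l. of_real (E l) * exp (\<i> * of_real (s \<bullet> l)) \<partial>lborel) = (\<integral>l. (\<integral>\<omega>. f l \<omega> \<partial>gauss_seq) \<partial>lborel)"
    by (simp add: f_def E_def)
  also have "\<dots> = (\<integral>\<omega>. F \<omega> \<partial>gauss_seq)"
    unfolding F_def by (rule Fubini_integral[OF fint, symmetric])
  finally have I: "(\<integral>l. of_real (E l) * exp (\<i> * of_real (s \<bullet> l)) \<partial>lborel) = (\<integral>\<omega>. F \<omega> \<partial>gauss_seq)" .
  have Fint: "integrable gauss_seq F"
    unfolding F_def by (rule integrable_snd[OF fint])
  \<comment> \<open>The signs of the coefficients are not computed from the sample: Fubini makes the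
    slice at almost every \<open>\<omega>\<close> integrable in \<open>l\<close>, and
    \<open>gaussian_fourier_pos\<close> extracts what it needs from this finiteness.\<close>
  have "AE \<omega> in gauss_seq. \<exists>r > 0. F \<omega> = of_real r"
    using AE_sum AE_integrable_snd[OF fint]
  proof eventually_elim
    case (elim \<omega>)
    have u8: "u n / 8 \<ge> 0" for n using u by simp
    obtain e :: "'m \<Rightarrow> real^'m" and c where e: "\<And>i j. e i \<bullet> e j = (if i = j then 1 else 0)"
      and q: "\<And>l. (\<Sum>n. u n / 8 * (norm (pencil U l *v (\<omega> n + x)))\<^sup>2) = (\<Sum>j\<in>UNIV. c j * (l \<bullet> e j)\<^sup>2)"
      by (rule pencil_series_quadratic_form[of "\<lambda>n. u n / 8" "\<lambda>n. \<omega> n + x" U, OF u8 elim(1)]) (rule that)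
    \<comment> \<open>The doubled coefficients offset the \<open>1 / 2\<close> in the exponent of
      \<open>gaussian_fourier_pos\<close>.\<close>
    have H: "H \<omega> l = exp (- (\<Sum>j\<in>UNIV. (2 * c j) * (l \<bullet> e j)\<^sup>2) / 2)" for l
      unfolding H_def q by (simp add: sum_distrib_left[symmetric] mult.assoc)
    have "(\<integral>\<^sup>+l. ennreal (norm (f l \<omega>)) \<partial>lborel) < \<infinity>"
      using elim(2) by (simp add: integrable_iff_bounded)
    then have "(\<integral>\<^sup>+l. ennreal (exp (- (\<Sum>j\<in>UNIV. (2 * c j) * (l \<bullet> e j)\<^sup>2) / 2)) \<partial>lborel) < \<infinity>"
      by (simp only: norm_f H)
    from gaussian_fourier_pos[where c = "\<lambda>j. 2 * c j" and s = s, OF e this]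
    obtain r where "r > 0" "F \<omega> = of_real r"
      by (auto simp: F_def f_def H)
    then show ?case by blast
  qed
  then have AEF: "AE \<omega> in gauss_seq. F \<omega> = of_real (Re (F \<omega>)) \<and> Re (F \<omega>) > 0"
    by eventually_elim auto
  define J where "J = (\<integral>\<omega>. Re (F \<omega>) \<partial>gauss_seq)"
  \<comment> \<open>\<open>F\<close> is complex-valued; replacing it by its real part almost
    everywhere makes a strict comparison of real integrals possible.\<close>
  have "(\<integral>\<omega>. F \<omega> \<partial>gauss_seq) = (\<integral>\<omega>. of_real (Re (F \<omega>)) \<partial>gauss_seq)"
    using AEF Fint by (intro integral_cong_AE) (auto simp: borel_measurable_integrable)
  then have FJ: "(\<integral>\<omega>. F \<omega> \<partial>gauss_seq) = of_real J" by (simp add: J_def)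
  \<comment> \<open>A function positive almost everywhere has a positive integral, since the whole
    space has measure \<open>1\<close> and is not null.\<close>
  have "(\<integral>\<omega>. 0 \<partial>(gauss_seq :: (nat \<Rightarrow> real^'q) measure)) < J"
    unfolding J_def
    using AEF Fint by (intro G.integral_less_AE_space) (auto simp: G.emeasure_space_1)
  then have J: "J > 0" by simp
  have "P_kernel U k h X T = of_real (h powr (- (real (k + 1) * real CARD('q) / 2) - real CARD('m)) * (K * J))"
    unfolding P_kernel_def integrand by (simp add: I FJ)
  moreover have "h powr (- (real (k + 1) * real CARD('q) / 2) - real CARD('m)) * (K * J) > 0"
    using h K J by simp
  ultimately show "P_kernel U k h X T \<in> \<real> \<and> Re (P_kernel U k h X T) > 0"
    by (simp only: Re_complex_of_real Reals_of_real simp_thms)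
qed

end
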